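(* Let $\mathcal{J}\subset R_\sigma=\mathbf{K}[\sigma^\vee\cap M]$ be an ideal. For $v_1,v_2\in\sigma$ write $v_1\sim v_2$ if $\mathrm{In}_{v_1}(\mathcal{J})=\mathrm{In}_{v_2}(\mathcal{J})$. Then the closures (with respect to the usual topology of $N_{\mathbf{R}}\simeq\mathbf{R}^n$) of the equivalence classes of the relation $\sim$ on $\sigma$ define a polyhedral fan which is a subdivision of $\sigma$.
   Context: $\mathbf{K}$ is a perfect field (no assumption on its characteristic). $N\simeq\mathbf{Z}^n$ is a free abelian group of rank $n$, $M\simeq\mathbf{Z}^n$ is its dual lattice, $N_{\mathbf{R}}=N\otimes_{\mathbf{Z}}\mathbf{R}$ and $M_{\mathbf{R}}=M\otimes_{\mathbf{Z}}\mathbf{R}$, both identified with $\mathbf{R}^n$, and $v\cdot\alpha$ denotes the duality pairing (scalar product). $\sigma\subset N_{\mathbf{R}}$ is a strongly convex rational polyhedral cone of dimension $n$, and $\sigma^\vee\subset M_{\mathbf{R}}$ is its dual cone. $R_\sigma=\mathbf{K}[\sigma^\vee\cap M]$ is the semigroup algebra; each $f\in R_\sigma$ is written uniquely as a finite sum $f=\sum_{\alpha\in\sigma^\vee\cap M}a_\alpha\mathbf{x}^\alpha$ with $a_\alpha\in\mathbf{K}$, and $\mathrm{Supp}(f)=\{\alpha: a_\alpha\neq 0\}$. For $v\in\sigma$ and $f\neq 0$: $\nu_v(f)=\min\{v\cdot\alpha:\alpha\in\mathrm{Supp}(f)\}\in\mathbf{R}$ and $\mathrm{In}_v(f)=\sum_{\alpha\in\mathrm{Supp}(f),\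 v\cdot\alpha=\nu_v(f)}a_\alpha\mathbf{x}^\alpha$; also $\nu_v(0)=\infty$ and $\mathrm{In}_v(0)=0$. For an ideal $\mathcal{J}\subset R_\sigma$, the initial ideal $\mathrm{In}_v(\mathcal{J})$ is the ideal of $R_\sigma$ generated by $\{\mathrm{In}_v(f): f\in\mathcal{J}\}$.
   Formalization: The fan is taken to be the maximal closures and their faces; closures of classes inside the boundary of σ are shown to be rational cones but need not belong to it: for (1-x, y+z) in K[x,y,z] the closure {v1=0, v2≤v3} is not a face of σ. *)

theory Defs
  imports
    "HOL-Analysis.Analysis"
    "HOL-Library.Poly_Mapping"
    "HOL-Algebra.QuotRing"
    "HOL-Computational_Algebra.Computational_Algebra"
begin

text \<open>
  \<^typ>\<open>int ^ 'n\<close> serves both as the lattice \<open>N\<close> and as its dual lattice \<open>M\<close>, and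
  \<^typ>\<open>real ^ 'n\<close> both as \<open>N\<^sub>R\<close> and as \<open>M\<^sub>R\<close>; the duality pairing is the
  standard inner product.
\<close>

definition perfect_field :: "'k::field itself \<Rightarrow> bool" where
  "perfect_field _ \<longleftrightarrow> CHAR('k) = 0 \<or> surj (\<lambda>x::'k. x ^ CHAR('k))"

definition real_vec :: "int ^ 'n \<Rightarrow> real ^ 'n" where
  "real_vec \<alpha> = (\<chi> i. of_int (\<alpha> $ i))"

definition rational_polyhedral_cone :: "(real ^ 'n) set \<Rightarrow> bool" where
  "rational_polyhedral_cone C \<longleftrightarrow>
     (\<exists>B :: (int ^ 'n) set. finite B \<and> C = convex_cone hull (real_vec ` B))"

definition strongly_convex :: "'a::real_vector set \<Rightarrow> bool" where
  "strongly_convex C \<longleftrightarrow> C \<inter> uminus ` C = {0}"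

definition dual_cone :: "'a::real_inner set \<Rightarrow> 'a set" where
  "dual_cone C = {u. \<forall>v\<in>C. 0 \<le> v \<bullet> u}"

text \<open>
  The group algebra \<open>K[M]\<close> is the type \<^typ>\<open>(int ^ 'n) \<Rightarrow>\<^sub>0 'k\<close> with the convolution
  product; \<^term>\<open>Poly_Mapping.single \<alpha> a\<close> is the term \<open>a x\<^sup>\<alpha>\<close> and
  \<^term>\<open>Poly_Mapping.keys f\<close> is the support of \<open>f\<close>.
\<close>

definition toric_ring :: "(real ^ 'n) set \<Rightarrow> ((int ^ 'n) \<Rightarrow>\<^sub>0 'k::field) ring" where
  "toric_ring \<sigma> =
     \<lparr> carrier = {f. real_vec ` Poly_Mapping.keys f \<subseteq> dual_cone \<sigma>},
       mult = (*), one = 1, zero = 0, add = (+) \<rparr>"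

lemma real_vec_add: "real_vec (\<alpha> + \<beta>) = real_vec \<alpha> + real_vec \<beta>"
  by (simp add: real_vec_def vec_eq_iff)

lemma real_vec_zero: "real_vec 0 = 0"
  by (simp add: real_vec_def vec_eq_iff)

lemma cring_toric_ring: "cring (toric_ring \<sigma> :: ((int ^ 'n) \<Rightarrow>\<^sub>0 'k::field) ring)"
proof -
  let ?R = "toric_ring \<sigma> :: ((int ^ 'n) \<Rightarrow>\<^sub>0 'k) ring"
  have add: "f + g \<in> carrier ?R" if "f \<in> carrier ?R" "g \<in> carrier ?R" for f g
    using that Poly_Mapping.keys_add[of f g] by (simp add: toric_ring_def) blast
  have mult: "f * g \<in> carrier ?R" if that_f: "f \<in> carrier ?R" and that_g: "g \<in> carrier ?R" for f g
  proof -
    have "real_vec \<gamma> \<in> dual_cone \<sigma>" if g: "\<gamma> \<in> Poly_Mapping.keys (f * g)" for \<gamma>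
    proof -
      obtain \<alpha> \<beta> where ab: "\<gamma> = \<alpha> + \<beta>" "\<alpha> \<in> Poly_Mapping.keys f" "\<beta> \<in> Poly_Mapping.keys g"
        using keys_mult[of f g] g by blast
      then have "real_vec \<alpha> \<in> dual_cone \<sigma>" "real_vec \<beta> \<in> dual_cone \<sigma>"
        using that_f that_g by (auto simp: toric_ring_def)
      then show ?thesis by (simp add: ab dual_cone_def real_vec_add inner_add_right)
    qed
    then show ?thesis by (auto simp: toric_ring_def)
  qed
  have zero: "0 \<in> carrier ?R" by (simp add: toric_ring_def)
  have one: "1 \<in> carrier ?R"
    by (simp add: toric_ring_def dual_cone_def real_vec_zero)
  have neg: "- f \<in> carrier ?R" if "f \<in> carrier ?R" for f
    using that by (simp add: toric_ring_def keys_minus)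
  show ?thesis
  proof (rule cringI)
    show "abelian_group ?R"
    proof (rule abelian_groupI)
      fix x assume x: "x \<in> carrier ?R"
      show "\<exists>y\<in>carrier ?R. y \<oplus>\<^bsub>?R\<^esub> x = \<zero>\<^bsub>?R\<^esub>"
        using neg[OF x] by (intro bexI[of _ "- x"]) (simp_all add: toric_ring_def)
    qed (use add zero in \<open>auto simp: toric_ring_def add_ac\<close>)
    show "comm_monoid ?R"
      by (rule comm_monoidI) (use mult one in \<open>auto simp: toric_ring_def mult_ac\<close>)
  qed (simp add: toric_ring_def distrib_right)
qed

definition weight_order :: "real ^ 'n \<Rightarrow> ((int ^ 'n) \<Rightarrow>\<^sub>0 'k::field) \<Rightarrow> ereal" where
  "weight_order v f =
     (if f = 0 then \<infinity>
      else ereal (Min ((\<lambda>\<alpha>. v \<bullet> real_vec \<alpha>) ` Poly_Mapping.keys f)))"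

definition initial_form ::
    "real ^ 'n \<Rightarrow> ((int ^ 'n) \<Rightarrow>\<^sub>0 'k::field) \<Rightarrow> ((int ^ 'n) \<Rightarrow>\<^sub>0 'k)" where
  "initial_form v f =
     (\<Sum>\<alpha> | \<alpha> \<in> Poly_Mapping.keys f \<and> ereal (v \<bullet> real_vec \<alpha>) = weight_order v f.
        Poly_Mapping.single \<alpha> (Poly_Mapping.lookup f \<alpha>))"

definition initial_ideal ::
    "(real ^ 'n) set \<Rightarrow> real ^ 'n \<Rightarrow> ((int ^ 'n) \<Rightarrow>\<^sub>0 'k::field) set \<Rightarrow> ((int ^ 'n) \<Rightarrow>\<^sub>0 'k) set" where
  "initial_ideal \<sigma> v J = genideal (toric_ring \<sigma>) (initial_form v ` J)"

definition initial_equiv ::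
    "(real ^ 'n) set \<Rightarrow> ((int ^ 'n) \<Rightarrow>\<^sub>0 'k::field) set \<Rightarrow> ((real ^ 'n) \<times> (real ^ 'n)) set" where
  "initial_equiv \<sigma> J =
     {(v, w). v \<in> \<sigma> \<and> w \<in> \<sigma> \<and> initial_ideal \<sigma> v J = initial_ideal \<sigma> w J}"

definition class_closures ::
    "(real ^ 'n) set \<Rightarrow> ((int ^ 'n) \<Rightarrow>\<^sub>0 'k::field) set \<Rightarrow> (real ^ 'n) set set" where
  "class_closures \<sigma> J = closure ` (\<sigma> // initial_equiv \<sigma> J)"

text \<open>
  The library relation \<open>face_of\<close> also counts the empty set as a face; it is excluded.
\<close>

definition polyhedral_fan :: "(real ^ 'n) set set \<Rightarrow> bool" where
  "polyhedral_fan \<Sigma> \<longleftrightarrow>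
     finite \<Sigma> \<and>
     (\<forall>C\<in>\<Sigma>. rational_polyhedral_cone C \<and> strongly_convex C) \<and>
     (\<forall>C\<in>\<Sigma>. \<forall>F. F face_of C \<and> F \<noteq> {} \<longrightarrow> F \<in> \<Sigma>) \<and>
     (\<forall>C\<in>\<Sigma>. \<forall>D\<in>\<Sigma>. (C \<inter> D) face_of C \<and> (C \<inter> D) face_of D)"

definition subdivides :: "(real ^ 'n) set set \<Rightarrow> (real ^ 'n) set \<Rightarrow> bool" where
  "subdivides \<Sigma> \<sigma> \<longleftrightarrow> \<Union>\<Sigma> = \<sigma>"

text \<open>
  A family \<open>\<C>\<close> of cones defines the collection of all faces of its inclusion-maximal
  members. The closures themselves are in general not closed under taking faces (for the zero
  ideal the only closure is \<open>\<sigma>\<close>), so faces have to be added. Only maximal members are used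
  because a class contained in the boundary of \<open>\<sigma>\<close> can have a closure that is not a face of
  the neighbouring ones: for \<open>(1 - x, y + z)\<close> in \<open>K[x, y, z]\<close> the vectors with
  \<open>v\<^sub>1 > 0\<close> form one class, while \<open>v\<^sub>1 = 0\<close> splits according to the sign of
  \<open>v\<^sub>2 - v\<^sub>3\<close>. If \<open>\<C>\<close> together with all its faces is a fan, it is this collection.
\<close>

definition fan_defined_by :: "(real ^ 'n) set set \<Rightarrow> (real ^ 'n) set set" where
  "fan_defined_by \<C> =
     {F. F \<noteq> {} \<and> (\<exists>C\<in>\<C>. (\<forall>D\<in>\<C>. \<not> C \<subset> D) \<and> F face_of C)}"

end

theory Submission
  imports Defs
begin

text \<open>
  Write \<open>\<kappa> v\<close> for the initial ideal \<open>In\<^sub>v(J)\<close>, with \<open>v\<close> allowed to be any real vector.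
  Four facts about \<open>\<kappa>\<close> carry the proof. What is used of them is collected in the locale
  \<open>convex_classes\<close>, inside which only convex geometry is left.

  \<^item> \<^emph>\<open>Finitely many sign cells.\<close> There are finitely many lattice vectors \<open>h\<close> such that \<open>\<kappa> v\<close> depends
    only on the signs of the numbers \<open>v \<bullet> h\<close> (\<open>finitely_many_sign_cells\<close>). They are the differences
    of exponents in a finite subset of \<open>J\<close> whose initial forms generate \<open>In\<^sub>v(J)\<close> for all \<open>v\<close> at once
    (\<open>exists_universal_basis\<close>). Division with respect to \<open>v\<close> need not terminate in the semigroup
    algebra, so each polynomial is accompanied by a bound on its degree, which amounts to
    homogenising \<open>J\<close>: below a given degree there are only finitely many monomials. Dickson's lemma
    then leaves room for only finitely many choices of leading terms.

  \<^item> \<^emph>\<open>Perturbation.\<close> \<open>In\<^bsub>v + \<epsilon>w\<^esub>(J) = In\<^sub>w(In\<^sub>v(J))\<close> for all small \<open>\<epsilon> > 0\<close>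
    (\<open>initial_space_perturbed\<close>).

  \<^item> \<^emph>\<open>Convexity.\<close> If \<open>\<kappa> u = \<kappa> u' = I\<close> for \<open>u, u'\<close> in \<open>\<sigma>\<close>, then \<open>\<kappa>\<close> equals \<open>I\<close> between \<open>u\<close> and \<open>u'\<close>
    (\<open>initial_space_convex\<close>). By perturbation both points may be moved into the open segment, where
    each of them dominates a positive multiple of the other on the dual cone. Choose monomials that
    span a complement of \<open>I\<close>. Every polynomial is congruent modulo \<open>J\<close> to some \<open>r + h\<close> with \<open>r\<close> in
    this complement and \<open>h\<close> of high order for \<open>u\<close>, hence also for \<open>u'\<close>. For an element of \<open>I\<close> that is
    homogeneous for both weights, the remainder \<open>r\<close> has larger order for both, since otherwise an
    initial part of \<open>r\<close> would lie in \<open>I\<close>. So the element is an initial form of a member of \<open>J\<close> for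
    every weight in between.

  \<^item> \<^emph>\<open>Collapse.\<close> If a segment through an interior point \<open>z\<close> of \<open>\<sigma>\<close> lies in the closure of one class,
    then \<open>\<kappa>\<close> is constant on it near \<open>z\<close> (\<open>initial_space_collapse\<close>): by the same complement argument
    \<open>In\<^sub>z(J)\<close> is homogeneous for the direction of the segment.

  By the first and the third fact the closure of a class is a convex finite union of rational
  polyhedral cones, hence a rational polyhedral cone. By perturbation every class lies in the closure
  of a class that meets the interior of \<open>\<sigma>\<close>, so the inclusion-maximal closures belong to such
  classes, and it remains to see that the closures of two of them, \<open>E\<close> and \<open>E'\<close>, meet in a common
  face (\<open>closure_cls_Int_face\<close>). Let \<open>z\<close> be in both closures and in the interior of a segment of
  direction \<open>d\<close> inside the closure of \<open>E\<close>. For \<open>v\<close> in the interior of \<open>\<sigma>\<close> consider the class that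
  contains \<open>z + \<epsilon>v\<close> for all small \<open>\<epsilon> > 0\<close>, the germ of \<open>z\<close> at \<open>v\<close>. Whether the closure of this germ contains a
  segment of direction \<open>d\<close> around \<open>z\<close> does not depend on \<open>v\<close>: this is locally constant by collapse and
  perturbation, and the interior of \<open>\<sigma>\<close> is connected. It holds for \<open>v\<close> in \<open>E\<close>, so it holds for \<open>v\<close> in
  \<open>E'\<close>, and the segment runs inside the closure of \<open>E'\<close>. Collapse is needed at interior points
  only; at a boundary point \<open>z\<close> it may fail, because there the classes may subdivide a face of the
  surrounding closures further.
\<close>

section \<open>Initial spaces of additive groups of polynomials\<close>

abbreviation lookup :: "('a \<Rightarrow>\<^sub>0 'k::zero) \<Rightarrow> 'a \<Rightarrow> 'k" where "lookup \<equiv> Poly_Mapping.lookup"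

abbreviation keys :: "('a \<Rightarrow>\<^sub>0 'k::zero) \<Rightarrow> 'a set" where "keys \<equiv> Poly_Mapping.keys"

abbreviation single :: "'a \<Rightarrow> 'k \<Rightarrow> 'a \<Rightarrow>\<^sub>0 'k::zero" where "single \<equiv> Poly_Mapping.single"

lift_definition part :: "('a \<Rightarrow> bool) \<Rightarrow> ('a \<Rightarrow>\<^sub>0 'k) \<Rightarrow> ('a \<Rightarrow>\<^sub>0 'k::zero)"
  is "\<lambda>P f a. if P a then f a else 0"
proof -
  fix P :: "'a \<Rightarrow> bool" and f :: "'a \<Rightarrow> 'k"
  assume "finite {a. f a \<noteq> 0}"
  then show "finite {a. (if P a then f a else 0) \<noteq> 0}"
    by (rule rev_finite_subset) (auto split: if_splits)
qed

lemma lookup_part: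
  "lookup (part P f) \<alpha> = (if P \<alpha> then lookup f \<alpha> else 0)"
  by transfer simp

lemma keys_part: "keys (part P f) = {\<alpha> \<in> keys f. P \<alpha>}"
  by (auto simp: in_keys_iff lookup_part split: if_splits)

lemma exists_least_key:
  fixes w :: "'a \<Rightarrow> real"
  assumes "keys f \<noteq> {}"
  obtains \<mu> where "\<mu> \<in> keys f" "\<And>\<alpha>. \<alpha> \<in> keys f \<Longrightarrow> w \<mu> \<le> w \<alpha>"
proof -
  have "Min (w ` keys f) \<in> w ` keys f"
    using assms by (intro Min_in) auto
  then obtain \<mu> where "\<mu> \<in> keys f" "w \<mu> = Min (w ` keys f)"
    by auto
  then show ?thesis using that by simp
qed

definition additive_group :: "'b::ab_group_add set \<Rightarrow> bool" where
  "additive_group V \<longleftrightarrow> 0 \<in> V \<and> (\<forall>f\<in>V. \<forall>g\<in>V. f - g \<in> V)"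

lemma additive_groupD:
  assumes "additive_group V"
  shows "0 \<in> V" "f \<in> V \<Longrightarrow> g \<in> V \<Longrightarrow> f - g \<in> V"
    "f \<in> V \<Longrightarrow> - f \<in> V" "f \<in> V \<Longrightarrow> g \<in> V \<Longrightarrow> f + g \<in> V"
proof -
  show zero: "0 \<in> V" and diff: "f \<in> V \<Longrightarrow> g \<in> V \<Longrightarrow> f - g \<in> V" for f g
    using assms by (auto simp: additive_group_def)
  show minus: "f \<in> V \<Longrightarrow> - f \<in> V" for f
    using diff[OF zero, of f] by simp
  show "f \<in> V \<Longrightarrow> g \<in> V \<Longrightarrow> f + g \<in> V"
    using diff[of f "- g"] minus[of g] by simp
qed

text \<open>
  The parts of \<open>g\<close> on the fibres of \<open>\<kappa>\<close> add up to \<open>g\<close>. Taking pairs of weights for \<open>\<kappa>\<close>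
  reduces statements to bihomogeneous elements, and the identity reduces them to monomials.
\<close>

lemma mem_if_parts_mem:
  fixes g :: "'a \<Rightarrow>\<^sub>0 'k::ab_group_add"
  assumes V: "additive_group V" and parts: "\<And>c. part (\<lambda>\<alpha>. \<kappa> \<alpha> = c) g \<in> V"
  shows "g \<in> V"
  using parts
proof (induction "card (\<kappa> ` keys g)" arbitrary: g rule: less_induct)
  case less
  show ?case
  proof (cases "g = 0")
    case True
    then show ?thesis using V by (simp add: additive_groupD)
  next
    case False
    then obtain \<alpha> where \<alpha>: "\<alpha> \<in> keys g" by (metis all_not_in_conv keys_eq_empty)
    define p where "p = part (\<lambda>\<beta>. \<kappa> \<beta> = \<kappa> \<alpha>) g"
    have p: "p \<in> V" using less.prems by (simp add: p_def)
    have "\<kappa> ` keys (g - p) \<subset> \<kappa> ` keys g"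
    proof
      show "\<kappa> ` keys (g - p) \<subseteq> \<kappa> ` keys g"
        by (auto simp: p_def in_keys_iff lookup_part lookup_minus split: if_splits)
      have "\<kappa> \<alpha> \<notin> \<kappa> ` keys (g - p)"
        by (auto simp: p_def in_keys_iff lookup_part lookup_minus split: if_splits)
      then show "\<kappa> ` keys (g - p) \<noteq> \<kappa> ` keys g"
        using \<alpha> by blast
    qed
    then have "card (\<kappa> ` keys (g - p)) < card (\<kappa> ` keys g)"
      by (simp add: psubset_card_mono)
    moreover have "part (\<lambda>\<beta>. \<kappa> \<beta> = c) (g - p) \<in> V" for c
    proof (cases "c = \<kappa> \<alpha>")
      case True
      then have "part (\<lambda>\<beta>. \<kappa> \<beta> = c) (g - p) = 0"
        by (intro poly_mapping_eqI) (simp add: p_def lookup_part lookup_minus)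
      then show ?thesis using V by (simp add: additive_groupD)
    next
      case False
      then have "part (\<lambda>\<beta>. \<kappa> \<beta> = c) (g - p) = part (\<lambda>\<beta>. \<kappa> \<beta> = c) g"
        by (intro poly_mapping_eqI) (simp add: p_def lookup_part lookup_minus)
      then show ?thesis using less.prems by simp
    qed
    ultimately have "g - p \<in> V" using less.hyps by blast
    then show ?thesis using additive_groupD(4)[OF V _ p, of "g - p"] by simp
  qed
qed

text \<open>
  For an additive group \<open>V\<close> this is the additive span of the initial forms of the elements of \<open>V\<close>,
  described through its homogeneous parts: the part of weight \<open>a\<close> is the part of weight \<open>a\<close> of some
  element of \<open>V\<close> of order at least \<open>a\<close>. An element of order greater than \<open>a\<close> contributes \<open>0\<close>, so cancellation
  in sums of initial forms needs no separate treatment.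
\<close>

definition initial_space ::
    "('a \<Rightarrow> real) \<Rightarrow> ('a \<Rightarrow>\<^sub>0 'k::ab_group_add) set \<Rightarrow> ('a \<Rightarrow>\<^sub>0 'k) set" where
  "initial_space w V = {g. \<forall>a. \<exists>f\<in>V.
     (\<forall>\<alpha>. w \<alpha> < a \<longrightarrow> lookup f \<alpha> = 0) \<and>
     (\<forall>\<alpha>. w \<alpha> = a \<longrightarrow> lookup f \<alpha> = lookup g \<alpha>)}"

lemma initial_spaceE:
  assumes "g \<in> initial_space w V"
  obtains f where "f \<in> V" "\<And>\<alpha>. w \<alpha> < a \<Longrightarrow> lookup f \<alpha> = 0"
    "\<And>\<alpha>. w \<alpha> = a \<Longrightarrow> lookup f \<alpha> = lookup g \<alpha>"
proof -
  from assms have "\<exists>f\<in>V. (\<forall>\<alpha>. w \<alpha> < a \<longrightarrow> lookup f \<alpha> = 0) \<and>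
      (\<forall>\<alpha>. w \<alpha> = a \<longrightarrow> lookup f \<alpha> = lookup g \<alpha>)"
    unfolding initial_space_def by blast
  then show ?thesis using that by blast
qed

lemma homogeneous_mem_initial_space:
  assumes V: "additive_group V" and f: "f \<in> V"
    and low: "\<And>\<alpha>. w \<alpha> < a \<Longrightarrow> lookup f \<alpha> = 0"
    and eq: "\<And>\<alpha>. w \<alpha> = a \<Longrightarrow> lookup f \<alpha> = lookup g \<alpha>"
    and g: "\<And>\<alpha>. w \<alpha> \<noteq> a \<Longrightarrow> lookup g \<alpha> = 0"
  shows "g \<in> initial_space w V"
  unfolding initial_space_def
proof (intro CollectI allI)
  fix b
  show "\<exists>f\<in>V. (\<forall>\<alpha>. w \<alpha> < b \<longrightarrow> lookup f \<alpha> = 0) \<and>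
      (\<forall>\<alpha>. w \<alpha> = b \<longrightarrow> lookup f \<alpha> = lookup g \<alpha>)"
  proof (cases "b = a")
    case True
    then show ?thesis using f low eq by blast
  next
    case False
    then show ?thesis using g additive_groupD(1)[OF V] by (intro bexI[of _ 0]) auto
  qed
qed

lemma additive_group_initial_space:
  assumes V: "additive_group V"
  shows "additive_group (initial_space w V)"
  unfolding additive_group_def
proof (intro conjI ballI)
  show "0 \<in> initial_space w V"
    by (rule homogeneous_mem_initial_space[OF V, of 0]) (auto simp: additive_groupD[OF V])
next
  fix g h assume g: "g \<in> initial_space w V" and h: "h \<in> initial_space w V"
  show "g - h \<in> initial_space w V"
    unfolding initial_space_def
  proof (intro CollectI allI)
    fix a
    obtain f where "f \<in> V" "\<And>\<alpha>. w \<alpha> < a \<Longrightarrow> lookup f \<alpha> = 0"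
      "\<And>\<alpha>. w \<alpha> = a \<Longrightarrow> lookup f \<alpha> = lookup g \<alpha>"
      by (rule initial_spaceE[OF g, of a]) (rule that)
    moreover obtain f' where "f' \<in> V" "\<And>\<alpha>. w \<alpha> < a \<Longrightarrow> lookup f' \<alpha> = 0"
      "\<And>\<alpha>. w \<alpha> = a \<Longrightarrow> lookup f' \<alpha> = lookup h \<alpha>"
      by (rule initial_spaceE[OF h, of a]) (rule that)
    ultimately show "\<exists>f\<in>V. (\<forall>\<alpha>. w \<alpha> < a \<longrightarrow> lookup f \<alpha> = 0) \<and>
      (\<forall>\<alpha>. w \<alpha> = a \<longrightarrow> lookup f \<alpha> = lookup (g - h) \<alpha>)"
      by (intro bexI[of _ "f - f'"]) (auto simp: lookup_minus additive_groupD[OF V])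
  qed
qed

definition supported_on :: "'a set \<Rightarrow> ('a \<Rightarrow>\<^sub>0 'k::zero) set" where
  "supported_on S = {f. keys f \<subseteq> S}"

lemma supported_on_iff:
  "f \<in> supported_on S \<longleftrightarrow> (\<forall>\<alpha>. \<alpha> \<notin> S \<longrightarrow> lookup f \<alpha> = 0)"
  by (auto simp: supported_on_def in_keys_iff)

lemma additive_group_supported_on:
  "additive_group (supported_on S :: ('a \<Rightarrow>\<^sub>0 'k::ab_group_add) set)"
  by (auto simp: additive_group_def supported_on_iff lookup_minus)

lemma initial_space_supported_on:
  assumes "V \<subseteq> supported_on S"
  shows "initial_space w V \<subseteq> supported_on S"
proof
  fix g assume g: "g \<in> initial_space w V"
  have "lookup g \<alpha> = 0" if "\<alpha> \<notin> S" for \<alpha>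
    using initial_spaceE[OF g, of "w \<alpha>"] that assms by (metis subsetD supported_on_iff)
  then show "g \<in> supported_on S" by (simp add: supported_on_iff)
qed

definition homogeneous :: "('a \<Rightarrow> real) \<Rightarrow> ('a \<Rightarrow>\<^sub>0 'k::zero) set \<Rightarrow> bool" where
  "homogeneous w V \<longleftrightarrow> (\<forall>g\<in>V. \<forall>a. part (\<lambda>\<alpha>. w \<alpha> = a) g \<in> V)"

lemma homogeneous_initial_space:
  assumes V: "additive_group V"
  shows "homogeneous w (initial_space w V)"
  unfolding homogeneous_def
proof (intro ballI allI)
  fix g a assume g: "g \<in> initial_space w V"
  obtain f where f: "f \<in> V" "\<And>\<alpha>. w \<alpha> < a \<Longrightarrow> lookup f \<alpha> = 0"
      "\<And>\<alpha>. w \<alpha> = a \<Longrightarrow> lookup f \<alpha> = lookup g \<alpha>"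
      by (rule initial_spaceE[OF g, of a]) (rule that)
  show "part (\<lambda>\<alpha>. w \<alpha> = a) g \<in> initial_space w V"
    by (rule homogeneous_mem_initial_space[OF V f(1,2)]) (auto simp: f lookup_part)
qed

lemma homogeneous_initial_space_other:
  assumes "homogeneous u V"
  shows "homogeneous u (initial_space w V)"
  unfolding homogeneous_def
proof (intro ballI allI)
  fix g b assume g: "g \<in> initial_space w V"
  show "part (\<lambda>\<alpha>. u \<alpha> = b) g \<in> initial_space w V"
    unfolding initial_space_def
  proof (intro CollectI allI)
    fix a
    obtain f where f: "f \<in> V" "\<And>\<alpha>. w \<alpha> < a \<Longrightarrow> lookup f \<alpha> = 0"
      "\<And>\<alpha>. w \<alpha> = a \<Longrightarrow> lookup f \<alpha> = lookup g \<alpha>"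
      by (rule initial_spaceE[OF g, of a]) (rule that)
    have "part (\<lambda>\<alpha>. u \<alpha> = b) f \<in> V" using assms f(1) by (auto simp: homogeneous_def)
    then show "\<exists>f\<in>V. (\<forall>\<alpha>. w \<alpha> < a \<longrightarrow> lookup f \<alpha> = 0) \<and>
        (\<forall>\<alpha>. w \<alpha> = a \<longrightarrow> lookup f \<alpha>
            = lookup (part (\<lambda>\<alpha>. u \<alpha> = b) g) \<alpha>)"
      using f by (intro bexI[of _ "part (\<lambda>\<alpha>. u \<alpha> = b) f"]) (auto simp: lookup_part)
  qed
qed

lemma initial_space_homogeneous:
  assumes V: "additive_group V" and h: "homogeneous w V"
  shows "initial_space w V = V"
proof
  show "V \<subseteq> initial_space w V"
  proof
    fix g assume "g \<in> V"
    then have "part (\<lambda>\<alpha>. w \<alpha> = a) g \<in> V" for a using h by (simp add: homogeneous_def)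
    then show "g \<in> initial_space w V"
      unfolding initial_space_def
      by (intro CollectI allI, rule_tac x="part (\<lambda>\<alpha>. w \<alpha> = a) g" in bexI)
        (auto simp: lookup_part)
  qed
  show "initial_space w V \<subseteq> V"
  proof
    fix g assume g: "g \<in> initial_space w V"
    have "part (\<lambda>\<alpha>. w \<alpha> = a) g \<in> V" for a
    proof -
      obtain f where f: "f \<in> V" "\<And>\<alpha>. w \<alpha> = a \<Longrightarrow> lookup f \<alpha> = lookup g \<alpha>"
        by (rule initial_spaceE[OF g, of a]) (rule that)
      have "part (\<lambda>\<alpha>. w \<alpha> = a) f = part (\<lambda>\<alpha>. w \<alpha> = a) g"
        by (intro poly_mapping_eqI) (auto simp: lookup_part f)
      then show ?thesis using h f(1) by (metis homogeneous_def)
    qed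
    then show "g \<in> V" by (rule mem_if_parts_mem[OF V])
  qed
qed

lemma homogeneous_combination:
  assumes V: "additive_group V" and u: "homogeneous u V" "homogeneous u' V"
    and w: "\<And>\<alpha>. w \<alpha> = s * u \<alpha> + t * u' \<alpha>"
  shows "homogeneous w V"
  unfolding homogeneous_def
proof (intro ballI allI)
  fix g a assume g: "g \<in> V"
  show "part (\<lambda>\<alpha>. w \<alpha> = a) g \<in> V"
  proof (rule mem_if_parts_mem[OF V])
    fix c :: "real \<times> real"
    obtain b b' where c: "c = (b, b')" by (cases c)
    let ?p = "part (\<lambda>\<alpha>. u \<alpha> = b) (part (\<lambda>\<alpha>. u' \<alpha> = b') g)"
    have p: "?p \<in> V" using u g by (simp add: homogeneous_def)
    have "part (\<lambda>\<alpha>. (u \<alpha>, u' \<alpha>) = c) (part (\<lambda>\<alpha>. w \<alpha> = a) g) = (if s * b + t * b' = a then ?p else 0)"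
      by (intro poly_mapping_eqI) (auto simp: lookup_part c w)
    then show "part (\<lambda>\<alpha>. (u \<alpha>, u' \<alpha>) = c) (part (\<lambda>\<alpha>. w \<alpha> = a) g) \<in> V"
      using p additive_groupD(1)[OF V] by simp
  qed
qed

section \<open>Monomial complements and reduction\<close>

definition meets_trivially :: "('a \<Rightarrow>\<^sub>0 'k::zero) set \<Rightarrow> 'a set \<Rightarrow> bool" where
  "meets_trivially V T \<longleftrightarrow> V \<inter> supported_on T \<subseteq> {0}"

definition spans_with :: "'a set \<Rightarrow> ('a \<Rightarrow>\<^sub>0 'k::ab_group_add) set \<Rightarrow> 'a set \<Rightarrow> bool" where
  "spans_with S V T \<longleftrightarrow> (\<forall>f\<in>supported_on S. \<exists>g\<in>V. f - g \<in> supported_on T)"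

lemma additive_group_plus_supported:
  fixes V :: "('a \<Rightarrow>\<^sub>0 'k::ab_group_add) set"
  assumes V: "additive_group V"
  shows "additive_group {f. \<exists>g\<in>V. f - g \<in> supported_on T}" (is "additive_group ?U")
  unfolding additive_group_def
proof (intro conjI ballI)
  show "0 \<in> ?U"
    using additive_groupD(1)[OF V] additive_groupD(1)[OF additive_group_supported_on[of T]] by force
  fix f f' assume "f \<in> ?U" "f' \<in> ?U"
  then obtain g g' where *: "g \<in> V" "f - g \<in> supported_on T" "g' \<in> V" "f' - g' \<in> supported_on T"
    by auto
  have "(f - g) - (f' - g') \<in> supported_on T"
    by (rule additive_groupD(2)[OF additive_group_supported_on *(2,4)])
  moreover have "(f - g) - (f' - g') = (f - f') - (g - g')" by simp
  ultimately show "f - f' \<in> ?U" using additive_groupD(2)[OF V *(1,3)] by auto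
qed

text \<open>
  The monomials in \<open>T\<close> span a complement of \<open>V\<close>, which leaves no room for a larger group that still
  avoids them. All equalities of initial spaces below are obtained in this way.
\<close>

lemma eq_if_common_complement:
  assumes V: "additive_group V'" and "V \<subseteq> V'" "V' \<subseteq> supported_on S"
    and "spans_with S V T" "meets_trivially V' T"
  shows "V = V'"
proof -
  have "f \<in> V" if f: "f \<in> V'" for f
  proof -
    obtain g where g: "g \<in> V" "f - g \<in> supported_on T"
      using assms(3,4) f unfolding spans_with_def by blast
    then have "f - g \<in> V'" using assms f additive_groupD(2)[OF V] by blast
    then have "f - g = 0" using g assms by (auto simp: meets_trivially_def)
    then show ?thesis using g by simp
  qed
  then show ?thesis using assms by blast
qed

text \<open>
  Closure under scalars in terms of coefficients, independent of a multiplication on the exponents.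
\<close>

definition scale_closed :: "('a \<Rightarrow>\<^sub>0 'k::mult_zero) set \<Rightarrow> bool" where
  "scale_closed V \<longleftrightarrow> (\<forall>f\<in>V. \<forall>c. \<exists>g\<in>V. \<forall>\<alpha>. lookup g \<alpha> = c * lookup f \<alpha>)"

lemma scale_closed_initial_space:
  fixes V :: "('a \<Rightarrow>\<^sub>0 'k::field) set"
  assumes V: "scale_closed V"
  shows "scale_closed (initial_space w V)"
  unfolding scale_closed_def
proof (intro ballI allI)
  fix g and c :: 'k assume g: "g \<in> initial_space w V"
  define cg where "cg = Poly_Mapping.map ((*) c) g"
  have cg: "lookup cg \<alpha> = c * lookup g \<alpha>" for \<alpha>
    by (simp add: cg_def Poly_Mapping.map.rep_eq when_def)
  have "cg \<in> initial_space w V"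
    unfolding initial_space_def
  proof (intro CollectI allI)
    fix a
    obtain f where f: "f \<in> V" "\<And>\<alpha>. w \<alpha> < a \<Longrightarrow> lookup f \<alpha> = 0"
      "\<And>\<alpha>. w \<alpha> = a \<Longrightarrow> lookup f \<alpha> = lookup g \<alpha>"
      by (rule initial_spaceE[OF g, of a]) (rule that)
    obtain h where "h \<in> V" "\<And>\<alpha>. lookup h \<alpha> = c * lookup f \<alpha>"
      using V f(1) by (meson scale_closed_def)
    then show "\<exists>f\<in>V. (\<forall>\<alpha>. w \<alpha> < a \<longrightarrow> lookup f \<alpha> = 0) \<and>
        (\<forall>\<alpha>. w \<alpha> = a \<longrightarrow> lookup f \<alpha> = lookup cg \<alpha>)"
      using f cg by (intro bexI[of _ h]) auto
  qed
  then show "\<exists>h\<in>initial_space w V. \<forall>\<alpha>. lookup h \<alpha> = c * lookup g \<alpha>"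
    using cg by blast
qed

text \<open>
  A maximal set of monomials whose span avoids \<open>V\<close> works: for any further monomial, maximality puts
  into \<open>V\<close> an element that involves it, so the monomial is congruent modulo \<open>V\<close> to a combination of the
  chosen ones. Complements spanned by monomials are homogeneous for all weights simultaneously, which
  is what the comparison of several weights needs.
\<close>

lemma exists_monomial_complement:
  fixes V :: "('a \<Rightarrow>\<^sub>0 'k::field) set"
  assumes V: "additive_group V" "scale_closed V"
  obtains T where "T \<subseteq> S" "meets_trivially V T" "spans_with S V T"
proof -
  define \<A> where "\<A> = {T. T \<subseteq> S \<and> meets_trivially V T}"
  have "{} \<in> \<A>" by (auto simp: \<A>_def meets_trivially_def supported_on_def)
  moreover have "\<Union>\<C> \<in> \<A>" if ne: "\<C> \<noteq> {}" and ch: "subset.chain \<A> \<C>" for \<C>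
  proof -
    have "f = 0" if f: "f \<in> V" "keys f \<subseteq> \<Union>\<C>" for f
    proof -
      obtain X where "X \<in> \<C>" "keys f \<subseteq> X"
        using finite_subset_Union_chain[OF finite_keys f(2) ne ch] by blast
      then show ?thesis using f ch
        by (auto simp: subset.chain_def \<A>_def meets_trivially_def supported_on_def)
    qed
    moreover have "\<Union>\<C> \<subseteq> S" using ch by (auto simp: subset.chain_def \<A>_def)
    ultimately show ?thesis by (auto simp: \<A>_def meets_trivially_def supported_on_def)
  qed
  ultimately obtain T where T: "T \<in> \<A>" and max: "\<And>X. X \<in> \<A> \<Longrightarrow> T \<subseteq> X \<Longrightarrow> X = T"
    using subset_Zorn_nonempty[of \<A>] by blast
  define U where "U = {f. \<exists>g\<in>V. f - g \<in> supported_on T}"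
  have U: "additive_group U" unfolding U_def by (rule additive_group_plus_supported[OF V(1)])
  have single: "single \<alpha> c \<in> U" if \<alpha>: "\<alpha> \<in> S" for \<alpha> c
  proof (cases "\<alpha> \<in> T")
    case True
    then show ?thesis using additive_groupD(1)[OF V(1)]
      by (auto simp: U_def supported_on_def intro!: bexI[of _ 0] split: if_splits)
  next
    case False
    then have "insert \<alpha> T \<notin> \<A>" using max[of "insert \<alpha> T"] by auto
    then obtain f where f: "f \<in> V" "keys f \<subseteq> insert \<alpha> T" "f \<noteq> 0"
      using \<alpha> T by (auto simp: \<A>_def meets_trivially_def supported_on_def)
    have nz: "lookup f \<alpha> \<noteq> 0"
    proof
      assume "lookup f \<alpha> = 0"
      then have "keys f \<subseteq> T" using f(2) by (auto simp: in_keys_iff)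
      then show False using f T by (auto simp: \<A>_def meets_trivially_def supported_on_def)
    qed
    obtain g where g: "g \<in> V"
      "\<And>\<beta>. lookup g \<beta> = (c / lookup f \<alpha>) * lookup f \<beta>"
      using V(2) f(1) unfolding scale_closed_def by meson
    have "single \<alpha> c - g \<in> supported_on T"
      using f(2) nz by (auto simp: supported_on_iff lookup_minus g lookup_single when_def in_keys_iff)
    then show ?thesis using g(1) by (auto simp: U_def)
  qed
  have "f \<in> U" if f: "f \<in> supported_on S" for f
  proof (rule mem_if_parts_mem[OF U])
    fix \<alpha>
    have "part (\<lambda>\<beta>. id \<beta> = \<alpha>) f = single \<alpha> (lookup f \<alpha>)"
      by (intro poly_mapping_eqI) (auto simp: lookup_part lookup_single when_def)
    also have "\<dots> \<in> U"
    proof (cases "\<alpha> \<in> S")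
      case False
      then show ?thesis using f additive_groupD(1)[OF U] by (simp add: supported_on_iff)
    qed (rule single)
    finally show "part (\<lambda>\<beta>. id \<beta> = \<alpha>) f \<in> U" .
  qed
  then have "spans_with S V T" by (auto simp: spans_with_def U_def)
  then show ?thesis using that T by (auto simp: \<A>_def)
qed

text \<open>
  Division of \<open>g\<close> by \<open>V\<close> up to order \<open>N\<close>: the part of \<open>g\<close> of least weight is split along the complement
  \<open>T\<close> of the initial space, and the component in the initial space is cancelled by an element of \<open>V\<close>.
  Each step passes to a larger weight, and there are finitely many weights below \<open>N\<close>. The result
  is \<open>g = f + r + h\<close> with \<open>h\<close> of order at least \<open>N\<close>.
\<close>

lemma reduction:
  fixes V :: "('a \<Rightarrow>\<^sub>0 'k::ab_group_add) set"
  assumes V: "additive_group V" "V \<subseteq> supported_on S" and T: "T \<subseteq> S"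
    and spans: "spans_with S (initial_space w V) T"
    and fin: "finite (w ` {\<alpha> \<in> S. w \<alpha> < N})"
    and g: "g \<in> supported_on S" and low: "\<And>\<alpha>. \<alpha> \<in> keys g \<Longrightarrow> a < w \<alpha>"
  shows "\<exists>f\<in>V. \<exists>r. r \<in> supported_on T \<and> (\<forall>\<alpha>\<in>keys r. a < w \<alpha>) \<and>
    (\<forall>\<alpha>\<in>keys (g - f - r). \<alpha> \<in> S \<and> N \<le> w \<alpha>)"
  using g low
proof (induction "card (w ` {\<alpha> \<in> S. a < w \<alpha> \<and> w \<alpha> < N})" arbitrary: a g rule: less_induct)
  case less
  show ?case
  proof (cases "\<forall>\<alpha>\<in>keys g. N \<le> w \<alpha>")
    case True
    then show ?thesis using less.prems additive_groupD(1)[OF V(1)]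
      by (intro bexI[of _ 0] exI[of _ 0]) (auto simp: supported_on_def)
  next
    case False
    then have "keys g \<noteq> {}" by auto
    then obtain \<mu> where "\<mu> \<in> keys g"
      and "\<And>\<alpha>. \<alpha> \<in> keys g \<Longrightarrow> w \<mu> \<le> w \<alpha>"
      by (rule exists_least_key[where w = w]) blast
    moreover define m where "m = w \<mu>"
    ultimately have \<mu>: "\<mu> \<in> keys g" "m = w \<mu>"
      and le: "\<And>\<alpha>. \<alpha> \<in> keys g \<Longrightarrow> m \<le> w \<alpha>"
      by auto
    obtain \<beta> where \<beta>: "\<beta> \<in> keys g" "w \<beta> < N" using False by force
    have \<mu>': "\<mu> \<in> S" "a < w \<mu>" "w \<mu> < N"
      using less.prems \<mu> le[OF \<beta>(1)] \<beta>(2) by (auto simp: supported_on_def)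
    have gm: "part (\<lambda>\<alpha>. w \<alpha> = m) g \<in> supported_on S"
      using less.prems(1) by (auto simp: supported_on_iff lookup_part)
    then obtain i where i: "i \<in> initial_space w V" "part (\<lambda>\<alpha>. w \<alpha> = m) g - i \<in> supported_on T"
      using spans by (auto simp: spans_with_def)
    obtain f0 where f0: "f0 \<in> V" "\<And>\<alpha>. w \<alpha> < m \<Longrightarrow> lookup f0 \<alpha> = 0"
      "\<And>\<alpha>. w \<alpha> = m \<Longrightarrow> lookup f0 \<alpha> = lookup i \<alpha>"
      by (rule initial_spaceE[OF i(1), of m]) (rule that)
    define r0 where "r0 = part (\<lambda>\<alpha>. w \<alpha> = m) (part (\<lambda>\<alpha>. w \<alpha> = m) g - i)"
    have r0: "r0 \<in> supported_on T" "\<forall>\<alpha>\<in>keys r0. w \<alpha> = m"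
      using i(2) by (auto simp: r0_def supported_on_iff lookup_part keys_part)
    define g' where "g' = g - f0 - r0"
    have r0S: "r0 \<in> supported_on S" using r0(1) T by (auto simp: supported_on_def)
    have g'S: "g' \<in> supported_on S"
      unfolding g'_def using less.prems(1) f0(1) V(2) r0S
      by (intro additive_groupD(2)[OF additive_group_supported_on]) auto
    have g'low: "m < w \<alpha>" if "\<alpha> \<in> keys g'" for \<alpha>
    proof (rule ccontr)
      assume "\<not> m < w \<alpha>"
      then consider "w \<alpha> < m" | "w \<alpha> = m" by linarith
      then have "lookup g' \<alpha> = 0"
      proof cases
        case 1
        then have "lookup g \<alpha> = 0" using le[of \<alpha>] by (auto simp: in_keys_iff)
        then show ?thesis using 1 f0 by (simp add: g'_def r0_def lookup_minus lookup_part)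
      next
        case 2
        then show ?thesis using f0 by (simp add: g'_def r0_def lookup_minus lookup_part)
      qed
      then show False using that by (simp add: in_keys_iff)
    qed
    have "finite (w ` {\<alpha> \<in> S. a < w \<alpha> \<and> w \<alpha> < N})"
      by (rule finite_subset[OF _ fin]) auto
    moreover have "w ` {\<alpha> \<in> S. m < w \<alpha> \<and> w \<alpha> < N} \<subset> w ` {\<alpha> \<in> S. a < w \<alpha> \<and> w \<alpha> < N}"
    proof
      show "w ` {\<alpha> \<in> S. m < w \<alpha> \<and> w \<alpha> < N} \<subseteq> w ` {\<alpha> \<in> S. a < w \<alpha> \<and> w \<alpha> < N}"
        using \<mu>(2) \<mu>'(2) by (intro image_mono) auto
      have "m \<in> w ` {\<alpha> \<in> S. a < w \<alpha> \<and> w \<alpha> < N}" using \<mu> \<mu>' by auto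
      then show "w ` {\<alpha> \<in> S. m < w \<alpha> \<and> w \<alpha> < N} \<noteq> w ` {\<alpha> \<in> S. a < w \<alpha> \<and> w \<alpha> < N}"
        by force
    qed
    ultimately have "card (w ` {\<alpha> \<in> S. m < w \<alpha> \<and> w \<alpha> < N}) < card (w ` {\<alpha> \<in> S. a < w \<alpha> \<and> w \<alpha> < N})"
      by (rule psubset_card_mono)
    from less.hyps[OF this g'S g'low]
    obtain f r where fr: "f \<in> V" "r \<in> supported_on T" "\<forall>\<alpha>\<in>keys r. m < w \<alpha>"
      "\<forall>\<alpha>\<in>keys (g' - f - r). \<alpha> \<in> S \<and> N \<le> w \<alpha>"
      by blast
    show ?thesis
    proof (intro bexI[of _ "f0 + f"] exI[of _ "r0 + r"] conjI)
      show "r0 + r \<in> supported_on T"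
        by (rule additive_groupD(4)[OF additive_group_supported_on]) (use r0 fr in auto)
      show "\<forall>\<alpha>\<in>keys (r0 + r). a < w \<alpha>"
        using Poly_Mapping.keys_add[of r0 r] r0(2) fr(3) \<mu> \<mu>'
        by (metis UnE order.strict_trans subsetD)
      have eq: "g - (f0 + f) - (r0 + r) = g' - f - r" by (simp add: g'_def algebra_simps)
      show "\<forall>\<alpha>\<in>keys (g - (f0 + f) - (r0 + r)). \<alpha> \<in> S \<and> N \<le> w \<alpha>"
        unfolding eq by (rule fr(4))
      show "f0 + f \<in> V" using f0(1) fr(1) by (rule additive_groupD(4)[OF V(1)])
    qed
  qed
qed

text \<open>
  If \<open>r\<close> had a term of weight below \<open>a\<close>, its part of least weight would be an initial part of the
  element \<open>r + h\<close> of \<open>V\<close>, hence in the initial space and spanned by \<open>T\<close> at the same time.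
\<close>

lemma remainder_order:
  fixes V :: "('a \<Rightarrow>\<^sub>0 'k::ab_group_add) set"
  assumes V: "additive_group V" and triv: "meets_trivially (initial_space u V) T"
    and r: "r \<in> supported_on T" and h: "\<And>\<alpha>. \<alpha> \<in> keys h \<Longrightarrow> a \<le> u \<alpha>"
    and mem: "r + h \<in> V" and \<alpha>: "\<alpha> \<in> keys r"
  shows "a \<le> u \<alpha>"
proof (rule ccontr)
  assume "\<not> a \<le> u \<alpha>"
  have "keys r \<noteq> {}" using \<alpha> by auto
  then obtain \<beta> where "\<beta> \<in> keys r"
    and "\<And>\<gamma>. \<gamma> \<in> keys r \<Longrightarrow> u \<beta> \<le> u \<gamma>"
    by (rule exists_least_key[where w = u]) blast
  moreover define b where "b = u \<beta>"
  ultimately have \<beta>: "\<beta> \<in> keys r" "u \<beta> = b"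
    and b: "\<And>\<gamma>. \<gamma> \<in> keys r \<Longrightarrow> b \<le> u \<gamma>"
    by auto
  have "b < a" using b[OF \<alpha>] \<open>\<not> a \<le> u \<alpha>\<close> by simp
  then have h0: "lookup h \<gamma> = 0" if "u \<gamma> \<le> b" for \<gamma>
    using h[of \<gamma>] that by (force simp: in_keys_iff)
  have r0: "lookup r \<gamma> = 0" if "u \<gamma> < b" for \<gamma>
    using b[of \<gamma>] that by (force simp: in_keys_iff)
  have "part (\<lambda>\<gamma>. u \<gamma> = b) r \<in> initial_space u V"
    by (rule homogeneous_mem_initial_space[OF V mem, of _ b])
      (auto simp: lookup_add lookup_part h0 r0)
  moreover have "part (\<lambda>\<gamma>. u \<gamma> = b) r \<in> supported_on T"
    using r by (simp add: supported_on_iff lookup_part)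
  ultimately have "part (\<lambda>\<gamma>. u \<gamma> = b) r = 0"
    using triv by (auto simp: meets_trivially_def)
  then have "lookup (part (\<lambda>\<gamma>. u \<gamma> = b) r) \<beta> = 0" by simp
  then show False using \<beta> by (simp add: lookup_part in_keys_iff)
qed

text \<open>
  Here an element \<open>g\<close> of the initial space occupies the weight \<open>a\<close>; subtracting it shows that the
  part of \<open>r\<close> of weight \<open>a\<close> lies in the initial space as well.
\<close>

lemma remainder_order_strict:
  fixes V :: "('a \<Rightarrow>\<^sub>0 'k::ab_group_add) set"
  assumes V: "additive_group V" and triv: "meets_trivially (initial_space u V) T"
    and r: "r \<in> supported_on T"
    and g: "g \<in> initial_space u V" "\<And>\<alpha>. \<alpha> \<in> keys g \<Longrightarrow> u \<alpha> = a"
    and h: "\<And>\<alpha>. \<alpha> \<in> keys h \<Longrightarrow> a < u \<alpha>"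
    and mem: "r + g + h \<in> V" and \<alpha>: "\<alpha> \<in> keys r"
  shows "a < u \<alpha>"
proof -
  have ge: "a \<le> u \<beta>" if "\<beta> \<in> keys r" for \<beta>
  proof (rule remainder_order[OF V triv r _ _ that])
    show "r + (g + h) \<in> V" using mem by (simp add: add.assoc)
    show "a \<le> u \<gamma>" if "\<gamma> \<in> keys (g + h)" for \<gamma>
      using that Poly_Mapping.keys_add[of g h] g(2) h by fastforce
  qed
  have g0: "lookup g \<gamma> = 0" if "u \<gamma> \<noteq> a" for \<gamma>
    using g(2)[of \<gamma>] that by (auto simp: in_keys_iff)
  have h0: "lookup h \<gamma> = 0" if "u \<gamma> \<le> a" for \<gamma>
    using h[of \<gamma>] that by (force simp: in_keys_iff)
  have r0: "lookup r \<gamma> = 0" if "u \<gamma> < a" for \<gamma>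
    using ge[of \<gamma>] that by (force simp: in_keys_iff)
  have "part (\<lambda>\<gamma>. u \<gamma> = a) r + g \<in> initial_space u V"
    by (rule homogeneous_mem_initial_space[OF V mem, of _ a])
      (auto simp: lookup_add lookup_part h0 r0 g0)
  then have "part (\<lambda>\<gamma>. u \<gamma> = a) r + g - g \<in> initial_space u V"
    by (rule additive_groupD(2)[OF additive_group_initial_space[OF V]]) (rule g)
  moreover have "part (\<lambda>\<gamma>. u \<gamma> = a) r \<in> supported_on T"
    using r by (simp add: supported_on_iff lookup_part)
  ultimately have "part (\<lambda>\<gamma>. u \<gamma> = a) r = 0"
    using triv by (auto simp: meets_trivially_def)
  then have "lookup (part (\<lambda>\<gamma>. u \<gamma> = a) r) \<alpha> = 0" by simp
  then have "u \<alpha> \<noteq> a" using \<alpha> by (auto simp: lookup_part in_keys_iff)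
  then show ?thesis using ge[OF \<alpha>] by simp
qed

text \<open>
  Convexity for weights \<open>u\<close> and \<open>u'\<close> each of which dominates a positive multiple of the other on \<open>S\<close>, so that high
  order for one means high order for the other. Let \<open>I\<close> be the common initial space.
  A bihomogeneous \<open>p\<close> in \<open>I\<close> is reduced modulo \<open>V\<close>; the remainder and the tail have larger order than
  \<open>p\<close> for both weights, so \<open>p\<close> is an initial part for \<open>w\<close>. Conversely an initial part for \<open>w\<close>
  that is spanned by the complement \<open>T\<close> can be continued, modulo terms of high order, to an element
  of \<open>V\<close> whose other terms are spanned by \<open>T\<close> too, and its initial part for \<open>u\<close> contradicts the choice of \<open>T\<close>.
\<close>

lemma initial_space_between:
  fixes V :: "('a \<Rightarrow>\<^sub>0 'k::field) set" and u u' w :: "'a \<Rightarrow> real"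
  assumes V: "additive_group V" "scale_closed V" "V \<subseteq> supported_on S"
    and eq: "initial_space u V = initial_space u' V"
    and w: "\<And>\<alpha>. w \<alpha> = s * u \<alpha> + t * u' \<alpha>" and s: "s > 0" and t: "t > 0"
    and c: "c > 0" and le: "\<And>\<alpha>. \<alpha> \<in> S \<Longrightarrow> c * u \<alpha> \<le> u' \<alpha>" "\<And>\<alpha>. \<alpha> \<in> S \<Longrightarrow> c * u' \<alpha> \<le> u \<alpha>"
    and fin: "\<And>N. finite (u ` {\<alpha> \<in> S. u \<alpha> < N})" "\<And>N. finite (w ` {\<alpha> \<in> S. w \<alpha> < N})"
  shows "initial_space w V = initial_space u V"
proof -
  define I where "I = initial_space u V"
  have I': "initial_space u' V = I" using eq by (simp add: I_def)
  have addI: "additive_group I" unfolding I_def by (rule additive_group_initial_space[OF V(1)])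
  have scI: "scale_closed I" unfolding I_def by (rule scale_closed_initial_space[OF V(2)])
  have IS: "I \<subseteq> supported_on S" unfolding I_def by (rule initial_space_supported_on[OF V(3)])
  have hom: "homogeneous u I" "homogeneous u' I"
    unfolding I_def by (rule homogeneous_initial_space[OF V(1)], unfold eq,
        rule homogeneous_initial_space[OF V(1)])
  obtain T where T: "T \<subseteq> S" "meets_trivially I T" "spans_with S I T"
    by (rule exists_monomial_complement[OF addI scI])
  have triv_u: "meets_trivially (initial_space u V) T"
    and triv_u': "meets_trivially (initial_space u' V) T"
    and span_u: "spans_with S (initial_space u V) T"
    using T by (simp_all add: I' flip: I_def)
  have sub: "I \<subseteq> initial_space w V"
  proof
    fix g assume g: "g \<in> I"
    show "g \<in> initial_space w V"
    proof (rule mem_if_parts_mem[OF additive_group_initial_space[OF V(1)]])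
      fix x :: "real \<times> real"
      obtain a b where x: "x = (a, b)" by (cases x)
      define p where "p = part (\<lambda>\<alpha>. (u \<alpha>, u' \<alpha>) = x) g"
      have "p = part (\<lambda>\<alpha>. u \<alpha> = a) (part (\<lambda>\<alpha>. u' \<alpha> = b) g)"
        by (intro poly_mapping_eqI) (auto simp: p_def lookup_part x)
      then have pI: "p \<in> I" using hom g by (simp add: homogeneous_def)
      have pk: "u \<alpha> = a" "u' \<alpha> = b" if "\<alpha> \<in> keys p" for \<alpha>
        using that by (auto simp: p_def keys_part x)
      (* weight at least N for u forces weight above a for u and above b for u' *)
      define N where "N = max (a + 1) ((b + 1) / c)"
      have l: "a - 1 < u \<alpha>" if "\<alpha> \<in> keys p" for \<alpha>
        using pk(1)[OF that] by simp
      have pS: "p \<in> supported_on S" using pI IS by auto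
      obtain f r where f: "f \<in> V" and r: "r \<in> supported_on T"
        and h: "\<And>\<alpha>. \<alpha> \<in> keys (p - f - r) \<Longrightarrow> \<alpha> \<in> S \<and> N \<le> u \<alpha>"
        using reduction[OF V(1,3) T(1) span_u fin(1) pS l, of N] by blast
      define h where "h = p - f - r"
      have hk: "a < u \<alpha>" "b < u' \<alpha>" if "\<alpha> \<in> keys h" for \<alpha>
      proof -
        have *: "\<alpha> \<in> S" "N \<le> u \<alpha>" using h that by (auto simp: h_def)
        have "a + 1 \<le> N" "(b + 1) / c \<le> N" by (auto simp: N_def)
        then show "a < u \<alpha>" using * by simp
        have "b + 1 \<le> c * N" using \<open>(b + 1) / c \<le> N\<close> c by (simp add: field_simps)
        also have "\<dots> \<le> c * u \<alpha>" using * c by simp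
        also have "\<dots> \<le> u' \<alpha>" by (rule le(1)[OF *(1)])
        finally show "b < u' \<alpha>" by simp
      qed
      have mem: "r + (- p) + h \<in> V"
        using additive_groupD(3)[OF V(1) f] by (simp add: h_def)
      have np: "- p \<in> I" using pI by (rule additive_groupD(3)[OF addI])
      have rk: "a < u \<alpha>" "b < u' \<alpha>" if \<alpha>: "\<alpha> \<in> keys r" for \<alpha>
      proof -
        show "a < u \<alpha>"
          by (rule remainder_order_strict[OF V(1) triv_u r _ _ _ mem \<alpha>])
            (use np pk hk in \<open>auto simp: I_def\<close>)
        show "b < u' \<alpha>"
          by (rule remainder_order_strict[OF V(1) triv_u' r _ _ _ mem \<alpha>])
            (use np pk hk in \<open>auto simp: I'\<close>)
      qed
      have pos: "s * a + t * b < w \<alpha>" if "a < u \<alpha>" "b < u' \<alpha>" for \<alpha>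
        using that s t by (simp add: w add_strict_mono)
      have z: "lookup h \<alpha> = 0 \<and> lookup r \<alpha> = 0"
        if "w \<alpha> \<le> s * a + t * b" for \<alpha>
        using that pos[of \<alpha>] rk[of \<alpha>] hk[of \<alpha>] by (force simp: in_keys_iff)
      have pw: "lookup p \<alpha> = 0" if "w \<alpha> \<noteq> s * a + t * b" for \<alpha>
        using that pk[of \<alpha>] by (auto simp: w in_keys_iff)
      have fe: "f = p - r - h" by (simp add: h_def)
      have "p \<in> initial_space w V"
        by (rule homogeneous_mem_initial_space[OF V(1) f, of w "s * a + t * b"])
          (auto simp: fe lookup_minus z pw)
      then show "part (\<lambda>\<alpha>. (u \<alpha>, u' \<alpha>) = x) g \<in> initial_space w V"
        by (simp add: p_def)
    qed
  qed
  then have span_w: "spans_with S (initial_space w V) T"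
    using T(3) by (meson spans_with_def subsetD)
  have "meets_trivially (initial_space w V) T"
    unfolding meets_trivially_def
  proof (rule subsetI, rule ccontr)
    fix q assume "q \<in> initial_space w V \<inter> supported_on T" and "q \<notin> {0}"
    then have q: "q \<in> initial_space w V" "q \<in> supported_on T" "q \<noteq> 0" by auto
    then obtain \<alpha>0 where \<alpha>0: "\<alpha>0 \<in> keys q"
      by (metis all_not_in_conv keys_eq_empty)
    define e where "e = w \<alpha>0"
    obtain f where f: "f \<in> V" "\<And>\<alpha>. w \<alpha> < e \<Longrightarrow> lookup f \<alpha> = 0"
      "\<And>\<alpha>. w \<alpha> = e \<Longrightarrow> lookup f \<alpha> = lookup q \<alpha>"
      by (rule initial_spaceE[OF q(1), of e]) (rule that)
    define qe where "qe = part (\<lambda>\<alpha>. w \<alpha> = e) q"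
    have qeT: "qe \<in> supported_on T" using q(2) by (auto simp: qe_def supported_on_iff lookup_part)
    have gS: "f - qe \<in> supported_on S"
      using f(1) V(3) qeT T(1) by (intro additive_groupD(2)[OF additive_group_supported_on])
        (auto simp: supported_on_def)
    have gk: "e < w \<alpha>" if "\<alpha> \<in> keys (f - qe)" for \<alpha>
    proof (rule ccontr)
      assume "\<not> e < w \<alpha>"
      then consider "w \<alpha> < e" | "w \<alpha> = e" by linarith
      then have "lookup (f - qe) \<alpha> = 0"
        by cases (auto simp: lookup_minus qe_def lookup_part f)
      then show False using that by (simp add: in_keys_iff)
    qed
    (* w is at most K times u on S, so a tail of large w-order has large u-order *)
    define K where "K = s + t / c"
    have K: "K > 0" using s t c by (simp add: K_def add_pos_pos)
    have wK: "w \<alpha> \<le> K * u \<alpha>" if "\<alpha> \<in> S" for \<alpha>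
    proof -
      have "u' \<alpha> \<le> u \<alpha> / c" using le(2)[OF that] c by (simp add: field_simps)
      then have "t * u' \<alpha> \<le> t * (u \<alpha> / c)" using t by (intro mult_left_mono) auto
      then show ?thesis by (simp add: w K_def algebra_simps)
    qed
    obtain f1 r where f1: "f1 \<in> V" and r: "r \<in> supported_on T"
      and rk: "\<And>\<alpha>. \<alpha> \<in> keys r \<Longrightarrow> e < w \<alpha>"
      and h: "\<And>\<alpha>. \<alpha> \<in> keys (f - qe - f1 - r)
                 \<Longrightarrow> \<alpha> \<in> S \<and> K * (u \<alpha>0 + 1) \<le> w \<alpha>"
      using reduction[OF V(1,3) T(1) span_w fin(2) gS gk, of "K * (u \<alpha>0 + 1)"] by auto
    define h where "h = f - qe - f1 - r"
    have hk: "u \<alpha>0 + 1 \<le> u \<alpha>" if "\<alpha> \<in> keys h" for \<alpha>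
    proof -
      have "K * (u \<alpha>0 + 1) \<le> K * u \<alpha>" using h wK that by (force simp: h_def)
      then show ?thesis using K by simp
    qed
    have "qe + r + h = f - f1" by (simp add: h_def)
    then have mem: "qe + r + h \<in> V" using additive_groupD(2)[OF V(1) f(1) f1] by simp
    have qrT: "qe + r \<in> supported_on T"
      using qeT r by (rule additive_groupD(4)[OF additive_group_supported_on])
    have "lookup r \<alpha>0 = 0" using rk[of \<alpha>0] by (auto simp: e_def in_keys_iff)
    then have "\<alpha>0 \<in> keys (qe + r)"
      using \<alpha>0 by (simp add: in_keys_iff lookup_add qe_def lookup_part e_def)
    from remainder_order[OF V(1) triv_u qrT hk mem this] show False by simp
  qed
  with sub T(3) initial_space_supported_on[OF V(3)] show ?thesis
    unfolding I_def[symmetric]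
    by (metis eq_if_common_complement additive_group_initial_space[OF V(1)])
qed

lemma meets_trivially_if_initial:
  fixes V :: "('a \<Rightarrow>\<^sub>0 'k::ab_group_add) set"
  assumes V: "additive_group V" and triv: "meets_trivially (initial_space v V) T"
  shows "meets_trivially V T"
  unfolding meets_trivially_def
proof (rule subsetI, rule ccontr)
  fix f assume f: "f \<in> V \<inter> supported_on T" and "f \<notin> {0}"
  then obtain \<alpha> where \<alpha>: "\<alpha> \<in> keys f"
    by (metis all_not_in_conv keys_eq_empty singletonI)
  have "v \<alpha> + 1 \<le> v \<alpha>"
    by (rule remainder_order[OF V triv, of f 0]) (use f \<alpha> in auto)
  then show False by simp
qed

text \<open>
  \<open>V\<close> is graded by \<open>z\<close> with finitely many monomials in each degree, so that reduction up to a
  large order leaves no tail in the degree under consideration.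
\<close>

lemma spans_with_if_initial:
  fixes V :: "('a \<Rightarrow>\<^sub>0 'k::ab_group_add) set"
  assumes V: "additive_group V" "V \<subseteq> supported_on S" and T: "T \<subseteq> S"
    and hom: "homogeneous z V" and fin_z: "\<And>a. finite {\<alpha> \<in> S. z \<alpha> = a}"
    and fin_v: "\<And>N. finite (v ` {\<alpha> \<in> S. v \<alpha> < N})"
    and spans: "spans_with S (initial_space v V) T"
  shows "spans_with S V T"
proof -
  define U where "U = {f. \<exists>g\<in>V. f - g \<in> supported_on T}"
  have U: "additive_group U" unfolding U_def by (rule additive_group_plus_supported[OF V(1)])
  have "f \<in> U" if f: "f \<in> supported_on S" for f
  proof (rule mem_if_parts_mem[OF U])
    fix a
    define p where "p = part (\<lambda>\<alpha>. z \<alpha> = a) f"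
    have pS: "p \<in> supported_on S" using f by (auto simp: p_def supported_on_iff lookup_part)
    define l where "l = Min (insert 0 (v ` keys p)) - 1"
    have l: "l < v \<alpha>" if "\<alpha> \<in> keys p" for \<alpha>
    proof -
      have "Min (insert 0 (v ` keys p)) \<le> v \<alpha>" using that by (intro Min_le) auto
      then show ?thesis by (simp add: l_def)
    qed
    define N where "N = Max (insert 0 (v ` {\<alpha> \<in> S. z \<alpha> = a})) + 1"
    have N: "v \<alpha> < N" if "\<alpha> \<in> S" "z \<alpha> = a" for \<alpha>
    proof -
      have "v \<alpha> \<le> Max (insert 0 (v ` {\<alpha> \<in> S. z \<alpha> = a}))" using that fin_z by (intro Max_ge) auto
      then show ?thesis by (simp add: N_def)
    qed
    obtain g r where g: "g \<in> V" and r: "r \<in> supported_on T"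
      and h: "\<And>\<alpha>. \<alpha> \<in> keys (p - g - r) \<Longrightarrow> \<alpha> \<in> S \<and> N \<le> v \<alpha>"
      using reduction[OF V T spans fin_v pS l, of N] by blast
    have h0: "lookup p \<alpha> - lookup g \<alpha> = lookup r \<alpha>"
      if "z \<alpha> = a" for \<alpha>
      using h[of \<alpha>] N[of \<alpha>] that by (force simp: in_keys_iff lookup_minus)
    have "p - part (\<lambda>\<alpha>. z \<alpha> = a) g = part (\<lambda>\<alpha>. z \<alpha> = a) r"
      by (intro poly_mapping_eqI) (auto simp: lookup_minus lookup_part h0, auto simp: p_def lookup_part)
    moreover have "part (\<lambda>\<alpha>. z \<alpha> = a) r \<in> supported_on T"
      using r by (auto simp: supported_on_iff lookup_part)
    ultimately show "part (\<lambda>\<alpha>. z \<alpha> = a) f \<in> U"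
      using g hom by (auto simp: U_def p_def homogeneous_def intro!: bexI[of _ "part (\<lambda>\<alpha>. z \<alpha> = a) g"])
  qed
  then show ?thesis by (auto simp: spans_with_def U_def)
qed

text \<open>
  Passing to the initial space for \<open>v\<close> gives the same result for \<open>W\<close>, for its initial space in
  direction \<open>d\<close> and for the one in direction \<open>- d\<close>. A monomial complement \<open>T\<close> of that result is then a
  complement of \<open>W\<close> and of the initial space in direction \<open>d\<close>. A \<open>d\<close>-homogeneous element of the latter
  differs from an element of \<open>W\<close> by a remainder spanned by \<open>T\<close>; direction \<open>d\<close> forces the terms of
  the remainder to have larger \<open>d\<close>-weight, direction \<open>- d\<close> forbids larger weights, and so it vanishes.
\<close>

lemma initial_space_direction_trivial:
  fixes W :: "('a \<Rightarrow>\<^sub>0 'k::field) set" and d v z :: "'a \<Rightarrow> real"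
  assumes W: "additive_group W" "scale_closed W" "W \<subseteq> supported_on S" "homogeneous z W"
    and fin_z: "\<And>a. finite {\<alpha> \<in> S. z \<alpha> = a}"
    and fin_v: "\<And>N. finite (v ` {\<alpha> \<in> S. v \<alpha> < N})"
    and up: "initial_space v (initial_space d W) = initial_space v W"
    and down: "initial_space v (initial_space (\<lambda>\<alpha>. - d \<alpha>) W) = initial_space v W"
  shows "initial_space d W = W"
proof -
  define I where "I = initial_space v W"
  have addI: "additive_group I" unfolding I_def by (rule additive_group_initial_space[OF W(1)])
  have scI: "scale_closed I" unfolding I_def by (rule scale_closed_initial_space[OF W(2)])
  obtain T where T: "T \<subseteq> S" "meets_trivially I T" "spans_with S I T"
    by (rule exists_monomial_complement[OF addI scI])
  have add_d: "additive_group (initial_space e W)" for e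
    by (rule additive_group_initial_space[OF W(1)])
  have trivW: "meets_trivially W T"
    using T(2) by (intro meets_trivially_if_initial[OF W(1)]) (simp add: I_def)
  have triv_up: "meets_trivially (initial_space d W) T"
    using T(2) by (intro meets_trivially_if_initial[OF add_d, of v]) (simp add: I_def up)
  have triv_down: "meets_trivially (initial_space (\<lambda>\<alpha>. - d \<alpha>) W) T"
    using T(2) by (intro meets_trivially_if_initial[OF add_d, of v]) (simp add: I_def down)
  have spanW: "spans_with S W T"
    using T(3) by (intro spans_with_if_initial[OF W(1,3) T(1) W(4) fin_z fin_v]) (simp add: I_def)
  have span_up: "spans_with S (initial_space d W) T"
    using T(3) by (intro spans_with_if_initial[OF add_d initial_space_supported_on[OF W(3)] T(1)
        homogeneous_initial_space_other[OF W(4)] fin_z fin_v]) (simp add: I_def up)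
  have "initial_space d W \<subseteq> W"
  proof
    fix g assume g: "g \<in> initial_space d W"
    show "g \<in> W"
    proof (rule mem_if_parts_mem[OF W(1)])
      fix a
      define p where "p = part (\<lambda>\<alpha>. d \<alpha> = a) g"
      have p: "p \<in> initial_space d W"
        using homogeneous_initial_space[OF W(1), of d] g by (simp add: homogeneous_def p_def)
      have pk: "d \<alpha> = a" if "\<alpha> \<in> keys p" for \<alpha>
        using that by (simp add: p_def keys_part)
      have "p \<in> supported_on S" using p initial_space_supported_on[OF W(3)] by blast
      then obtain f where f: "f \<in> W" "p - f \<in> supported_on T"
        using spanW by (auto simp: spans_with_def)
      have mem: "p - f + (- p) + 0 \<in> W" "p - f + (- p) \<in> W"
        using additive_groupD(3)[OF W(1) f(1)] by simp_all
      have False if \<alpha>: "\<alpha> \<in> keys (p - f)" for \<alpha>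
      proof -
        have "a < d \<alpha>"
          by (rule remainder_order_strict[OF W(1) triv_up f(2) _ _ _ mem(1) \<alpha>])
            (use additive_groupD(3)[OF add_d p] pk in auto)
        moreover have "- a \<le> - d \<alpha>"
          by (rule remainder_order[OF W(1) triv_down f(2) _ mem(2) \<alpha>]) (use pk in auto)
        ultimately show False by simp
      qed
      then have "p - f = 0" by (metis all_not_in_conv keys_eq_empty)
      then show "part (\<lambda>\<alpha>. d \<alpha> = a) g \<in> W" using f(1) by (simp add: p_def)
    qed
  qed
  then show ?thesis
    by (rule eq_if_common_complement[OF W(1) _ W(3) span_up trivW])
qed

section \<open>Universal standard bases\<close>

abbreviation wt :: "real ^ 'n \<Rightarrow> int ^ 'n \<Rightarrow> real" where
  "wt v \<alpha> \<equiv> v \<bullet> real_vec \<alpha>"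

definition idot :: "int ^ 'n \<Rightarrow> int ^ 'n \<Rightarrow> int" where
  "idot b \<alpha> = (\<Sum>i\<in>UNIV. b $ i * \<alpha> $ i)"

lemma wt_real_vec: "wt (real_vec b) \<alpha> = of_int (idot b \<alpha>)"
  by (simp add: inner_vec_def real_vec_def idot_def)

lemma real_vec_minus: "real_vec (\<alpha> - \<beta>) = real_vec \<alpha> - real_vec \<beta>"
  by (simp add: real_vec_def vec_eq_iff)

lemma inj_real_vec: "inj real_vec"
  by (auto simp: inj_def real_vec_def vec_eq_iff)

lemma idot_add: "idot b (\<alpha> + \<beta>) = idot b \<alpha> + idot b \<beta>"
  by (simp add: idot_def algebra_simps sum.distrib)

lemma idot_diff: "idot b (\<alpha> - \<beta>) = idot b \<alpha> - idot b \<beta>"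
  by (simp add: idot_def algebra_simps sum_subtractf)

lemma lookup_single_mult:
  fixes f :: "('a::ab_group_add) \<Rightarrow>\<^sub>0 ('k::semiring_0)"
  shows "lookup (single \<gamma> c * f) \<alpha> = c * lookup f (\<alpha> - \<gamma>)"
proof (induction f rule: update_induct)
  case const
  then show ?case by simp
next
  case (update f a b)
  have eq: "Poly_Mapping.update a b f = f + single a b"
    using update.hyps
    by (intro poly_mapping_eqI)
      (auto simp: lookup_update lookup_add lookup_single when_def in_keys_iff)
  have "\<gamma> + a = \<alpha> \<longleftrightarrow> a = \<alpha> - \<gamma>" by (auto simp: algebra_simps)
  then show ?case
    using update.IH
    by (simp add: eq distrib_left lookup_add mult_single lookup_single when_def)
qed

lemma increasing_subsequence_nat:
  fixes s :: "nat \<Rightarrow> nat"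
  obtains r :: "nat \<Rightarrow> nat" where "strict_mono r" "mono (\<lambda>n. s (r n))"
proof -
  obtain r :: "nat \<Rightarrow> nat" where r: "strict_mono r" "monoseq (\<lambda>n. s (r n))"
    using seq_monosub[of s] by auto
  show ?thesis
  proof (cases "mono (\<lambda>n. s (r n))")
    case True
    then show ?thesis using that r by blast
  next
    case False
    then have dec: "\<And>m n. m \<le> n \<Longrightarrow> s (r n) \<le> s (r m)"
      using r(2) by (auto simp: monoseq_def mono_def)
    obtain N where N: "\<And>n. s (r N) \<le> s (r n)"
      using ex_has_least_nat[of "\<lambda>_. True" 0 "\<lambda>n. s (r n)"] by auto
    have "s (r (N + n)) = s (r N)" for n
      using N[of "N + n"] dec[of N "N + n"] by simp
    then have "mono (\<lambda>n. s (r (N + n)))" by (simp add: mono_def)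
    moreover have "strict_mono (\<lambda>n. r (N + n))"
      using r(1) by (simp add: strict_mono_def)
    ultimately show ?thesis using that by blast
  qed
qed

text \<open>
  Dickson's lemma, obtained by extracting an increasing subsequence for one coordinate after the
  other.
\<close>

lemma Dickson:
  fixes f :: "nat \<Rightarrow> 'b \<Rightarrow> nat"
  assumes "finite I"
  obtains i j where "i < j" "\<And>x. x \<in> I \<Longrightarrow> f i x \<le> f j x"
proof -
  from assms have "\<exists>r :: nat \<Rightarrow> nat. strict_mono r \<and> (\<forall>x\<in>I. mono (\<lambda>n. f (r n) x))"
  proof (induction I)
    case empty
    show ?case by (intro exI[of _ id]) (simp add: strict_mono_def)
  next
    case (insert x I)
    then obtain r :: "nat \<Rightarrow> nat" where r: "strict_mono r" "\<And>y. y \<in> I \<Longrightarrow> mono (\<lambda>n. f (r n) y)" by auto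
    obtain q :: "nat \<Rightarrow> nat" where q: "strict_mono q" "mono (\<lambda>n. f (r (q n)) x)"
      by (rule increasing_subsequence_nat[of "\<lambda>n. f (r n) x"])
    have "mono (\<lambda>n. f (r (q n)) y)" if "y \<in> I" for y
      using r(2)[OF that] q(1) by (simp add: mono_def strict_mono_less_eq)
    moreover have "strict_mono (\<lambda>n. r (q n))"
      using r(1) q(1) by (simp add: strict_mono_def)
    ultimately show ?case using q(2) by (intro exI[of _ "\<lambda>n. r (q n)"]) auto
  qed
  then obtain r :: "nat \<Rightarrow> nat" where r: "strict_mono r" "\<And>x. x \<in> I \<Longrightarrow> mono (\<lambda>n. f (r n) x)" by auto
  show ?thesis
  proof (rule that)
    show "r 0 < r 1" using r(1) by (simp add: strict_mono_def)
    show "f (r 0) x \<le> f (r 1) x" if "x \<in> I" for x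
      using r(2)[OF that] by (simp add: mono_def)
  qed
qed

text \<open>
  The strict inequalities between the finitely many weights of \<open>A\<close> persist on an open set around
  \<open>v\<close>, and a nonempty open set is not covered by countably many hyperplanes. Weights that are injective
  on the lattice play the part of monomial orders.
\<close>

lemma generic_weight_refining:
  fixes v :: "real ^ 'n" and A :: "(int ^ 'n) set"
  assumes "finite A"
  obtains v' where "inj (wt v')"
    "\<And>\<alpha> \<beta>. \<alpha> \<in> A \<Longrightarrow> \<beta> \<in> A \<Longrightarrow> wt v \<alpha> < wt v \<beta> \<Longrightarrow> wt v' \<alpha> < wt v' \<beta>"
proof -
  define P where "P = {(\<alpha>, \<beta>) \<in> A \<times> A. wt v \<alpha> < wt v \<beta>}"
  define U where "U = (\<Inter>p\<in>P. {x. (real_vec (snd p) - real_vec (fst p)) \<bullet> x > 0})"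
  have "finite P" by (rule finite_subset[of _ "A \<times> A"]) (use assms in \<open>auto simp: P_def\<close>)
  then have "open U" unfolding U_def by (intro open_INT ballI open_halfspace_gt) auto
  moreover have "v \<in> U" by (auto simp: U_def P_def inner_diff_left inner_diff_right inner_commute)
  ultimately have "\<not> negligible U" using open_not_negligible by blast
  moreover have "negligible (\<Union>\<alpha>\<in>- {0 :: int ^ 'n}. {x. real_vec \<alpha> \<bullet> x = 0})"
  proof (rule negligible_countable_Union)
    show "countable ((\<lambda>\<alpha>::int ^ 'n. {x. real_vec \<alpha> \<bullet> x = 0}) ` (- {0}))"
      by (intro countable_image) simp
    fix X assume "X \<in> (\<lambda>\<alpha>::int ^ 'n. {x. real_vec \<alpha> \<bullet> x = 0}) ` (- {0})"
    then obtain \<alpha> :: "int ^ 'n" where "\<alpha> \<noteq> 0" "X = {x. real_vec \<alpha> \<bullet> x = 0}" by auto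
    moreover from this have "real_vec \<alpha> \<noteq> 0"
      using inj_real_vec real_vec_zero by (metis injD)
    ultimately show "negligible X" by (simp add: negligible_hyperplane)
  qed
  ultimately have "\<not> U \<subseteq> (\<Union>\<alpha>\<in>- {0 :: int ^ 'n}. {x. real_vec \<alpha> \<bullet> x = 0})"
    using negligible_subset by blast
  then obtain v' where v': "v' \<in> U" "\<And>\<alpha> :: int ^ 'n. \<alpha> \<noteq> 0 \<Longrightarrow> wt v' \<alpha> \<noteq> 0"
    by (auto simp: inner_commute)
  show ?thesis
  proof (rule that[of v'])
    show "inj (wt v')"
    proof (rule injI)
      fix \<alpha> \<beta> assume "wt v' \<alpha> = wt v' \<beta>"
      then have "wt v' (\<alpha> - \<beta>) = 0" by (simp add: real_vec_minus inner_diff_right)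
      then show "\<alpha> = \<beta>" using v'(2)[of "\<alpha> - \<beta>"] by auto
    qed
    fix \<alpha> \<beta> assume "\<alpha> \<in> A" "\<beta> \<in> A" "wt v \<alpha> < wt v \<beta>"
    then have "(\<alpha>, \<beta>) \<in> P" by (simp add: P_def)
    then have "(real_vec \<beta> - real_vec \<alpha>) \<bullet> v' > 0" using v'(1) by (force simp: U_def)
    then show "wt v' \<alpha> < wt v' \<beta>" by (simp add: inner_diff_left inner_diff_right inner_commute)
  qed
qed

text \<open>
  The unwanted terms of \<open>f\<close> are removed in order of increasing weight; the correction for one of
  them disturbs only terms of larger weight. It terminates because \<open>A\<close> is finite.
\<close>

lemma eliminate_terms:
  fixes f :: "'a \<Rightarrow>\<^sub>0 'k::ab_group_add" and w :: "'a \<Rightarrow> real"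
  assumes A: "finite A" and inj: "inj_on w A" and Bad: "Bad \<subseteq> A"
    and Y: "additive_group Y" "Y \<subseteq> supported_on A"
    and elim: "\<And>\<beta> c. \<beta> \<in> Bad \<Longrightarrow>
       \<exists>y\<in>Y. lookup y \<beta> = c \<and> (\<forall>\<alpha>\<in>keys y. w \<beta> \<le> w \<alpha>)"
    and f: "f \<in> supported_on A"
  shows "\<exists>y\<in>Y. keys (f - y) \<inter> Bad = {}"
  using f
proof (induction "card {\<alpha> \<in> A. \<exists>\<beta>\<in>keys f \<inter> Bad. w \<beta> \<le> w \<alpha>}" arbitrary: f rule: less_induct)
  case less
  show ?case
  proof (cases "keys f \<inter> Bad = {}")
    case True
    then show ?thesis using additive_groupD(1)[OF Y(1)] by (intro bexI[of _ 0]) auto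
  next
    case False
    have "Min (w ` (keys f \<inter> Bad)) \<in> w ` (keys f \<inter> Bad)"
      using False by (intro Min_in) auto
    then obtain \<beta> where \<beta>: "\<beta> \<in> keys f" "\<beta> \<in> Bad"
      and "w \<beta> = Min (w ` (keys f \<inter> Bad))" by auto
    then have min: "w \<beta> \<le> w \<alpha>" if "\<alpha> \<in> keys f" "\<alpha> \<in> Bad" for \<alpha>
      using that by simp
    obtain y0 where y0: "y0 \<in> Y" "lookup y0 \<beta> = lookup f \<beta>"
      "\<And>\<alpha>. \<alpha> \<in> keys y0 \<Longrightarrow> w \<beta> \<le> w \<alpha>"
      using elim[OF \<beta>(2), of "lookup f \<beta>"] by blast
    define f' where "f' = f - y0"
    have f': "f' \<in> supported_on A" unfolding f'_def
      by (rule additive_groupD(2)[OF additive_group_supported_on]) (use less.prems y0 Y in auto)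
    have gt: "w \<beta> < w \<alpha>" if \<alpha>: "\<alpha> \<in> keys f'" "\<alpha> \<in> Bad" for \<alpha>
    proof -
      have "\<alpha> \<noteq> \<beta>" using \<alpha>(1) y0(2) by (auto simp: f'_def in_keys_iff lookup_minus)
      moreover have "\<alpha> \<in> keys f \<or> \<alpha> \<in> keys y0"
        using \<alpha>(1) by (auto simp: f'_def in_keys_iff lookup_minus)
      then have "w \<beta> \<le> w \<alpha>" using min y0(3) \<alpha>(2) by blast
      ultimately show ?thesis
        using inj Bad \<alpha>(2) \<beta>(2) by (metis inj_onD less_eq_real_def subsetD)
    qed
    have "{\<alpha> \<in> A. \<exists>\<beta>\<in>keys f' \<inter> Bad. w \<beta> \<le> w \<alpha>}
        \<subset> {\<alpha> \<in> A. \<exists>\<beta>\<in>keys f \<inter> Bad. w \<beta> \<le> w \<alpha>}" (is "?L \<subset> ?R")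
    proof
      show "?L \<subseteq> ?R"
      proof
        fix \<alpha> assume "\<alpha> \<in> ?L"
        then obtain \<beta>' where "\<alpha> \<in> A" "\<beta>' \<in> keys f'" "\<beta>' \<in> Bad" "w \<beta>' \<le> w \<alpha>" by blast
        then have "w \<beta> \<le> w \<alpha>" using gt[of \<beta>'] by simp
        then show "\<alpha> \<in> ?R" using \<open>\<alpha> \<in> A\<close> \<beta> by blast
      qed
      have "\<beta> \<in> ?R" using \<beta> Bad by blast
      moreover have "\<beta> \<notin> ?L" using gt by force
      ultimately show "?L \<noteq> ?R" by blast
    qed
    then have "card ?L < card ?R" using A by (intro psubset_card_mono) auto
    from less.hyps[OF this f'] obtain y where y: "y \<in> Y" "keys (f' - y) \<inter> Bad = {}"
      by blast
    have eq: "f - (y0 + y) = f' - y" by (simp add: f'_def algebra_simps)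
    show ?thesis
      using y(2) additive_groupD(4)[OF Y(1) y0(1) y(1)] unfolding eq[symmetric] by blast
  qed
qed

text \<open>
  \<open>B\<close> generates the cone \<open>\<sigma>\<close>. The condition \<open>spanning\<close> says that \<open>\<sigma>\<close> has full dimension; it makes
  the degree below a proper function on the lattice points of the dual cone.
\<close>

locale cone_monoid =
  fixes B :: "(int ^ 'n) set"
  assumes finite_B: "finite B"
    and spanning: "\<And>\<alpha>. (\<And>b. b \<in> B \<Longrightarrow> idot b \<alpha> = 0) \<Longrightarrow> \<alpha> = 0"
begin

definition S :: "(int ^ 'n) set" where "S = {\<alpha>. \<forall>b\<in>B. 0 \<le> idot b \<alpha>}"

definition deg :: "int ^ 'n \<Rightarrow> int" where "deg \<alpha> = (\<Sum>b\<in>B. idot b \<alpha>)"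

definition upto_degree :: "int \<Rightarrow> (int ^ 'n) set" where "upto_degree e = {\<alpha> \<in> S. deg \<alpha> \<le> e}"

lemma deg_add: "deg (\<alpha> + \<beta>) = deg \<alpha> + deg \<beta>"
  by (simp add: deg_def idot_add sum.distrib)

lemma deg_diff: "deg (\<alpha> - \<beta>) = deg \<alpha> - deg \<beta>"
  by (simp add: deg_def idot_diff sum_subtractf)

lemma S_add: "\<alpha> \<in> S \<Longrightarrow> \<beta> \<in> S \<Longrightarrow> \<alpha> + \<beta> \<in> S"
  by (simp add: S_def idot_add)

lemma idot_le_deg: "\<alpha> \<in> S \<Longrightarrow> b \<in> B \<Longrightarrow> idot b \<alpha> \<le> deg \<alpha>"
  unfolding deg_def by (rule member_le_sum) (auto simp: S_def finite_B)

lemma finite_upto_degree: "finite (upto_degree e)"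
proof (rule finite_imageD)
  have "(\<lambda>\<alpha>. \<lambda>b\<in>B. idot b \<alpha>) ` upto_degree e \<subseteq> (\<Pi>\<^sub>E b\<in>B. {0..e})"
    using idot_le_deg by (force simp: upto_degree_def S_def)
  then show "finite ((\<lambda>\<alpha>. \<lambda>b\<in>B. idot b \<alpha>) ` upto_degree e)"
    by (rule finite_subset) (intro finite_PiE finite_B, simp)
  show "inj_on (\<lambda>\<alpha>. \<lambda>b\<in>B. idot b \<alpha>) (upto_degree e)"
  proof (rule inj_onI)
    fix \<alpha> \<beta> assume eq: "(\<lambda>b\<in>B. idot b \<alpha>) = (\<lambda>b\<in>B. idot b \<beta>)"
    have "idot b (\<alpha> - \<beta>) = 0" if "b \<in> B" for b
      using fun_cong[OF eq, of b] that by (simp add: idot_diff)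
    then have "\<alpha> - \<beta> = 0" by (rule spanning)
    then show "\<alpha> = \<beta>" by simp
  qed
qed

lemma exists_degree_bound:
  assumes "f \<in> supported_on S"
  obtains e where "f \<in> supported_on (upto_degree e)"
proof
  show "f \<in> supported_on (upto_degree (Max (insert 0 (deg ` keys f))))"
    using assms by (auto simp: supported_on_def upto_degree_def)
qed

definition monoid_ideal :: "((int ^ 'n) \<Rightarrow>\<^sub>0 'k::field) set \<Rightarrow> bool" where
  "monoid_ideal J \<longleftrightarrow> additive_group J \<and> J \<subseteq> supported_on S \<and>
     (\<forall>f\<in>J. \<forall>\<gamma>\<in>S. \<forall>c. single \<gamma> c * f \<in> J)"

text \<open>
  A pair \<open>(\<alpha>, d)\<close> with \<open>deg \<alpha> \<le> d\<close> stands for the monomial \<open>t\<^bsup>d - deg \<alpha>\<^esup> x\<^sup>\<alpha>\<close> of degree \<open>d\<close> in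
  the homogenised ring, and this is divisibility there.
\<close>

definition divides :: "(int ^ 'n) \<times> int \<Rightarrow> (int ^ 'n) \<times> int \<Rightarrow> bool" where
  "divides p q \<longleftrightarrow> fst q - fst p \<in> S \<and> deg (fst q - fst p) \<le> snd q - snd p"

definition leading :: "real ^ 'n \<Rightarrow> ((int ^ 'n) \<Rightarrow>\<^sub>0 'k::zero) \<Rightarrow> int ^ 'n \<Rightarrow> bool" where
  "leading v f m \<longleftrightarrow> m \<in> keys f \<and> (\<forall>\<alpha>\<in>keys f. wt v m \<le> wt v \<alpha>)"

lemma exists_leading: "f \<noteq> 0 \<Longrightarrow> \<exists>m. leading v f m"
  unfolding leading_def by (metis exists_least_key[where w = "wt v"] keys_eq_empty)

text \<open>
  The leading term of every homogenised element of \<open>J\<close> is divisible by that of a member of \<open>F\<close>.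
\<close>

definition standard_basis ::
    "((int ^ 'n) \<Rightarrow>\<^sub>0 'k::field) set \<Rightarrow> (((int ^ 'n) \<Rightarrow>\<^sub>0 'k) \<times> int) set \<Rightarrow> real ^ 'n \<Rightarrow> bool" where
  "standard_basis J F v \<longleftrightarrow>
     (\<forall>e g \<mu>. g \<in> J \<longrightarrow> g \<in> supported_on (upto_degree e) \<longrightarrow> leading v g \<mu> \<longrightarrow>
       (\<exists>(f, d)\<in>F. f \<in> J \<and> f \<in> supported_on (upto_degree d) \<and>
          (\<exists>m. leading v f m \<and> divides (m, d) (\<mu>, e))))"

lemma shifted_multiple:
  assumes f: "f \<in> supported_on (upto_degree d)" and m: "leading v f m"
    and div: "divides (m, d) (\<beta>, e)" and c: "(c::'k::field) = c' * lookup f m"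
    and y: "y = single (\<beta> - m) c' * f"
  shows "lookup y \<beta> = c" "y \<in> supported_on (upto_degree e)"
    "\<And>\<alpha>. \<alpha> \<in> keys y \<Longrightarrow> wt v \<beta> \<le> wt v \<alpha>"
proof -
  have k: "\<exists>\<alpha>'. \<alpha> = (\<beta> - m) + \<alpha>' \<and> \<alpha>' \<in> keys f"
    if "\<alpha> \<in> keys y" for \<alpha>
    using that by (intro exI[of _ "\<alpha> - (\<beta> - m)"]) (auto simp: y in_keys_iff lookup_single_mult)
  show "lookup y \<beta> = c" by (simp add: y lookup_single_mult c)
  show "wt v \<beta> \<le> wt v \<alpha>" if \<alpha>: "\<alpha> \<in> keys y" for \<alpha>
  proof -
    obtain \<alpha>' where "\<alpha> = (\<beta> - m) + \<alpha>'" "\<alpha>' \<in> keys f" using k[OF \<alpha>] by blast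
    then show ?thesis using m
      by (auto simp: leading_def real_vec_add real_vec_minus inner_add_right inner_diff_right)
  qed
  show "y \<in> supported_on (upto_degree e)"
    unfolding supported_on_def
  proof (intro CollectI subsetI)
    fix \<alpha> assume "\<alpha> \<in> keys y"
    then obtain \<alpha>' where \<alpha>: "\<alpha> = (\<beta> - m) + \<alpha>'" "\<alpha>' \<in> keys f" using k by blast
    then have "\<alpha>' \<in> S" "deg \<alpha>' \<le> d" using f by (auto simp: supported_on_def upto_degree_def)
    moreover have "\<beta> - m \<in> S" "deg (\<beta> - m) \<le> e - d" using div by (auto simp: divides_def)
    ultimately show "\<alpha> \<in> upto_degree e"
      by (simp add: \<alpha> upto_degree_def S_add deg_add)
  qed
qed

text \<open>
  A triple \<open>(f, m, d)\<close> records a polynomial, the term \<open>m\<close> that is required to be its leading one, and a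
  degree bound. The search for a common standard basis branches over such requirements.
\<close>

definition chosen_leading ::
    "(((int ^ 'n) \<Rightarrow>\<^sub>0 'k::field) \<times> (int ^ 'n) \<times> int) set \<Rightarrow> (real ^ 'n) set" where
  "chosen_leading P = {v. inj (wt v) \<and> (\<forall>(f, m, d)\<in>P. leading v f m)}"

definition basis_exists ::
    "((int ^ 'n) \<Rightarrow>\<^sub>0 'k::field) set \<Rightarrow> (((int ^ 'n) \<Rightarrow>\<^sub>0 'k) \<times> (int ^ 'n) \<times> int) set \<Rightarrow> bool" where
  "basis_exists J P \<longleftrightarrow> (\<exists>F. finite F \<and> (\<forall>v\<in>chosen_leading P. standard_basis J F v))"

definition admissible :: "((int ^ 'n) \<Rightarrow>\<^sub>0 'k::field) set \<Rightarrow> ((int ^ 'n) \<Rightarrow>\<^sub>0 'k) \<times> (int ^ 'n) \<times> int \<Rightarrow> bool" where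
  "admissible J = (\<lambda>(f, m, d). f \<in> J \<and> f \<in> supported_on (upto_degree d) \<and> m \<in> keys f)"

text \<open>
  If the recorded polynomials are no standard basis for some \<open>v\<close> compatible with the recorded leading
  terms, division yields an element \<open>g'\<close> of \<open>J\<close> none of whose terms is divisible by a recorded one. Every
  compatible weight selects one of the finitely many terms of \<open>g'\<close> as leading term. If each of these
  selections admitted a finite standard basis, the union of these bases would serve all compatible weights.
\<close>

lemma extend_chosen:
  fixes J :: "((int ^ 'n) \<Rightarrow>\<^sub>0 'k::field) set"
  assumes J: "monoid_ideal J" and P: "finite P" "\<forall>t\<in>P. admissible J t" and bad: "\<not> basis_exists J P"
  shows "\<exists>t. admissible J t \<and> \<not> basis_exists J (insert t P) \<and> (\<forall>s\<in>P. \<not> divides (snd s) (snd t))"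
proof -
  have addJ: "additive_group J" using J by (simp add: monoid_ideal_def)
  define F0 where "F0 = (\<lambda>(f, m, d). (f, d)) ` P"
  have "finite F0" using P(1) by (simp add: F0_def)
  then obtain v where v: "v \<in> chosen_leading P" "\<not> standard_basis J F0 v"
    using bad by (auto simp: basis_exists_def)
  have inj: "inj (wt v)" using v(1) by (simp add: chosen_leading_def)
  obtain e g \<mu> where g: "g \<in> J" "g \<in> supported_on (upto_degree e)" and \<mu>: "leading v g \<mu>"
    and no: "\<not> (\<exists>(f, d)\<in>F0. f \<in> J \<and> f \<in> supported_on (upto_degree d) \<and>
          (\<exists>m. leading v f m \<and> divides (m, d) (\<mu>, e)))"
    using v(2) unfolding standard_basis_def by blast
  have \<mu>P: "\<not> divides (snd s) (\<mu>, e)" if s: "s \<in> P" for s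
  proof
    assume d: "divides (snd s) (\<mu>, e)"
    obtain f m d where s': "s = (f, m, d)" by (cases s)
    have "leading v f m" using v(1) s s' by (auto simp: chosen_leading_def)
    moreover have "f \<in> J" "f \<in> supported_on (upto_degree d)"
      using P(2) s s' by (auto simp: admissible_def)
    moreover have "(f, d) \<in> F0" using s s' by (force simp: F0_def)
    ultimately show False using no d s' by auto
  qed
  define A where "A = {\<alpha> \<in> upto_degree e. wt v \<mu> < wt v \<alpha>}"
  define Bad where "Bad = {\<beta> \<in> A. \<exists>s\<in>P. divides (snd s) (\<beta>, e)}"
  define Y where "Y = J \<inter> supported_on A"
  have Y: "additive_group Y"
    using addJ additive_group_supported_on[of A] by (auto simp: Y_def additive_group_def)
  define f where "f = g - single \<mu> (lookup g \<mu>)"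
  have fA: "f \<in> supported_on A"
    unfolding supported_on_def
  proof (intro CollectI subsetI)
    fix \<alpha> assume "\<alpha> \<in> keys f"
    then have "\<alpha> \<noteq> \<mu>" "\<alpha> \<in> keys g"
      by (auto simp: f_def in_keys_iff lookup_minus lookup_single when_def split: if_splits)
    moreover from this have "wt v \<mu> \<noteq> wt v \<alpha>" using inj by (metis injD)
    ultimately show "\<alpha> \<in> A" using \<mu> g(2) by (force simp: A_def leading_def supported_on_def)
  qed
  have elim: "\<exists>y\<in>Y. lookup y \<beta> = c \<and> (\<forall>\<alpha>\<in>keys y. wt v \<beta> \<le> wt v \<alpha>)"
    if \<beta>: "\<beta> \<in> Bad" for \<beta> c
  proof -
    obtain h m d where s: "(h, m, d) \<in> P" and dv: "divides (m, d) (\<beta>, e)"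
      using \<beta> by (force simp: Bad_def)
    have h: "h \<in> J" "h \<in> supported_on (upto_degree d)" "lookup h m \<noteq> 0"
      using P(2) s by (auto simp: admissible_def in_keys_iff)
    have lead: "leading v h m" using v(1) s by (auto simp: chosen_leading_def)
    define y where "y = single (\<beta> - m) (c / lookup h m) * h"
    have c: "c = c / lookup h m * lookup h m" using h(3) by simp
    note y = shifted_multiple[OF h(2) lead dv c y_def]
    have "\<beta> - m \<in> S" using dv by (simp add: divides_def)
    then have "y \<in> J" using J h(1) by (simp add: y_def monoid_ideal_def)
    moreover have "y \<in> supported_on A"
      unfolding supported_on_def
    proof (intro CollectI subsetI)
      fix \<alpha> assume \<alpha>: "\<alpha> \<in> keys y"
      have "wt v \<mu> < wt v \<beta>" using \<beta> by (simp add: Bad_def A_def)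
      then show "\<alpha> \<in> A" using y(2) y(3)[OF \<alpha>] \<alpha> by (auto simp: A_def supported_on_def)
    qed
    ultimately show ?thesis using y by (auto simp: Y_def)
  qed
  have finA: "finite A" using finite_upto_degree by (simp add: A_def)
  have BadA: "Bad \<subseteq> A" by (auto simp: Bad_def)
  have injA: "inj_on (wt v) A" using inj by (meson inj_on_subset subset_UNIV)
  obtain y where y: "y \<in> Y" "keys (f - y) \<inter> Bad = {}"
    using eliminate_terms[OF finA injA BadA Y _ elim fA] by (auto simp: Y_def)
  define g' where "g' = g - y"
  have g': "g' \<in> J" using g(1) y(1) additive_groupD(2)[OF addJ] by (auto simp: g'_def Y_def)
  have yA: "y \<in> supported_on A" using y(1) by (simp add: Y_def)
  then have "y \<in> supported_on (upto_degree e)" by (auto simp: supported_on_def A_def)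
  then have g'e: "g' \<in> supported_on (upto_degree e)"
    unfolding g'_def by (intro additive_groupD(2)[OF additive_group_supported_on] g(2))
  have "\<mu> \<notin> A" by (simp add: A_def)
  then have "lookup y \<mu> = 0" using yA by (simp add: supported_on_iff)
  then have g'0: "g' \<noteq> 0"
    using \<mu> by (metis g'_def leading_def in_keys_iff lookup_minus lookup_zero diff_zero)
  have g'P: "\<not> divides (snd s) (\<alpha>, e)" if \<alpha>: "\<alpha> \<in> keys g'" and s: "s \<in> P" for \<alpha> s
  proof (cases "\<alpha> = \<mu>")
    case True
    then show ?thesis using \<mu>P s by simp
  next
    case False
    then have a: "\<alpha> \<in> keys (f - y)"
      using \<alpha> by (simp add: g'_def f_def in_keys_iff lookup_minus lookup_single)
    have "f - y \<in> supported_on A"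
      by (rule additive_groupD(2)[OF additive_group_supported_on fA yA])
    then have "\<alpha> \<in> A" using a by (auto simp: supported_on_def)
    then show ?thesis using y(2) a s by (auto simp: Bad_def)
  qed
  have "\<exists>\<alpha>\<in>keys g'. \<not> basis_exists J (insert (g', \<alpha>, e) P)"
  proof (rule ccontr)
    assume "\<not> ?thesis"
    then have "\<forall>\<alpha>\<in>keys g'. \<exists>F. finite F \<and>
        (\<forall>v\<in>chosen_leading (insert (g', \<alpha>, e) P). standard_basis J F v)"
      by (auto simp: basis_exists_def)
    then obtain F where F: "\<And>\<alpha>. \<alpha> \<in> keys g' \<Longrightarrow> finite (F \<alpha>)"
      "\<And>\<alpha> v. \<alpha> \<in> keys g' \<Longrightarrow> v \<in> chosen_leading (insert (g', \<alpha>, e) P)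
        \<Longrightarrow> standard_basis J (F \<alpha>) v"
      by metis
    have "standard_basis J (\<Union>\<alpha>\<in>keys g'. F \<alpha>) v" if v: "v \<in> chosen_leading P" for v
    proof -
      obtain \<alpha> where \<alpha>: "leading v g' \<alpha>" using exists_leading[OF g'0] by blast
      then have \<alpha>k: "\<alpha> \<in> keys g'" by (simp add: leading_def)
      have "v \<in> chosen_leading (insert (g', \<alpha>, e) P)" using v \<alpha> by (auto simp: chosen_leading_def)
      then have "standard_basis J (F \<alpha>) v" by (rule F(2)[OF \<alpha>k])
      then show ?thesis unfolding standard_basis_def using \<alpha>k by (fast intro: UN_I)
    qed
    then have "basis_exists J P" unfolding basis_exists_def
      using F(1) by (intro exI[of _ "\<Union>\<alpha>\<in>keys g'. F \<alpha>"]) auto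
    then show False using bad by simp
  qed
  then obtain \<alpha> where "\<alpha> \<in> keys g'" "\<not> basis_exists J (insert (g', \<alpha>, e) P)" by blast
  then show ?thesis using g' g'e g'P
    by (intro exI[of _ "(g', \<alpha>, e)"]) (auto simp: admissible_def)
qed

text \<open>
  Otherwise \<open>extend_chosen\<close> could be iterated for ever and would produce an infinite sequence of
  terms none of which divides a later one, against Dickson's lemma.
\<close>

lemma generic_standard_basis:
  fixes J :: "((int ^ 'n) \<Rightarrow>\<^sub>0 'k::field) set"
  assumes J: "monoid_ideal J"
  obtains F where "finite F" "\<And>v. inj (wt v) \<Longrightarrow> standard_basis J F v"
proof -
  have "basis_exists J {}"
  proof (rule ccontr)
    assume none: "\<not> basis_exists J {}"
    define good where "good P \<longleftrightarrow> finite P \<and> (\<forall>t\<in>P. admissible J t) \<and> \<not> basis_exists J P" for P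
    define step where "step P P' \<longleftrightarrow> (\<exists>t. P' = insert t P \<and> admissible J t \<and>
        (\<forall>s\<in>P. \<not> divides (snd s) (snd t)))" for P P'
    have "\<exists>p. \<forall>n. good (p n) \<and> step (p n) (p (Suc n))"
    proof (rule dependent_nat_choice)
      show "\<exists>P. good P" using none by (auto simp: good_def)
      fix P n assume P: "good P"
      then obtain t where "admissible J t" "\<not> basis_exists J (insert t P)"
        "\<forall>s\<in>P. \<not> divides (snd s) (snd t)"
        using extend_chosen[OF J, of P] unfolding good_def by blast
      then show "\<exists>P'. good P' \<and> step P P'"
        using P unfolding good_def step_def by blast
    qed
    then obtain p where p: "\<And>n. step (p n) (p (Suc n))" by blast
    then obtain t where t: "\<And>n. p (Suc n) = insert (t n) (p n)" "\<And>n. admissible J (t n)"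
      "\<And>n s. s \<in> p n \<Longrightarrow> \<not> divides (snd s) (snd (t n))"
      unfolding step_def by metis
    have mono: "p i \<subseteq> p j" if "i \<le> j" for i j
      using that by (rule lift_Suc_mono_le[rotated]) (auto simp: t(1))
    have nd: "\<not> divides (snd (t i)) (snd (t j))" if "i < j" for i j
      using t(3)[of "t i" j] t(1)[of i] mono[of "Suc i" j] that by auto
    (* the exponent vector of the homogenised n-th term, None being the homogenising variable *)
    define \<phi> where "\<phi> n x = (case x of
        None \<Rightarrow> nat (snd (snd (t n)) - deg (fst (snd (t n))))
      | Some b \<Rightarrow> nat (idot b (fst (snd (t n)))))" for n and x :: "(int ^ 'n) option"
    obtain i j where ij: "i < j" "\<And>x. x \<in> insert None (Some ` B) \<Longrightarrow> \<phi> i x \<le> \<phi> j x"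
      by (rule Dickson[of "insert None (Some ` B)" \<phi>]) (use finite_B in auto)
    have S: "fst (snd (t n)) \<in> S" "deg (fst (snd (t n))) \<le> snd (snd (t n))" for n
      using t(2)[of n] by (auto simp: admissible_def supported_on_def upto_degree_def split: prod.splits)
    have "0 \<le> idot b (fst (snd (t j)) - fst (snd (t i)))" if b: "b \<in> B" for b
    proof -
      have "0 \<le> idot b (fst (snd (t i)))" "0 \<le> idot b (fst (snd (t j)))"
        using S b by (auto simp: S_def)
      then show ?thesis using ij(2)[of "Some b"] b by (simp add: \<phi>_def idot_diff)
    qed
    then have "fst (snd (t j)) - fst (snd (t i)) \<in> S" by (simp add: S_def)
    moreover have "deg (fst (snd (t j)) - fst (snd (t i))) \<le> snd (snd (t j)) - snd (snd (t i))"
      using ij(2)[of None] S(2)[of i] S(2)[of j] by (simp add: \<phi>_def deg_diff)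
    ultimately have "divides (snd (t i)) (snd (t j))" by (simp add: divides_def)
    then show False using nd[OF ij(1)] by simp
  qed
  then show ?thesis using that by (auto simp: basis_exists_def chosen_leading_def)
qed

end

lemma initial_form_leading:
  fixes f :: "(int ^ 'n) \<Rightarrow>\<^sub>0 'k::field"
  assumes m: "m \<in> keys f" "\<And>\<alpha>. \<alpha> \<in> keys f \<Longrightarrow> wt v m \<le> wt v \<alpha>"
  shows "initial_form v f = part (\<lambda>\<alpha>. wt v \<alpha> = wt v m) f"
proof -
  have "Min (wt v ` keys f) = wt v m"
    using m by (intro Min_eqI) auto
  moreover have "f \<noteq> 0" using m(1) by auto
  ultimately have o: "weight_order v f = ereal (wt v m)" by (simp add: weight_order_def)
  show ?thesis
  proof (rule poly_mapping_eqI)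
    fix \<alpha>
    have "lookup (initial_form v f) \<alpha> =
      (\<Sum>\<beta> | \<beta> \<in> keys f \<and> wt v \<beta> = wt v m.
        if \<beta> = \<alpha> then lookup f \<beta> else 0)"
      by (simp add: initial_form_def o lookup_sum lookup_single when_def)
    also have "\<dots> = lookup (part (\<lambda>\<alpha>. wt v \<alpha> = wt v m) f) \<alpha>"
      by (auto simp: lookup_part in_keys_iff)
    finally show "lookup (initial_form v f) \<alpha> =
      lookup (part (\<lambda>\<alpha>. wt v \<alpha> = wt v m) f) \<alpha>" .
  qed
qed

lemma initial_form_0: "initial_form v 0 = 0"
  by (simp add: initial_form_def)

context cone_monoid
begin

text \<open>
  The shifted initial forms of \<open>F\<close> span the initial space of \<open>J\<close> for every real weight. Quantifying
  over additive groups \<open>U\<close> expresses the span.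
\<close>

definition universal_basis ::
    "((int ^ 'n) \<Rightarrow>\<^sub>0 'k::field) set \<Rightarrow> ((int ^ 'n) \<Rightarrow>\<^sub>0 'k) set \<Rightarrow> bool" where
  "universal_basis J F \<longleftrightarrow> (\<forall>v U. additive_group U \<longrightarrow>
     (\<forall>f\<in>F. \<forall>\<gamma>\<in>S. \<forall>c. single \<gamma> c * initial_form v f \<in> U) \<longrightarrow>
     initial_space (wt v) J \<subseteq> U)"

lemma universal_basisD:
  assumes "universal_basis J F" "additive_group U"
    "\<And>f \<gamma> c. f \<in> F \<Longrightarrow> \<gamma> \<in> S \<Longrightarrow> single \<gamma> c * initial_form v f \<in> U"
  shows "initial_space (wt v) J \<subseteq> U"
  using assms unfolding universal_basis_def by blast

text \<open>
  For injective weights a standard basis gives every element of \<open>J\<close> a representation without terms of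
  lower order. An arbitrary \<open>v\<close> is refined, on the finitely many monomials up to the degree in
  question, by an injective weight \<open>v'\<close>; the representation for \<open>v'\<close> then has no terms of lower order
  for \<open>v\<close> either, and its parts of least \<open>v\<close>-weight are shifted initial forms.
\<close>

theorem exists_universal_basis:
  fixes J :: "((int ^ 'n) \<Rightarrow>\<^sub>0 'k::field) set"
  assumes J: "monoid_ideal J"
  obtains F where "finite F" "F \<subseteq> J" "universal_basis J F"
proof -
  obtain F where F: "finite F" "\<And>v. inj (wt v) \<Longrightarrow> standard_basis J F v"
    by (rule generic_standard_basis[OF J]) (rule that)
  have addJ: "additive_group J" using J by (simp add: monoid_ideal_def)
  show ?thesis
  proof (rule that[of "fst ` F \<inter> J"])
    show "finite (fst ` F \<inter> J)" "fst ` F \<inter> J \<subseteq> J" using F(1) by auto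
    show "universal_basis J (fst ` F \<inter> J)"
      unfolding universal_basis_def
    proof (intro allI impI subsetI)
      fix v :: "real ^ 'n" and U :: "((int ^ 'n) \<Rightarrow>\<^sub>0 'k) set"
      assume U: "additive_group U" and gen: "\<forall>f\<in>fst ` F \<inter> J. \<forall>\<gamma>\<in>S. \<forall>c.
          single \<gamma> c * initial_form v f \<in> U"
      fix g assume g: "g \<in> initial_space (wt v) J"
      show "g \<in> U"
      proof (rule mem_if_parts_mem[OF U])
        fix a
        obtain f where f: "f \<in> J" "\<And>\<alpha>. wt v \<alpha> < a \<Longrightarrow> lookup f \<alpha> = 0"
          "\<And>\<alpha>. wt v \<alpha> = a \<Longrightarrow> lookup f \<alpha> = lookup g \<alpha>"
          by (rule initial_spaceE[OF g, of a]) (rule that)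
        have "f \<in> supported_on S" using J f(1) by (auto simp: monoid_ideal_def)
        then obtain e where e: "f \<in> supported_on (upto_degree e)" by (rule exists_degree_bound)
        obtain v' where v': "inj (wt v')" "\<And>\<alpha> \<beta>. \<alpha> \<in> upto_degree e \<Longrightarrow> \<beta> \<in> upto_degree e \<Longrightarrow>
            wt v \<alpha> < wt v \<beta> \<Longrightarrow> wt v' \<alpha> < wt v' \<beta>"
          using generic_weight_refining[OF finite_upto_degree[of e], of v] by blast
        define A where "A = {\<alpha> \<in> upto_degree e. a \<le> wt v \<alpha>}"
        define Bad where "Bad = {\<beta> \<in> A. \<exists>h\<in>J \<inter> supported_on (upto_degree e). leading v' h \<beta>}"
        define Y where "Y = {y \<in> J \<inter> supported_on A. part (\<lambda>\<alpha>. wt v \<alpha> = a) y \<in> U}"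
        have part_diff: "part Q (x - y) = part Q x - part Q y" for Q and x y :: "(int ^ 'n) \<Rightarrow>\<^sub>0 'k"
          by (intro poly_mapping_eqI) (simp add: lookup_part lookup_minus)
        have part_0: "part Q (0 :: (int ^ 'n) \<Rightarrow>\<^sub>0 'k) = 0" for Q
          by (intro poly_mapping_eqI) (simp add: lookup_part)
        have Y: "additive_group Y"
          using addJ U additive_group_supported_on[of A]
          by (auto simp: Y_def additive_group_def part_diff part_0)
        have fA: "f \<in> supported_on A"
          unfolding supported_on_def
        proof (intro CollectI subsetI)
          fix \<alpha> assume "\<alpha> \<in> keys f"
          then show "\<alpha> \<in> A" using e f(2)[of \<alpha>] by (force simp: A_def supported_on_def in_keys_iff)
        qed
        have elim: "\<exists>y\<in>Y. lookup y \<beta> = c \<and> (\<forall>\<alpha>\<in>keys y. wt v' \<beta> \<le> wt v' \<alpha>)"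
          if \<beta>: "\<beta> \<in> Bad" for \<beta> c
        proof -
          obtain h where "h \<in> J" "h \<in> supported_on (upto_degree e)" "leading v' h \<beta>"
            using \<beta> by (auto simp: Bad_def)
          then obtain k d m where k: "(k, d) \<in> F" "k \<in> J" "k \<in> supported_on (upto_degree d)"
            and m: "leading v' k m" and dv: "divides (m, d) (\<beta>, e)"
            using F(2)[OF v'(1)] unfolding standard_basis_def by blast
          have nz: "lookup k m \<noteq> 0" using m by (simp add: leading_def in_keys_iff)
          define c' where "c' = c / lookup k m"
          define y where "y = single (\<beta> - m) c' * k"
          have c: "c = c' * lookup k m" using nz by (simp add: c'_def)
          note y = shifted_multiple[OF k(3) m dv c y_def]
          have \<gamma>: "\<beta> - m \<in> S" using dv by (simp add: divides_def)
          then have yJ: "y \<in> J" using J k(2) by (simp add: y_def monoid_ideal_def)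
          have \<beta>A: "\<beta> \<in> upto_degree e" "a \<le> wt v \<beta>" using \<beta> by (auto simp: Bad_def A_def)
          have low: "wt v \<beta> \<le> wt v \<alpha>" if "\<alpha> \<in> upto_degree e" "wt v' \<beta> \<le> wt v' \<alpha>" for \<alpha>
            using v'(2)[OF that(1) \<beta>A(1)] that(2) by force
          have ylow: "wt v \<beta> \<le> wt v \<alpha>" if "\<alpha> \<in> keys y" for \<alpha>
            using low[of \<alpha>] y(2) y(3)[OF that] that by (auto simp: supported_on_def)
          have yA: "y \<in> supported_on A"
            using y(2) ylow \<beta>A(2) by (force simp: supported_on_def A_def)
          have "part (\<lambda>\<alpha>. wt v \<alpha> = a) y \<in> U"
          proof (cases "wt v \<beta> = a")
            case False
            then have "part (\<lambda>\<alpha>. wt v \<alpha> = a) y = 0"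
              using ylow \<beta>A(2) by (intro poly_mapping_eqI) (force simp: lookup_part in_keys_iff)
            then show ?thesis using additive_groupD(1)[OF U] by simp
          next
            case True
            have km: "wt v m \<le> wt v \<alpha>" if \<alpha>: "\<alpha> \<in> keys k" for \<alpha>
            proof -
              have "\<alpha> \<in> S" "deg \<alpha> \<le> d" using k(3) \<alpha> by (auto simp: supported_on_def upto_degree_def)
              then have "(\<beta> - m) + \<alpha> \<in> upto_degree e"
                using dv by (simp add: divides_def upto_degree_def S_add deg_add)
              moreover have "wt v' \<beta> \<le> wt v' ((\<beta> - m) + \<alpha>)"
                using m \<alpha> by (simp add: leading_def real_vec_add real_vec_minus inner_add_right inner_diff_right)
              ultimately have "wt v \<beta> \<le> wt v ((\<beta> - m) + \<alpha>)" by (rule low)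
              then show ?thesis
                by (simp add: real_vec_add real_vec_minus inner_add_right inner_diff_right)
            qed
            have mk: "m \<in> keys k" using m by (simp add: leading_def)
            have init: "initial_form v k = part (\<lambda>\<alpha>. wt v \<alpha> = wt v m) k"
              by (rule initial_form_leading[OF mk km])
            have "part (\<lambda>\<alpha>. wt v \<alpha> = a) y = single (\<beta> - m) c' * initial_form v k"
              unfolding True[symmetric]
              by (intro poly_mapping_eqI)
                (auto simp: init y_def lookup_part lookup_single_mult real_vec_minus inner_diff_right)
            then show ?thesis using gen k \<gamma> by force
          qed
          then show ?thesis using y yJ yA by (auto simp: Y_def)
        qed
        have finA: "finite A" using finite_upto_degree by (simp add: A_def)
        have BadA: "Bad \<subseteq> A" by (auto simp: Bad_def)
        have injA: "inj_on (wt v') A" using v'(1) by (meson inj_on_subset subset_UNIV)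
        have YA: "Y \<subseteq> supported_on A" by (auto simp: Y_def)
        obtain y where y: "y \<in> Y" "keys (f - y) \<inter> Bad = {}"
          using eliminate_terms[OF finA injA BadA Y YA elim fA] by auto
        have "f - y = 0"
        proof (rule ccontr)
          assume "f - y \<noteq> 0"
          then obtain \<mu> where \<mu>: "leading v' (f - y) \<mu>" using exists_leading by blast
          have "f - y \<in> supported_on A"
            using fA y(1) YA by (intro additive_groupD(2)[OF additive_group_supported_on]) auto
          moreover have "f - y \<in> J" using f(1) y(1) addJ by (auto simp: Y_def additive_groupD)
          ultimately have "\<mu> \<in> Bad"
            using \<mu> by (auto simp: Bad_def leading_def A_def supported_on_def intro!: bexI[of _ "f - y"])
          then show False using \<mu> y(2) by (auto simp: leading_def)
        qed
        then have "f \<in> Y" using y(1) by simp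
        moreover have "part (\<lambda>\<alpha>. wt v \<alpha> = a) f = part (\<lambda>\<alpha>. wt v \<alpha> = a) g"
          by (intro poly_mapping_eqI) (simp add: lookup_part f(3))
        ultimately show "part (\<lambda>\<alpha>. wt v \<alpha> = a) g \<in> U" by (simp add: Y_def)
      qed
    qed
  qed
qed

end

section \<open>Perturbation, convexity and collapse\<close>

lemma eventually_sgn_at_right:
  fixes a b :: real
  shows "\<forall>\<^sub>F \<epsilon> in at_right 0. sgn (a + \<epsilon> * b) = (if a \<noteq> 0 then sgn a else sgn b)"
proof -
  have lim: "((\<lambda>\<epsilon>. a + \<epsilon> * b) \<longlongrightarrow> a + 0 * b) (at_right 0)"
    by (intro tendsto_intros)
  consider "a > 0" | "a < 0" | "a = 0" by linarith
  then show ?thesis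
  proof cases
    case 1
    then have "\<forall>\<^sub>F \<epsilon> in at_right 0. 0 < a + \<epsilon> * b" using order_tendstoD(1)[OF lim] by simp
    then show ?thesis by (rule eventually_mono) (use 1 in simp)
  next
    case 2
    then have "\<forall>\<^sub>F \<epsilon> in at_right 0. a + \<epsilon> * b < 0" using order_tendstoD(2)[OF lim] by simp
    then show ?thesis by (rule eventually_mono) (use 2 in simp)
  next
    case 3
    have "\<forall>\<^sub>F \<epsilon>::real in at_right 0. 0 < \<epsilon>" by (simp add: eventually_at_right_less)
    then show ?thesis by (rule eventually_mono) (use 3 in \<open>simp add: sgn_mult\<close>)
  qed
qed

lemma eventually_at_rightE:
  assumes "\<forall>\<^sub>F \<epsilon> in at_right (0::real). P \<epsilon>"
  obtains \<epsilon> where "0 < \<epsilon>" "P \<epsilon>"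
proof -
  have "\<forall>\<^sub>F \<epsilon>::real in at_right 0. 0 < \<epsilon>" by (simp add: eventually_at_right_less)
  with assms have "\<forall>\<^sub>F \<epsilon> in at_right 0. 0 < \<epsilon> \<and> P \<epsilon>" by eventually_elim simp
  then have "\<exists>\<epsilon>. 0 < \<epsilon> \<and> P \<epsilon>"
    using eventually_happens by fastforce
  then show ?thesis using that by blast
qed

lemma eventually_less_at_right:
  fixes a b c d :: real
  assumes "a < c \<or> a = c \<and> b < d"
  shows "\<forall>\<^sub>F \<epsilon> in at_right 0. a + \<epsilon> * b < c + \<epsilon> * d"
  using eventually_sgn_at_right[of "c - a" "d - b"]
proof eventually_elim
  case (elim \<epsilon>)
  then have "sgn (c - a + \<epsilon> * (d - b)) = 1" using assms by auto
  then have "0 < c - a + \<epsilon> * (d - b)" by (simp add: sgn_1_pos)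
  then show ?case by (simp add: algebra_simps)
qed

lemma convex_cone_hull_finite_image:
  fixes f :: "'b \<Rightarrow> 'a::real_vector"
  assumes B: "finite B" and x: "x \<in> convex_cone hull (f ` B)"
  obtains c where "\<And>b. 0 \<le> c b" "x = (\<Sum>b\<in>B. c b *\<^sub>R f b)"
proof -
  define X where "X = {x. \<exists>c. (\<forall>b. 0 \<le> c b) \<and> x = (\<Sum>b\<in>B. c b *\<^sub>R f b)}"
  have "convex_cone hull (f ` B) \<subseteq> X"
  proof (rule hull_minimal)
    show "f ` B \<subseteq> X"
    proof
      fix y assume "y \<in> f ` B"
      then obtain b0 where b0: "b0 \<in> B" "y = f b0" by auto
      have "(\<Sum>b\<in>B. (if b = b0 then 1 else 0) *\<^sub>R f b) = (\<Sum>b\<in>B. if b = b0 then f b else 0)"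
        by (rule sum.cong) auto
      also have "\<dots> = y" using B b0 by simp
      finally show "y \<in> X" unfolding X_def
        by (intro CollectI exI[of _ "\<lambda>b. if b = b0 then 1 else 0"]) auto
    qed
    show "convex_cone X"
      unfolding convex_cone_iff
    proof (intro conjI ballI allI impI)
      show "0 \<in> X" unfolding X_def by (intro CollectI exI[of _ "\<lambda>_. 0"]) simp
      fix x y assume "x \<in> X" "y \<in> X"
      then obtain c c' where "\<forall>b. 0 \<le> c b" "x = (\<Sum>b\<in>B. c b *\<^sub>R f b)"
        "\<forall>b. 0 \<le> c' b" "y = (\<Sum>b\<in>B. c' b *\<^sub>R f b)" by (auto simp: X_def)
      then show "x + y \<in> X" unfolding X_def
        by (intro CollectI exI[of _ "\<lambda>b. c b + c' b"]) (auto simp: scaleR_add_left sum.distrib)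
    next
      fix x and t :: real assume "x \<in> X" and t: "0 \<le> t"
      then obtain c where "\<forall>b. 0 \<le> c b" "x = (\<Sum>b\<in>B. c b *\<^sub>R f b)" by (auto simp: X_def)
      then show "t *\<^sub>R x \<in> X" unfolding X_def using t
        by (intro CollectI exI[of _ "\<lambda>b. t * c b"]) (auto simp: scaleR_sum_right)
    qed
  qed
  then have "x \<in> X" using x by blast
  then obtain c where "\<forall>b. 0 \<le> c b" "x = (\<Sum>b\<in>B. c b *\<^sub>R f b)" by (auto simp: X_def)
  then show ?thesis using that by blast
qed

context cone_monoid
begin

lemma zero_in_S: "0 \<in> S"
  by (simp add: S_def idot_def)

lemma monoid_idealD:
  assumes "monoid_ideal J"
  shows "additive_group J" "J \<subseteq> supported_on S" "scale_closed J"
    "f \<in> J \<Longrightarrow> \<gamma> \<in> S \<Longrightarrow> single \<gamma> c * f \<in> J"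
proof -
  show "additive_group J" "J \<subseteq> supported_on S"
    and m: "f \<in> J \<Longrightarrow> \<gamma> \<in> S \<Longrightarrow> single \<gamma> c * f \<in> J" for f \<gamma> c
    using assms by (auto simp: monoid_ideal_def)
  show "scale_closed J"
    unfolding scale_closed_def
  proof (intro ballI allI)
    fix f c assume "f \<in> J"
    then show "\<exists>g\<in>J. \<forall>\<alpha>. lookup g \<alpha> = c * lookup f \<alpha>"
      using m[OF _ zero_in_S, of f c]
      by (intro bexI[of _ "single 0 c * f"]) (auto simp: lookup_single_mult)
  qed
qed

lemma monoid_ideal_initial_space:
  fixes J :: "((int ^ 'n) \<Rightarrow>\<^sub>0 'k::field) set"
  assumes J: "monoid_ideal J"
  shows "monoid_ideal (initial_space (wt v) J)"
  unfolding monoid_ideal_def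
proof (intro conjI ballI allI)
  note J' = monoid_idealD[OF J]
  show "additive_group (initial_space (wt v) J)" by (rule additive_group_initial_space[OF J'(1)])
  show "initial_space (wt v) J \<subseteq> supported_on S" by (rule initial_space_supported_on[OF J'(2)])
  fix g \<gamma> and c :: 'k assume g: "g \<in> initial_space (wt v) J" and \<gamma>: "\<gamma> \<in> S"
  show "single \<gamma> c * g \<in> initial_space (wt v) J"
    unfolding initial_space_def
  proof (intro CollectI allI)
    fix a
    obtain f where f: "f \<in> J" "\<And>\<alpha>. wt v \<alpha> < a - wt v \<gamma> \<Longrightarrow> lookup f \<alpha> = 0"
      "\<And>\<alpha>. wt v \<alpha> = a - wt v \<gamma> \<Longrightarrow> lookup f \<alpha> = lookup g \<alpha>"
      by (rule initial_spaceE[OF g, of "a - wt v \<gamma>"]) (rule that)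
    show "\<exists>f\<in>J. (\<forall>\<alpha>. wt v \<alpha> < a \<longrightarrow> lookup f \<alpha> = 0) \<and>
      (\<forall>\<alpha>. wt v \<alpha> = a \<longrightarrow>
        lookup f \<alpha> = lookup (single \<gamma> c * g) \<alpha>)"
      by (rule bexI[OF _ J'(4)[OF f(1) \<gamma>, of c]])
        (auto simp: lookup_single_mult real_vec_minus inner_diff_right f)
  qed
qed

lemma multiple_initial_form_mem:
  fixes J :: "((int ^ 'n) \<Rightarrow>\<^sub>0 'k::field) set"
  assumes J: "monoid_ideal J" and f: "f \<in> J" and \<gamma>: "\<gamma> \<in> S"
  shows "single \<gamma> c * initial_form v f \<in> initial_space (wt v) J"
proof -
  have "initial_form v f \<in> initial_space (wt v) J"
  proof (cases "f = 0")
    case True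
    then show ?thesis
      using additive_groupD(1)[OF additive_group_initial_space[OF monoid_idealD(1)[OF J]]]
      by (simp add: initial_form_0)
  next
    case False
    then obtain m where "leading v f m" using exists_leading by blast
    then have m: "m \<in> keys f"
      "\<And>\<alpha>. \<alpha> \<in> keys f \<Longrightarrow> wt v m \<le> wt v \<alpha>" by (auto simp: leading_def)
    have low: "lookup f \<alpha> = 0" if "wt v \<alpha> < wt v m" for \<alpha>
      using m(2)[of \<alpha>] that by (force simp: in_keys_iff)
    have init: "initial_form v f = part (\<lambda>\<alpha>. wt v \<alpha> = wt v m) f" by (rule initial_form_leading[OF m])
    show ?thesis
      unfolding init
      by (rule homogeneous_mem_initial_space[OF monoid_idealD(1)[OF J] f, of _ "wt v m"])
        (auto simp: lookup_part low)
  qed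
  then show ?thesis by (rule monoid_idealD(4)[OF monoid_ideal_initial_space[OF J]]) (rule \<gamma>)
qed

end

lemma initial_form_same_signs:
  fixes f :: "(int ^ 'n) \<Rightarrow>\<^sub>0 'k::field"
  assumes "\<And>\<alpha> \<beta>. \<alpha> \<in> keys f \<Longrightarrow> \<beta> \<in> keys f \<Longrightarrow>
     sgn (wt v (\<alpha> - \<beta>)) = sgn (wt w (\<alpha> - \<beta>))"
  shows "initial_form v f = initial_form w f"
proof (cases "f = 0")
  case False
  then have "keys f \<noteq> {}" by simp
  then obtain m where m: "m \<in> keys f"
    "\<And>\<alpha>. \<alpha> \<in> keys f \<Longrightarrow> wt v m \<le> wt v \<alpha>"
    by (rule exists_least_key[where w = "wt v"]) blast
  have s: "wt v m \<le> wt v \<alpha> \<longleftrightarrow> wt w m \<le> wt w \<alpha>" "wt v \<alpha> = wt v m \<longleftrightarrow> wt w \<alpha> = wt w m"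
    if "\<alpha> \<in> keys f" for \<alpha>
    using assms[OF that m(1)]
    by (auto simp: real_vec_minus inner_diff_right sgn_real_def split: if_splits)
  have eqv: "initial_form v f = part (\<lambda>\<alpha>. wt v \<alpha> = wt v m) f" by (rule initial_form_leading[OF m])
  have eqw: "initial_form w f = part (\<lambda>\<alpha>. wt w \<alpha> = wt w m) f"
    by (rule initial_form_leading) (use m s in auto)
  show ?thesis unfolding eqv eqw
    by (intro poly_mapping_eqI) (use s in \<open>auto simp: lookup_part in_keys_iff\<close>)
qed (simp add: initial_form_0)

text \<open>
  The least term for \<open>v + \<epsilon>w\<close> is the one that is least for \<open>v\<close> and, among those, least for \<open>w\<close>;
  only finitely many terms compete.
\<close>

lemma initial_form_perturbed:
  fixes f :: "(int ^ 'n) \<Rightarrow>\<^sub>0 'k::field"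
  shows "\<forall>\<^sub>F \<epsilon> in at_right 0. initial_form (v + \<epsilon> *\<^sub>R w) f = initial_form w (initial_form v f)"
proof (cases "f = 0")
  case False
  then have "keys f \<noteq> {}" by simp
  then obtain m' where m': "m' \<in> keys f"
    "\<And>\<alpha>. \<alpha> \<in> keys f \<Longrightarrow> wt v m' \<le> wt v \<alpha>"
    by (rule exists_least_key[where w = "wt v"]) blast
  have eqv: "initial_form v f = part (\<lambda>\<alpha>. wt v \<alpha> = wt v m') f" by (rule initial_form_leading[OF m'])
  then have "m' \<in> keys (initial_form v f)" using m'(1) by (simp add: keys_part)
  then have "keys (initial_form v f) \<noteq> {}" by auto
  then obtain m where m: "m \<in> keys (initial_form v f)"
    "\<And>\<alpha>. \<alpha> \<in> keys (initial_form v f) \<Longrightarrow> wt w m \<le> wt w \<alpha>"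
    by (rule exists_least_key[where w = "wt w"]) blast
  have mk: "m \<in> keys f" "wt v m = wt v m'" using m(1) by (auto simp: eqv keys_part)
  have eqw: "initial_form w (initial_form v f) =
      part (\<lambda>\<alpha>. wt w \<alpha> = wt w m) (part (\<lambda>\<alpha>. wt v \<alpha> = wt v m') f)"
    using initial_form_leading[OF m] by (simp add: eqv)
  have "\<forall>\<^sub>F \<epsilon> in at_right 0. \<forall>\<alpha>\<in>keys f.
      (wt v \<alpha> = wt v m \<and> wt w \<alpha> = wt w m) \<or> wt v m + \<epsilon> * wt w m < wt v \<alpha> + \<epsilon> * wt w \<alpha>"
  proof (rule eventually_ball_finite, simp, rule ballI)
    fix \<alpha> assume \<alpha>: "\<alpha> \<in> keys f"
    show "\<forall>\<^sub>F \<epsilon> in at_right 0. (wt v \<alpha> = wt v m \<and> wt w \<alpha> = wt w m) \<or>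
        wt v m + \<epsilon> * wt w m < wt v \<alpha> + \<epsilon> * wt w \<alpha>"
    proof (cases "wt v \<alpha> = wt v m \<and> wt w \<alpha> = wt w m")
      case False
      have "wt v m < wt v \<alpha> \<or> wt v m = wt v \<alpha> \<and> wt w m < wt w \<alpha>"
      proof (cases "wt v \<alpha> = wt v m")
        case True
        then have "\<alpha> \<in> keys (initial_form v f)" using \<alpha> mk by (simp add: eqv keys_part)
        then show ?thesis using m(2)[of \<alpha>] True False by simp
      next
        case ne: False
        then show ?thesis using m'(2)[OF \<alpha>] mk by simp
      qed
      from eventually_less_at_right[OF this] show ?thesis by eventually_elim simp
    qed simp
  qed
  then show ?thesis
  proof eventually_elim
    case (elim \<epsilon>)
    have split: "wt (v + \<epsilon> *\<^sub>R w) \<alpha> = wt v \<alpha> + \<epsilon> * wt w \<alpha>" for \<alpha>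
      by (simp add: inner_add_left)
    have "initial_form (v + \<epsilon> *\<^sub>R w) f = part (\<lambda>\<alpha>. wt (v + \<epsilon> *\<^sub>R w) \<alpha> = wt (v + \<epsilon> *\<^sub>R w) m) f"
      by (rule initial_form_leading[OF mk(1)]) (use elim in \<open>force simp: split\<close>)
    also have "\<dots> = initial_form w (initial_form v f)"
      unfolding eqw split
      by (intro poly_mapping_eqI) (use elim mk in \<open>force simp: lookup_part in_keys_iff\<close>)
    finally show ?case .
  qed
qed (simp add: initial_form_0)

context cone_monoid
begin

text \<open>
  The signs of the weights of differences of exponents determine the initial forms of a universal
  basis, and these determine the initial space.
\<close>

lemma finitely_many_sign_cells:
  fixes J :: "((int ^ 'n) \<Rightarrow>\<^sub>0 'k::field) set"
  assumes J: "monoid_ideal J"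
  obtains H :: "(int ^ 'n) set" where "finite H"
    "\<And>v w. \<forall>h\<in>H. sgn (wt v h) = sgn (wt w h) \<Longrightarrow>
       initial_space (wt v) J = initial_space (wt w) J"
proof -
  obtain F where F: "finite F" "F \<subseteq> J" "universal_basis J F"
    by (rule exists_universal_basis[OF J])
  define H where "H = (\<Union>f\<in>F. (\<lambda>(\<alpha>, \<beta>). \<alpha> - \<beta>) ` (keys f \<times> keys f))"
  have sub: "initial_space (wt v) J \<subseteq> initial_space (wt w) J"
    if signs: "\<forall>h\<in>H. sgn (wt v h) = sgn (wt w h)" for v w
  proof (rule universal_basisD[OF F(3) additive_group_initial_space[OF monoid_idealD(1)[OF J]]])
    fix f \<gamma> c assume f: "f \<in> F" and \<gamma>: "\<gamma> \<in> S"
    have "initial_form v f = initial_form w f"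
      by (rule initial_form_same_signs, rule signs[rule_format]) (use f in \<open>force simp: H_def\<close>)
    then show "single \<gamma> c * initial_form v f \<in> initial_space (wt w) J"
      using multiple_initial_form_mem[OF J _ \<gamma>] f F(2) by auto
  qed
  show ?thesis
  proof (rule that[of H])
    show "finite H" using F(1) by (auto simp: H_def)
    show "initial_space (wt v) J = initial_space (wt w) J"
      if "\<forall>h\<in>H. sgn (wt v h) = sgn (wt w h)" for v w
      using sub[of v w] sub[of w v] that by auto
  qed
qed

text \<open>
  For one polynomial the threshold for \<open>\<epsilon>\<close> depends on the polynomial. One inclusion gets a uniform
  threshold from a finite universal basis, the other one from the fact that the initial space is the
  same for all small \<open>\<epsilon>\<close>, since \<open>v + \<epsilon>w\<close> stays in one sign cell.
\<close>

theorem initial_space_perturbed: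
  fixes J :: "((int ^ 'n) \<Rightarrow>\<^sub>0 'k::field) set"
  assumes J: "monoid_ideal J"
  shows "\<forall>\<^sub>F \<epsilon> in at_right 0.
    initial_space (wt (v + \<epsilon> *\<^sub>R w)) J = initial_space (wt w) (initial_space (wt v) J)"
proof -
  note J' = monoid_idealD[OF J]
  define W where "W = initial_space (wt v) J"
  have W: "monoid_ideal W" unfolding W_def by (rule monoid_ideal_initial_space[OF J])
  have split: "wt (v + \<epsilon> *\<^sub>R w) \<alpha> = wt v \<alpha> + \<epsilon> * wt w \<alpha>" for \<epsilon> \<alpha>
    by (simp add: inner_add_left)
  obtain H :: "(int ^ 'n) set" where H: "finite H"
    "\<And>v w. \<forall>h\<in>H. sgn (wt v h) = sgn (wt w h) \<Longrightarrow>
       initial_space (wt v) J = initial_space (wt w) J"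
    by (rule finitely_many_sign_cells[OF J]) (rule that)
  define cell where "cell \<epsilon> \<longleftrightarrow> (\<forall>h\<in>H. sgn (wt (v + \<epsilon> *\<^sub>R w) h) =
      (if wt v h \<noteq> 0 then sgn (wt v h) else sgn (wt w h)))" for \<epsilon>
  have ev_cell: "\<forall>\<^sub>F \<epsilon> in at_right 0. cell \<epsilon>"
    unfolding cell_def split
    by (rule eventually_ball_finite[OF H(1)]) (intro ballI eventually_sgn_at_right)
  have const: "initial_space (wt (v + \<epsilon> *\<^sub>R w)) J = initial_space (wt (v + \<epsilon>' *\<^sub>R w)) J"
    if "cell \<epsilon>" "cell \<epsilon>'" for \<epsilon> \<epsilon>'
    by (rule H(2)) (use that in \<open>simp add: cell_def\<close>)
  obtain F where F: "finite F" "F \<subseteq> J" "universal_basis J F"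
    by (rule exists_universal_basis[OF J])
  have "\<forall>\<^sub>F \<epsilon> in at_right 0. \<forall>f\<in>F. initial_form (v + \<epsilon> *\<^sub>R w) f = initial_form w (initial_form v f)"
    by (rule eventually_ball_finite[OF F(1)]) (intro ballI initial_form_perturbed)
  with ev_cell show ?thesis
  proof eventually_elim
    case (elim \<epsilon>)
    show ?case
    proof
      show "initial_space (wt (v + \<epsilon> *\<^sub>R w)) J \<subseteq> initial_space (wt w) (initial_space (wt v) J)"
      proof (rule universal_basisD[OF F(3) additive_group_initial_space[OF additive_group_initial_space[OF J'(1)]]])
        fix f \<gamma> c assume f: "f \<in> F" and \<gamma>: "\<gamma> \<in> S"
        have "single 0 1 * initial_form v f \<in> W"
          unfolding W_def using f F(2) by (intro multiple_initial_form_mem[OF J _ zero_in_S]) auto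
        then have "initial_form v f \<in> W" by simp
        from multiple_initial_form_mem[OF W this \<gamma>]
        show "single \<gamma> c * initial_form (v + \<epsilon> *\<^sub>R w) f
            \<in> initial_space (wt w) (initial_space (wt v) J)"
          using elim(2) f by (simp add: W_def)
      qed
      show "initial_space (wt w) (initial_space (wt v) J) \<subseteq> initial_space (wt (v + \<epsilon> *\<^sub>R w)) J"
      proof
        fix g assume g: "g \<in> initial_space (wt w) (initial_space (wt v) J)"
        show "g \<in> initial_space (wt (v + \<epsilon> *\<^sub>R w)) J"
        proof (rule mem_if_parts_mem[OF additive_group_initial_space[OF J'(1)]])
          fix x :: "real \<times> real"
          obtain a b where x: "x = (a, b)" by (cases x)
          define p where "p = part (\<lambda>\<alpha>. (wt v \<alpha>, wt w \<alpha>) = x) g"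
          obtain g' where g': "g' \<in> initial_space (wt v) J"
            "\<And>\<alpha>. wt w \<alpha> < b \<Longrightarrow> lookup g' \<alpha> = 0"
            "\<And>\<alpha>. wt w \<alpha> = b \<Longrightarrow> lookup g' \<alpha> = lookup g \<alpha>"
            by (rule initial_spaceE[OF g, of b]) (rule that)
          obtain f where f: "f \<in> J"
            "\<And>\<alpha>. wt v \<alpha> < a \<Longrightarrow> lookup f \<alpha> = 0"
            "\<And>\<alpha>. wt v \<alpha> = a \<Longrightarrow> lookup f \<alpha> = lookup g' \<alpha>"
            by (rule initial_spaceE[OF g'(1), of a]) (rule that)
          have "\<forall>\<^sub>F \<epsilon> in at_right 0. \<forall>\<alpha>\<in>keys f.
              (wt v \<alpha> = a \<and> wt w \<alpha> = b) \<or> a + \<epsilon> * b < wt v \<alpha> + \<epsilon> * wt w \<alpha>"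
          proof (rule eventually_ball_finite, simp, rule ballI)
            fix \<alpha> assume \<alpha>: "\<alpha> \<in> keys f"
            show "\<forall>\<^sub>F \<epsilon> in at_right 0. (wt v \<alpha> = a \<and> wt w \<alpha> = b) \<or>
                a + \<epsilon> * b < wt v \<alpha> + \<epsilon> * wt w \<alpha>"
            proof (cases "wt v \<alpha> = a \<and> wt w \<alpha> = b")
              case False
              have "a \<le> wt v \<alpha>" using f(2)[of \<alpha>] \<alpha> by (force simp: in_keys_iff)
              moreover have "b \<le> wt w \<alpha>" if "wt v \<alpha> = a"
                using f(3)[OF that] g'(2)[of \<alpha>] \<alpha> by (force simp: in_keys_iff)
              ultimately have "a < wt v \<alpha> \<or> a = wt v \<alpha> \<and> b < wt w \<alpha>" using False by auto
              from eventually_less_at_right[OF this] show ?thesis by eventually_elim simp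
            qed simp
          qed
          then have "\<forall>\<^sub>F \<epsilon> in at_right 0. cell \<epsilon> \<and> (\<forall>\<alpha>\<in>keys f.
              (wt v \<alpha> = a \<and> wt w \<alpha> = b) \<or> a + \<epsilon> * b < wt v \<alpha> + \<epsilon> * wt w \<alpha>)"
            using ev_cell by eventually_elim simp
          then obtain \<epsilon>' where \<epsilon>': "cell \<epsilon>'" "\<And>\<alpha>. \<alpha> \<in> keys f \<Longrightarrow>
              (wt v \<alpha> = a \<and> wt w \<alpha> = b) \<or> a + \<epsilon>' * b < wt v \<alpha> + \<epsilon>' * wt w \<alpha>"
            by (rule eventually_at_rightE) blast
          have "p \<in> initial_space (wt (v + \<epsilon>' *\<^sub>R w)) J"
          proof (rule homogeneous_mem_initial_space[OF J'(1) f(1), of _ "a + \<epsilon>' * b"])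
            fix \<alpha>
            show "lookup f \<alpha> = 0" if "wt (v + \<epsilon>' *\<^sub>R w) \<alpha> < a + \<epsilon>' * b"
              using \<epsilon>'(2)[of \<alpha>] that by (force simp: split in_keys_iff)
            show "lookup p \<alpha> = 0" if "wt (v + \<epsilon>' *\<^sub>R w) \<alpha> \<noteq> a + \<epsilon>' * b"
              using that by (auto simp: p_def lookup_part x split)
            show "lookup f \<alpha> = lookup p \<alpha>"
              if "wt (v + \<epsilon>' *\<^sub>R w) \<alpha> = a + \<epsilon>' * b"
            proof (cases "wt v \<alpha> = a \<and> wt w \<alpha> = b")
              case True
              then show ?thesis by (simp add: p_def lookup_part x f(3) g'(3))
            next
              case False
              then show ?thesis
                using \<epsilon>'(2)[of \<alpha>] that by (auto simp: p_def lookup_part x split in_keys_iff)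
            qed
          qed
          then show "part (\<lambda>\<alpha>. (wt v \<alpha>, wt w \<alpha>) = x) g \<in> initial_space (wt (v + \<epsilon> *\<^sub>R w)) J"
            using const[OF elim(1) \<epsilon>'(1)] by (simp add: p_def)
        qed
      qed
    qed
  qed
qed

definition cone :: "(real ^ 'n) set" where "cone = convex_cone hull (real_vec ` B)"

lemma wt_nonneg: "v \<in> cone \<Longrightarrow> \<alpha> \<in> S \<Longrightarrow> 0 \<le> wt v \<alpha>"
proof -
  assume v: "v \<in> cone" and \<alpha>: "\<alpha> \<in> S"
  obtain c where c: "\<And>b. 0 \<le> c b" "v = (\<Sum>b\<in>B. c b *\<^sub>R real_vec b)"
    using convex_cone_hull_finite_image[OF finite_B] v unfolding cone_def by blast
  have "wt v \<alpha> = (\<Sum>b\<in>B. c b * of_int (idot b \<alpha>))"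
    by (simp add: c(2) inner_sum_left wt_real_vec)
  also have "\<dots> \<ge> 0" using c(1) \<alpha> by (intro sum_nonneg) (auto simp: S_def)
  finally show ?thesis .
qed

text \<open>
  A nonnegative combination of the generators in \<open>B\<close> takes discrete values on the monoid, although
  infinitely many monomials may share one value when \<open>v\<close> is on the boundary.
\<close>

lemma finite_weights_below:
  assumes v: "v \<in> cone"
  shows "finite (wt v ` {\<alpha> \<in> S. wt v \<alpha> < N})"
proof -
  obtain c where c: "\<And>b. 0 \<le> c b" "v = (\<Sum>b\<in>B. c b *\<^sub>R real_vec b)"
    using convex_cone_hull_finite_image[OF finite_B] v unfolding cone_def by blast
  define B' where "B' = {b \<in> B. c b > 0}"
  have finB': "finite B'" using finite_B by (simp add: B'_def)
  have wt: "wt v \<alpha> = (\<Sum>b\<in>B'. c b * of_int (idot b \<alpha>))" for \<alpha>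
  proof -
    have "wt v \<alpha> = (\<Sum>b\<in>B. c b * of_int (idot b \<alpha>))"
      by (simp add: c(2) inner_sum_left wt_real_vec)
    also have "\<dots> = (\<Sum>b\<in>B'. c b * of_int (idot b \<alpha>))"
      using c(1) by (intro sum.mono_neutral_right finite_B) (auto simp: B'_def order_less_le)
    finally show ?thesis .
  qed
  have "wt v ` {\<alpha> \<in> S. wt v \<alpha> < N} \<subseteq>
      (\<lambda>x. \<Sum>b\<in>B'. c b * of_int (x b)) ` (\<Pi>\<^sub>E b\<in>B'. {0..\<lceil>N / c b\<rceil>})"
  proof
    fix y assume "y \<in> wt v ` {\<alpha> \<in> S. wt v \<alpha> < N}"
    then obtain \<alpha> where \<alpha>: "\<alpha> \<in> S" "wt v \<alpha> < N" "y = wt v \<alpha>" by auto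
    have "idot b \<alpha> \<in> {0..\<lceil>N / c b\<rceil>}" if b: "b \<in> B'" for b
    proof -
      have cb: "c b > 0" using b by (simp add: B'_def)
      have nn: "0 \<le> idot b' \<alpha>" if "b' \<in> B'" for b'
        using \<alpha>(1) that by (simp add: S_def B'_def)
      have "c b * of_int (idot b \<alpha>) \<le> (\<Sum>b\<in>B'. c b * of_int (idot b \<alpha>))"
        using b finB' nn c(1) by (intro member_le_sum) auto
      then have "of_int (idot b \<alpha>) \<le> N / c b" using \<alpha>(2) cb by (simp add: wt field_simps)
      then show ?thesis using nn[OF b] by (simp add: le_ceiling_iff le_less_trans)
    qed
    then have "(\<lambda>b\<in>B'. idot b \<alpha>) \<in> (\<Pi>\<^sub>E b\<in>B'. {0..\<lceil>N / c b\<rceil>})" by auto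
    moreover have "y = (\<Sum>b\<in>B'. c b * of_int ((\<lambda>b\<in>B'. idot b \<alpha>) b))"
      unfolding \<alpha>(3) wt by (rule sum.cong) auto
    ultimately show "y \<in> (\<lambda>x. \<Sum>b\<in>B'. c b * of_int (x b)) ` (\<Pi>\<^sub>E b\<in>B'. {0..\<lceil>N / c b\<rceil>})"
      by blast
  qed
  then show ?thesis by (rule finite_subset) (intro finite_imageI finite_PiE finB', simp)
qed

text \<open>
  An interior vector dominates a positive multiple of \<open>\<Sum>B\<close>, so a bound on the weight bounds the degree.
\<close>

lemma finite_weight_fibre:
  assumes z: "z \<in> interior cone"
  shows "finite {\<alpha> \<in> S. wt z \<alpha> = a}"
proof -
  define s where "s = (\<Sum>b\<in>B. real_vec b)"
  have wts: "wt s \<alpha> = of_int (deg \<alpha>)" for \<alpha>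
    by (simp add: s_def inner_sum_left wt_real_vec deg_def)
  have "((\<lambda>\<epsilon>. z - \<epsilon> *\<^sub>R s) \<longlongrightarrow> z - 0 *\<^sub>R s) (at_right 0)" by (intro tendsto_intros)
  then have "\<forall>\<^sub>F \<epsilon> in at_right 0. z - \<epsilon> *\<^sub>R s \<in> interior cone"
    by (rule topological_tendstoD) (use z in auto)
  then obtain \<epsilon> where \<epsilon>: "0 < \<epsilon>" "z - \<epsilon> *\<^sub>R s \<in> interior cone"
    by (rule eventually_at_rightE)
  have "{\<alpha> \<in> S. wt z \<alpha> = a} \<subseteq> upto_degree \<lceil>a / \<epsilon>\<rceil>"
  proof
    fix \<alpha> assume \<alpha>: "\<alpha> \<in> {\<alpha> \<in> S. wt z \<alpha> = a}"
    have "0 \<le> wt (z - \<epsilon> *\<^sub>R s) \<alpha>"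
      using \<epsilon>(2) interior_subset \<alpha> by (intro wt_nonneg) auto
    then have "\<epsilon> * of_int (deg \<alpha>) \<le> a" using \<alpha> by (simp add: inner_diff_left wts)
    then have "of_int (deg \<alpha>) \<le> a / \<epsilon>" using \<epsilon>(1) by (simp add: field_simps)
    then have "deg \<alpha> \<le> \<lceil>a / \<epsilon>\<rceil>" by linarith
    then show "\<alpha> \<in> upto_degree \<lceil>a / \<epsilon>\<rceil>" using \<alpha> by (simp add: upto_degree_def)
  qed
  then show ?thesis using finite_upto_degree by (rule finite_subset)
qed

text \<open>
  The common initial space \<open>I\<close> is homogeneous for \<open>u\<close> and \<open>u'\<close>, hence for \<open>u' - u\<close>, and by
  perturbation \<open>u + \<epsilon>(u' - u)\<close> and \<open>u' + \<epsilon>(u - u')\<close> have initial space \<open>I\<close> as well. Unlike \<open>u\<close> and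
  \<open>u'\<close>, which may lie on different faces, these two points dominate multiples of each other.
\<close>

theorem initial_space_convex:
  fixes J :: "((int ^ 'n) \<Rightarrow>\<^sub>0 'k::field) set"
  assumes J: "monoid_ideal J" and u: "u \<in> cone" and u': "u' \<in> cone"
    and eq: "initial_space (wt u) J = initial_space (wt u') J" and t: "0 < t" "t < 1"
  shows "initial_space (wt ((1 - t) *\<^sub>R u + t *\<^sub>R u')) J = initial_space (wt u) J"
proof -
  note J' = monoid_idealD[OF J]
  define I where "I = initial_space (wt u) J"
  have I': "initial_space (wt u') J = I" using eq by (simp add: I_def)
  have addI: "additive_group I" unfolding I_def by (rule additive_group_initial_space[OF J'(1)])
  have hom_u: "homogeneous (wt u) I" unfolding I_def by (rule homogeneous_initial_space[OF J'(1)])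
  have hom_u': "homogeneous (wt u') I"
    unfolding I_def eq by (rule homogeneous_initial_space[OF J'(1)])
  have stable: "initial_space (wt (a *\<^sub>R u + b *\<^sub>R u')) I = I" for a b
    by (rule initial_space_homogeneous[OF addI homogeneous_combination[OF addI hom_u hom_u', of _ a b]])
      (simp add: inner_add_left)
  have stable1: "initial_space (wt (u' - u)) I = I" using stable[of "-1" 1] by simp
  have stable2: "initial_space (wt (u - u')) I = I" using stable[of 1 "-1"] by simp
  have "\<forall>\<^sub>F \<epsilon> in at_right 0. initial_space (wt (u + \<epsilon> *\<^sub>R (u' - u))) J = I"
    using initial_space_perturbed[OF J, of u "u' - u"] unfolding I_def[symmetric] stable1 .
  moreover have "\<forall>\<^sub>F \<epsilon> in at_right 0. initial_space (wt (u' + \<epsilon> *\<^sub>R (u - u'))) J = I"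
    using initial_space_perturbed[OF J, of u' "u - u'"] by (simp add: stable2 I')
  moreover have "\<forall>\<^sub>F \<epsilon>::real in at_right 0. \<epsilon> \<in> {0<..<min (1/2) (min t (1 - t))}"
    by (rule eventually_at_right_real) (use t in auto)
  ultimately have "\<forall>\<^sub>F \<epsilon> in at_right 0. initial_space (wt (u + \<epsilon> *\<^sub>R (u' - u))) J = I \<and>
      initial_space (wt (u' + \<epsilon> *\<^sub>R (u - u'))) J = I \<and> 0 < \<epsilon> \<and> \<epsilon> < 1/2 \<and> \<epsilon> < t \<and> \<epsilon> < 1 - t"
    by eventually_elim simp
  then obtain \<epsilon> where p: "initial_space (wt (u + \<epsilon> *\<^sub>R (u' - u))) J = I"
      and p': "initial_space (wt (u' + \<epsilon> *\<^sub>R (u - u'))) J = I"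
      and \<epsilon>: "0 < \<epsilon>" "\<epsilon> < 1/2" "\<epsilon> < t" "\<epsilon> < 1 - t"
    by (rule eventually_at_rightE) blast
  define s where "s = (1 - t - \<epsilon>) / (1 - 2 * \<epsilon>)"
  define s' where "s' = (t - \<epsilon>) / (1 - 2 * \<epsilon>)"
  have s: "s > 0" "s' > 0" using \<epsilon> by (simp_all add: s_def s'_def)
  have comb: "s * (1 - \<epsilon>) + s' * \<epsilon> = 1 - t" "s * \<epsilon> + s' * (1 - \<epsilon>) = t"
  proof -
    have ne: "1 - 2 * \<epsilon> \<noteq> 0" using \<epsilon> by simp
    show "s * (1 - \<epsilon>) + s' * \<epsilon> = 1 - t" unfolding s_def s'_def using ne
      by (simp add: divide_simps) (simp add: algebra_simps)
    show "s * \<epsilon> + s' * (1 - \<epsilon>) = t" unfolding s_def s'_def using ne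
      by (simp add: divide_simps) (simp add: algebra_simps)
  qed
  have w1: "wt (u + \<epsilon> *\<^sub>R (u' - u)) \<alpha> = (1 - \<epsilon>) * wt u \<alpha> + \<epsilon> * wt u' \<alpha>" for \<alpha>
    by (simp add: inner_add_left inner_diff_left algebra_simps)
  have w2: "wt (u' + \<epsilon> *\<^sub>R (u - u')) \<alpha> = \<epsilon> * wt u \<alpha> + (1 - \<epsilon>) * wt u' \<alpha>" for \<alpha>
    by (simp add: inner_add_left inner_diff_left algebra_simps)
  have dominated: "\<epsilon> * ((1 - \<epsilon>) * x + \<epsilon> * y) \<le> \<epsilon> * x + (1 - \<epsilon>) * y" if "0 \<le> x" "0 \<le> y" for x y
  proof -
    have "\<epsilon> * \<epsilon> \<le> (1/2) * \<epsilon>" using \<epsilon> by (intro mult_right_mono) auto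
    then have "0 \<le> 1 - \<epsilon> - \<epsilon> * \<epsilon>" using \<epsilon>(2) by linarith
    then have "0 \<le> (\<epsilon> * \<epsilon>) * x + (1 - \<epsilon> - \<epsilon> * \<epsilon>) * y"
      using that \<epsilon>(1) by (intro add_nonneg_nonneg mult_nonneg_nonneg) auto
    then show ?thesis by (simp add: algebra_simps)
  qed
  have "convex cone" by (simp add: cone_def convex_convex_cone_hull)
  have mem: "(1 - x) *\<^sub>R u + x *\<^sub>R u' \<in> cone" if "0 \<le> x" "x \<le> 1" for x
    using convexD[OF \<open>convex cone\<close> u u', of "1 - x" x] that by simp
  have p_mem: "u + \<epsilon> *\<^sub>R (u' - u) \<in> cone"
    using mem[of \<epsilon>] \<epsilon> by (simp add: algebra_simps)
  have q_mem: "(1 - t) *\<^sub>R u + t *\<^sub>R u' \<in> cone" using mem[of t] t by simp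
  have "initial_space (wt ((1 - t) *\<^sub>R u + t *\<^sub>R u')) J = initial_space (wt (u + \<epsilon> *\<^sub>R (u' - u))) J"
  proof (rule initial_space_between[OF J'(1,3,2)])
    show "initial_space (wt (u + \<epsilon> *\<^sub>R (u' - u))) J = initial_space (wt (u' + \<epsilon> *\<^sub>R (u - u'))) J"
      by (simp only: p p')
    show "0 < s" "0 < s'" "0 < \<epsilon>" by (fact s \<epsilon>)+
    show "finite (wt (u + \<epsilon> *\<^sub>R (u' - u)) ` {\<alpha> \<in> S. wt (u + \<epsilon> *\<^sub>R (u' - u)) \<alpha> < N})" for N
      by (rule finite_weights_below[OF p_mem])
    show "finite (wt ((1 - t) *\<^sub>R u + t *\<^sub>R u') ` {\<alpha> \<in> S. wt ((1 - t) *\<^sub>R u + t *\<^sub>R u') \<alpha> < N})" for N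
      by (rule finite_weights_below[OF q_mem])
    fix \<alpha>
    have "wt ((1 - t) *\<^sub>R u + t *\<^sub>R u') \<alpha>
        = (s * (1 - \<epsilon>) + s' * \<epsilon>) * wt u \<alpha> + (s * \<epsilon> + s' * (1 - \<epsilon>)) * wt u' \<alpha>"
      by (simp add: comb inner_add_left)
    also have "\<dots> = s * wt (u + \<epsilon> *\<^sub>R (u' - u)) \<alpha> + s' * wt (u' + \<epsilon> *\<^sub>R (u - u')) \<alpha>"
      unfolding w1 w2 by (simp add: algebra_simps)
    finally show "wt ((1 - t) *\<^sub>R u + t *\<^sub>R u') \<alpha>
        = s * wt (u + \<epsilon> *\<^sub>R (u' - u)) \<alpha> + s' * wt (u' + \<epsilon> *\<^sub>R (u - u')) \<alpha>" .
    assume \<alpha>: "\<alpha> \<in> S"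
    note nn = wt_nonneg[OF u \<alpha>] wt_nonneg[OF u' \<alpha>]
    show "\<epsilon> * wt (u + \<epsilon> *\<^sub>R (u' - u)) \<alpha> \<le> wt (u' + \<epsilon> *\<^sub>R (u - u')) \<alpha>"
      unfolding w1 w2 by (rule dominated[OF nn])
    show "\<epsilon> * wt (u' + \<epsilon> *\<^sub>R (u - u')) \<alpha> \<le> wt (u + \<epsilon> *\<^sub>R (u' - u)) \<alpha>"
      unfolding w1 w2 using dominated[OF nn(2,1)] by (simp add: add.commute)
  qed
  then show ?thesis by (simp add: p I_def)
qed

text \<open>
  By perturbation the assumption says that \<open>v\<close> turns the initial space at \<open>z\<close>, and its initial
  spaces in the directions \<open>d\<close> and \<open>- d\<close>, into the same space \<open>I\<close>.
\<close>

theorem initial_space_collapse: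
  fixes J :: "((int ^ 'n) \<Rightarrow>\<^sub>0 'k::field) set"
  assumes J: "monoid_ideal J" and z: "z \<in> interior cone" and v: "v \<in> cone" and \<eta>: "0 < \<eta>"
    and const: "\<And>s \<epsilon>. \<bar>s\<bar> \<le> \<eta> \<Longrightarrow> 0 < \<epsilon> \<Longrightarrow>
       initial_space (wt (z + s *\<^sub>R d + \<epsilon> *\<^sub>R v)) J = I"
  shows "\<forall>\<^sub>F s in at_right 0. initial_space (wt (z + s *\<^sub>R d)) J = initial_space (wt z) J"
proof -
  define W where "W = initial_space (wt z) J"
  have W: "monoid_ideal W" unfolding W_def by (rule monoid_ideal_initial_space[OF J])
  note W' = monoid_idealD[OF W]
  have iter: "initial_space (wt v) (initial_space (wt (z + s *\<^sub>R d)) J) = I" if s: "\<bar>s\<bar> \<le> \<eta>" for s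
  proof -
    have "\<forall>\<^sub>F \<epsilon>::real in at_right 0. 0 < \<epsilon>" by (simp add: eventually_at_right_less)
    with initial_space_perturbed[OF J, of "z + s *\<^sub>R d" v]
    have "\<forall>\<^sub>F \<epsilon>::real in at_right 0. initial_space (wt v) (initial_space (wt (z + s *\<^sub>R d)) J) = I"
      by eventually_elim (use const[OF s] in simp)
    then show ?thesis by simp
  qed
  have direction: "initial_space (wt v) (initial_space (wt (a *\<^sub>R d)) W) = I" if a: "\<bar>a\<bar> = 1" for a
  proof -
    have "\<forall>\<^sub>F s::real in at_right 0. s \<in> {0<..<\<eta>}"
      by (rule eventually_at_right_real) (rule \<eta>)
    with initial_space_perturbed[OF J, of z "a *\<^sub>R d"]
    have "\<forall>\<^sub>F s::real in at_right 0. initial_space (wt v) (initial_space (wt (a *\<^sub>R d)) W) = I"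
    proof eventually_elim
      case (elim s)
      then have "\<bar>s * a\<bar> \<le> \<eta>" using a by (simp add: abs_mult)
      from iter[OF this] show ?case using elim(1) by (simp add: W_def)
    qed
    then show ?thesis by simp
  qed
  have base: "initial_space (wt v) W = I" using iter[of 0] \<eta> by (simp add: W_def)
  have up: "initial_space (wt v) (initial_space (wt d) W) = initial_space (wt v) W"
    using direction[of 1] base by simp
  have down: "initial_space (wt v) (initial_space (\<lambda>\<alpha>. - wt d \<alpha>) W) = initial_space (wt v) W"
    using direction[of "-1"] base by simp
  have homW: "homogeneous (wt z) W"
    unfolding W_def by (rule homogeneous_initial_space[OF monoid_idealD(1)[OF J]])
  have "initial_space (wt d) W = W"
    by (rule initial_space_direction_trivial[OF W'(1,3,2) homW finite_weight_fibre[OF z]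
        finite_weights_below[OF v] up down])
  with initial_space_perturbed[OF J, of z d] show ?thesis
    by (simp add: W_def)
qed

end

section \<open>Rational polyhedral cones\<close>

lemma convex_cone_sum:
  assumes C: "convex_cone C" and I: "finite I"
    and mem: "\<And>i. i \<in> I \<Longrightarrow> 0 \<le> c i" "\<And>i. i \<in> I \<Longrightarrow> c i \<noteq> 0 \<Longrightarrow> g i \<in> C"
  shows "(\<Sum>i\<in>I. c i *\<^sub>R g i) \<in> C"
  using I mem
proof (induction I)
  case empty
  show ?case using C by (simp add: convex_cone_contains_0)
next
  case (insert i I)
  have "c i *\<^sub>R g i \<in> C"
  proof (cases "c i = 0")
    case True
    then show ?thesis using C by (simp add: convex_cone_contains_0)
  next
    case False
    then show ?thesis using insert.prems by (intro convex_cone_scaleR[OF C]) auto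
  qed
  moreover have "(\<Sum>i\<in>I. c i *\<^sub>R g i) \<in> C" using insert.prems by (intro insert.IH) auto
  ultimately show ?case using insert.hyps by (simp add: convex_cone_add[OF C])
qed

lemma rational_polyhedral_cone_convex_cone: "rational_polyhedral_cone C \<Longrightarrow> convex_cone C"
  by (auto simp: rational_polyhedral_cone_def convex_cone_convex_cone_hull)

lemma rational_polyhedral_cone_polyhedron: "rational_polyhedral_cone C \<Longrightarrow> polyhedron C"
  by (auto simp: rational_polyhedral_cone_def polyhedron_convex_cone_hull)

text \<open>
  One step of the double description method: the generators inside the half-space are kept, and each
  pair of generators on opposite sides is replaced by its integral combination on the bounding hyperplane.
\<close>

lemma rational_polyhedral_cone_Int_halfspace:
  fixes C :: "(real ^ 'n) set"
  assumes "rational_polyhedral_cone C"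
  shows "rational_polyhedral_cone (C \<inter> {x. 0 \<le> wt x a})"
proof -
  obtain B :: "(int ^ 'n) set" where B: "finite B" and C: "C = convex_cone hull (real_vec ` B)"
    using assms by (auto simp: rational_polyhedral_cone_def)
  define q where "q b = wt (real_vec b) a" for b :: "int ^ 'n"
  define comb :: "int ^ 'n \<Rightarrow> int ^ 'n \<Rightarrow> int ^ 'n"
    where "comb b c = (\<chi> i. idot b a * c $ i - idot c a * b $ i)" for b c
  have comb: "real_vec (comb b c) = q b *\<^sub>R real_vec c - q c *\<^sub>R real_vec b" for b c
    by (simp add: vec_eq_iff real_vec_def comb_def q_def wt_real_vec[unfolded real_vec_def])
  define Pos where "Pos = {b \<in> B. 0 < q b}"
  define Neg where "Neg = {b \<in> B. q b < 0}"
  define Zer where "Zer = {b \<in> B. q b = 0}"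
  have fin: "finite Pos" "finite Neg" "finite Zer" using B by (auto simp: Pos_def Neg_def Zer_def)
  have BU: "B = Zer \<union> (Pos \<union> Neg)" by (auto simp: Pos_def Neg_def Zer_def)
  have split: "(\<Sum>b\<in>B. f b) = (\<Sum>b\<in>Zer. f b) + (\<Sum>b\<in>Pos. f b) + (\<Sum>b\<in>Neg. f b)"
    for f :: "int ^ 'n \<Rightarrow> 'b::comm_monoid_add"
  proof -
    have "(\<Sum>b\<in>B. f b) = (\<Sum>b\<in>Zer. f b) + (\<Sum>b\<in>Pos \<union> Neg. f b)"
      unfolding BU by (rule sum.union_disjoint) (use fin in \<open>auto simp: Pos_def Neg_def Zer_def\<close>)
    also have "(\<Sum>b\<in>Pos \<union> Neg. f b) = (\<Sum>b\<in>Pos. f b) + (\<Sum>b\<in>Neg. f b)"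
      by (rule sum.union_disjoint) (use fin in \<open>auto simp: Pos_def Neg_def\<close>)
    finally show ?thesis by (simp add: add.assoc)
  qed
  define G where "G = Zer \<union> Pos \<union> (\<lambda>(b, c). comb b c) ` (Pos \<times> Neg)"
  let ?K = "convex_cone hull (real_vec ` G)"
  have K: "convex_cone ?K" by (rule convex_cone_convex_cone_hull)
  have gen: "real_vec g \<in> ?K" if "g \<in> G" for g using that by (intro hull_inc) auto
  have CC: "convex_cone C" unfolding C by (rule convex_cone_convex_cone_hull)
  have Bmem: "real_vec b \<in> C" if "b \<in> B" for b unfolding C using that by (intro hull_inc) auto
  have "?K \<subseteq> C \<inter> {x. 0 \<le> wt x a}"
  proof (rule hull_minimal)
    show "convex_cone (C \<inter> {x. 0 \<le> wt x a})"
      using CC by (auto simp: convex_cone_iff inner_add_left)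
    show "real_vec ` G \<subseteq> C \<inter> {x. 0 \<le> wt x a}"
    proof
      fix x assume "x \<in> real_vec ` G"
      then consider b where "b \<in> Zer \<union> Pos" "x = real_vec b"
        | b c where "b \<in> Pos" "c \<in> Neg" "x = real_vec (comb b c)"
        by (auto simp: G_def)
      then show "x \<in> C \<inter> {x. 0 \<le> wt x a}"
      proof cases
        case 1
        then show ?thesis using Bmem by (auto simp: Zer_def Pos_def q_def)
      next
        case 2
        have "x = q b *\<^sub>R real_vec c + (- q c) *\<^sub>R real_vec b" using 2 by (simp add: comb)
        moreover have "\<dots> \<in> C"
          using 2 Bmem by (intro convex_cone_add[OF CC] convex_cone_scaleR[OF CC])
            (auto simp: Pos_def Neg_def)
        moreover have "wt (real_vec (comb b c)) a = 0"
          by (simp add: comb inner_diff_left q_def mult.commute)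
        ultimately show ?thesis using 2 by auto
      qed
    qed
  qed
  moreover have "x \<in> ?K" if xC: "x \<in> C" and xa: "0 \<le> wt x a" for x
  proof -
    obtain l where l: "\<And>b. 0 \<le> l b" "x = (\<Sum>b\<in>B. l b *\<^sub>R real_vec b)"
      using convex_cone_hull_finite_image[OF B] xC unfolding C by blast
    define P where "P = (\<Sum>b\<in>Pos. l b * q b)"
    define N where "N = (\<Sum>c\<in>Neg. l c * (- q c))"
    define xp where "xp = (\<Sum>b\<in>Pos. l b *\<^sub>R real_vec b)"
    define xn where "xn = (\<Sum>b\<in>Neg. l b *\<^sub>R real_vec b)"
    define xz where "xz = (\<Sum>b\<in>Zer. l b *\<^sub>R real_vec b)"
    have x: "x = xz + xp + xn" unfolding l(2) split xz_def xp_def xn_def ..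
    have "wt x a = (\<Sum>b\<in>B. l b * q b)" by (simp add: l(2) inner_sum_left q_def)
    also have "\<dots> = P - N"
      unfolding split P_def N_def by (simp add: Zer_def sum_negf)
    finally have NP: "N \<le> P" using xa by simp
    have N0: "0 \<le> N" unfolding N_def using l(1) by (intro sum_nonneg mult_nonneg_nonneg) (auto simp: Neg_def)
    have xz: "xz \<in> ?K" unfolding xz_def
      by (rule convex_cone_sum[OF K fin(3)]) (use l(1) gen in \<open>simp_all add: G_def\<close>)
    have xp: "xp \<in> ?K" unfolding xp_def
      by (rule convex_cone_sum[OF K fin(1)]) (use l(1) gen in \<open>simp_all add: G_def\<close>)
    show ?thesis
    proof (cases "N = 0")
      case True
      then have "\<forall>c\<in>Neg. l c * (- q c) = 0"
        unfolding N_def using l(1) fin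
        by (subst (asm) sum_nonneg_eq_0_iff) (auto simp: Neg_def mult_nonneg_nonpos)
      then have "xn = 0" unfolding xn_def by (intro sum.neutral) (auto simp: Neg_def)
      then show ?thesis using x xz xp by (simp add: convex_cone_add[OF K])
    next
      case False
      then have P0: "P > 0" using N0 NP by simp
      (* the combinations of opposite generators absorb xn together with the fraction N / P of xp *)
      have "(\<Sum>p\<in>Pos \<times> Neg. (l (fst p) * l (snd p)) *\<^sub>R real_vec (comb (fst p) (snd p)))
          = (\<Sum>b\<in>Pos. \<Sum>c\<in>Neg. (l b * l c) *\<^sub>R real_vec (comb b c))"
        by (simp add: sum.cartesian_product case_prod_unfold)
      also have "\<dots> = (\<Sum>b\<in>Pos. \<Sum>c\<in>Neg. (l b * q b) *\<^sub>R (l c *\<^sub>R real_vec c)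
            + (l c * (- q c)) *\<^sub>R (l b *\<^sub>R real_vec b))"
        by (intro sum.cong refl) (simp add: comb algebra_simps)
      also have "\<dots> = P *\<^sub>R xn + N *\<^sub>R xp"
      proof -
        have "(\<Sum>b\<in>Pos. \<Sum>c\<in>Neg. (l b * q b) *\<^sub>R (l c *\<^sub>R real_vec c))
            = (\<Sum>b\<in>Pos. (l b * q b) *\<^sub>R xn)"
          by (simp only: xn_def scaleR_sum_right)
        also have "\<dots> = P *\<^sub>R xn" by (simp only: P_def scaleR_sum_left)
        finally have "(\<Sum>b\<in>Pos. \<Sum>c\<in>Neg. (l b * q b) *\<^sub>R (l c *\<^sub>R real_vec c)) = P *\<^sub>R xn" .
        moreover have "(\<Sum>b\<in>Pos. \<Sum>c\<in>Neg. (l c * (- q c)) *\<^sub>R (l b *\<^sub>R real_vec b)) = N *\<^sub>R xp"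
          unfolding N_def xp_def scaleR_sum_right scaleR_sum_left ..
        ultimately show ?thesis by (simp only: sum.distrib)
      qed
      finally have sum: "(\<Sum>p\<in>Pos \<times> Neg. (l (fst p) * l (snd p)) *\<^sub>R real_vec (comb (fst p) (snd p)))
          = P *\<^sub>R xn + N *\<^sub>R xp" .
      have "P *\<^sub>R xn + N *\<^sub>R xp \<in> ?K"
        unfolding sum[symmetric]
      proof (rule convex_cone_sum[OF K])
        fix p assume "p \<in> Pos \<times> Neg"
        then have "comb (fst p) (snd p) \<in> G" unfolding G_def by (intro UnI2 image_eqI[of _ _ p]) auto
        then show "real_vec (comb (fst p) (snd p)) \<in> ?K" by (rule gen)
      qed (use fin l(1) in auto)
      then have "(1 / P) *\<^sub>R (P *\<^sub>R xn + N *\<^sub>R xp) \<in> ?K"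
        using P0 by (intro convex_cone_scaleR[OF K]) auto
      moreover have "(1 - N / P) *\<^sub>R xp \<in> ?K"
        using P0 NP xp by (intro convex_cone_scaleR[OF K]) auto
      ultimately have "xz + ((1 / P) *\<^sub>R (P *\<^sub>R xn + N *\<^sub>R xp) + (1 - N / P) *\<^sub>R xp) \<in> ?K"
        using xz by (intro convex_cone_add[OF K])
      also have "xz + ((1 / P) *\<^sub>R (P *\<^sub>R xn + N *\<^sub>R xp) + (1 - N / P) *\<^sub>R xp) = x"
        using P0 by (simp add: x algebra_simps)
      finally show ?thesis .
    qed
  qed
  ultimately have "C \<inter> {x. 0 \<le> wt x a} = ?K" by auto
  moreover have "finite G" using fin by (simp add: G_def)
  ultimately show ?thesis unfolding rational_polyhedral_cone_def by blast
qed

lemma rational_polyhedral_cone_Int_halfspaces: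
  assumes "rational_polyhedral_cone C" "finite H"
  shows "rational_polyhedral_cone (C \<inter> {x. \<forall>a\<in>H. 0 \<le> wt x a})"
  using assms(2)
proof (induction H)
  case empty
  then show ?case using assms(1) by simp
next
  case (insert a H)
  have "C \<inter> {x. \<forall>a\<in>insert a H. 0 \<le> wt x a} = (C \<inter> {x. \<forall>a\<in>H. 0 \<le> wt x a}) \<inter> {x. 0 \<le> wt x a}"
    by auto
  then show ?case using rational_polyhedral_cone_Int_halfspace[OF insert.IH] by simp
qed

lemma rational_polyhedral_cone_Union:
  fixes \<D> :: "(real ^ 'n) set set"
  assumes "finite \<D>" "\<D> \<noteq> {}" and rat: "\<And>D. D \<in> \<D> \<Longrightarrow> rational_polyhedral_cone D"
    and conv: "convex (\<Union>\<D>)"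
  shows "rational_polyhedral_cone (\<Union>\<D>)"
proof -
  have "\<forall>D\<in>\<D>. \<exists>B :: (int ^ 'n) set. finite B \<and> D = convex_cone hull (real_vec ` B)"
    using rat by (simp add: rational_polyhedral_cone_def)
  then obtain B :: "(real ^ 'n) set \<Rightarrow> (int ^ 'n) set" where
    B: "\<And>D. D \<in> \<D> \<Longrightarrow> finite (B D)" "\<And>D. D \<in> \<D> \<Longrightarrow> D = convex_cone hull (real_vec ` B D)"
    by metis
  have cc: "convex_cone D" if "D \<in> \<D>" for D
    using rat[OF that] by (rule rational_polyhedral_cone_convex_cone)
  have "convex_cone hull (real_vec ` (\<Union>D\<in>\<D>. B D)) = \<Union>\<D>"
  proof
    show "convex_cone hull (real_vec ` (\<Union>D\<in>\<D>. B D)) \<subseteq> \<Union>\<D>"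
    proof (rule hull_minimal)
      show "real_vec ` (\<Union>D\<in>\<D>. B D) \<subseteq> \<Union>\<D>"
      proof
        fix x assume "x \<in> real_vec ` (\<Union>D\<in>\<D>. B D)"
        then obtain D where D: "D \<in> \<D>" "x \<in> real_vec ` B D" by auto
        then have "x \<in> convex_cone hull (real_vec ` B D)" by (simp add: hull_inc)
        then show "x \<in> \<Union>\<D>" using B(2)[OF D(1)] D(1) by blast
      qed
      show "convex_cone (\<Union>\<D>)"
        unfolding convex_cone_def
      proof (intro conjI conv)
        show "\<Union>\<D> \<noteq> {}" using assms(2) cc convex_cone_nonempty by fastforce
        show "conic (\<Union>\<D>)" using cc by (fastforce simp: conic_def convex_cone_def)
      qed
    qed
    show "\<Union>\<D> \<subseteq> convex_cone hull (real_vec ` (\<Union>D\<in>\<D>. B D))"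
    proof
      fix x assume "x \<in> \<Union>\<D>"
      then obtain D where D: "D \<in> \<D>" "x \<in> D" by auto
      then have "x \<in> convex_cone hull (real_vec ` B D)" using B(2) by blast
      moreover have "convex_cone hull (real_vec ` B D) \<subseteq> convex_cone hull (real_vec ` (\<Union>D\<in>\<D>. B D))"
        using D(1) by (intro hull_mono) auto
      ultimately show "x \<in> convex_cone hull (real_vec ` (\<Union>D\<in>\<D>. B D))" by blast
    qed
  qed
  moreover have "finite (\<Union>D\<in>\<D>. B D)" using assms(1) B(1) by auto
  ultimately show ?thesis unfolding rational_polyhedral_cone_def by metis
qed

text \<open>
  A nonzero point of a face lies inside the segment from \<open>0\<close> to any larger multiple of it.
\<close>

lemma face_of_convex_cone:
  fixes F C :: "'a::real_vector set"
  assumes F: "F face_of C" "F \<noteq> {}" and C: "convex_cone C"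
  shows "convex_cone F" "\<And>u v. u \<in> C \<Longrightarrow> v \<in> C \<Longrightarrow> u + v \<in> F \<Longrightarrow> u \<in> F"
proof -
  have FC: "F \<subseteq> C" and Fconv: "convex F"
    and face: "\<And>a b x. a \<in> C \<Longrightarrow> b \<in> C \<Longrightarrow> x \<in> F \<Longrightarrow> x \<in> open_segment a b \<Longrightarrow> a \<in> F \<and> b \<in> F"
    using F(1) unfolding face_of_def by blast+
  have C0: "0 \<in> C" using C by (rule convex_cone_contains_0)
  have multiple: "0 \<in> F \<and> t *\<^sub>R x \<in> F" if "x \<in> F" "x \<noteq> 0" "t > 1" for x t
  proof (rule face)
    show "t *\<^sub>R x \<in> C" using that FC by (intro convex_cone_scaleR[OF C]) auto
    have "x = (1 - 1 / t) *\<^sub>R 0 + (1 / t) *\<^sub>R (t *\<^sub>R x)" using that by simp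
    then show "x \<in> open_segment 0 (t *\<^sub>R x)"
      unfolding in_segment using that by (intro conjI exI[of _ "1 / t"]) auto
  qed (use that C0 in auto)
  have zero: "0 \<in> F"
    using F(2) multiple[of _ 2] by fastforce
  have scale: "t *\<^sub>R x \<in> F" if "x \<in> F" "0 \<le> t" for x t
  proof (cases "t \<le> 1")
    case True
    then show ?thesis using convexD[OF Fconv zero that(1), of "1 - t" t] that by simp
  next
    case False
    then show ?thesis using multiple[of x t] that zero by (cases "x = 0") auto
  qed
  have add: "x + y \<in> F" if "x \<in> F" "y \<in> F" for x y
  proof -
    have "(1 / 2) *\<^sub>R x + (1 / 2) *\<^sub>R y \<in> F" using convexD[OF Fconv that, of "1/2" "1/2"] by simp
    from scale[OF this, of 2] show ?thesis by (simp add: scaleR_add_right)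
  qed
  show "convex_cone F" unfolding convex_cone_iff using zero scale add by blast
  fix u v assume u: "u \<in> C" and v: "v \<in> C" and uv: "u + v \<in> F"
  show "u \<in> F"
  proof (cases "u = v")
    case True
    then have "u = (1 / 2) *\<^sub>R (u + v)" by (simp add: scaleR_2[symmetric])
    then show ?thesis using scale[OF uv, of "1/2"] by simp
  next
    case False
    have "2 *\<^sub>R u \<in> F \<and> 2 *\<^sub>R v \<in> F"
    proof (rule face[OF _ _ uv])
      show "2 *\<^sub>R u \<in> C" "2 *\<^sub>R v \<in> C" using u v by (auto intro: convex_cone_scaleR[OF C])
      have "u + v = (1 - 1 / 2) *\<^sub>R (2 *\<^sub>R u) + (1 / 2) *\<^sub>R (2 *\<^sub>R v)" by simp
      then show "u + v \<in> open_segment (2 *\<^sub>R u) (2 *\<^sub>R v)"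
        unfolding in_segment using False by (intro conjI exI[of _ "1 / 2"]) auto
    qed
    then show ?thesis using scale[of "2 *\<^sub>R u" "1 / 2"] by simp
  qed
qed

text \<open>
  Every generator that occurs in a representation of a point of the face lies in the face.
\<close>

lemma rational_polyhedral_cone_face:
  fixes C :: "(real ^ 'n) set"
  assumes C: "rational_polyhedral_cone C" and F: "F face_of C" "F \<noteq> {}"
  shows "rational_polyhedral_cone F"
proof -
  obtain B :: "(int ^ 'n) set" where B: "finite B" and CB: "C = convex_cone hull (real_vec ` B)"
    using C by (auto simp: rational_polyhedral_cone_def)
  have cc: "convex_cone C" using C by (rule rational_polyhedral_cone_convex_cone)
  note Fc = face_of_convex_cone[OF F cc]
  have Bmem: "real_vec b \<in> C" if "b \<in> B" for b unfolding CB using that by (intro hull_inc) auto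
  define G where "G = {b \<in> B. real_vec b \<in> F}"
  let ?K = "convex_cone hull (real_vec ` G)"
  have "?K \<subseteq> F" by (rule hull_minimal) (use Fc(1) in \<open>auto simp: G_def\<close>)
  moreover have "x \<in> ?K" if x: "x \<in> F" for x
  proof -
    have "x \<in> C" using x F(1) face_of_imp_subset by blast
    then obtain l where l: "\<And>b. 0 \<le> l b" "x = (\<Sum>b\<in>B. l b *\<^sub>R real_vec b)"
      using convex_cone_hull_finite_image[OF B] unfolding CB by blast
    have "b \<in> G" if b: "b \<in> B" "l b \<noteq> 0" for b
    proof -
      have pos: "l b > 0" using l(1)[of b] b(2) by simp
      have "x = l b *\<^sub>R real_vec b + (\<Sum>b\<in>B - {b}. l b *\<^sub>R real_vec b)"
        unfolding l(2) using B b(1) by (rule sum.remove)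
      moreover have "(\<Sum>b\<in>B - {b}. l b *\<^sub>R real_vec b) \<in> C"
        using B l(1) Bmem by (intro convex_cone_sum[OF cc]) auto
      moreover have "l b *\<^sub>R real_vec b \<in> C" using Bmem b(1) l(1) by (intro convex_cone_scaleR[OF cc])
      ultimately have "l b *\<^sub>R real_vec b \<in> F" using Fc(2) x by metis
      then have "real_vec b \<in> F"
        using convex_cone_scaleR[OF Fc(1), of "1 / l b" "l b *\<^sub>R real_vec b"] pos by simp
      then show ?thesis using b(1) by (simp add: G_def)
    qed
    then show ?thesis
      unfolding l(2) using B l(1)
      by (intro convex_cone_sum convex_cone_convex_cone_hull) (auto intro: hull_inc)
  qed
  ultimately have "F = ?K" by auto
  moreover have "finite G" using B by (simp add: G_def)
  ultimately show ?thesis unfolding rational_polyhedral_cone_def by blast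
qed

lemma closure_finite_UN:
  "finite I \<Longrightarrow> closure (\<Union>i\<in>I. f i) = (\<Union>i\<in>I. closure (f i))"
  by (induction I rule: finite_induct) simp_all

lemma mem_closure_if_eventually:
  fixes a w :: "'a::real_normed_vector"
  assumes "\<forall>\<^sub>F t in at_right (0::real). a + t *\<^sub>R w \<in> X"
  shows "a \<in> closure X"
proof (rule Lim_in_closed_set)
  show "closed (closure X)" by simp
  show "\<forall>\<^sub>F t in at_right (0::real). a + t *\<^sub>R w \<in> closure X"
    using assms by (rule eventually_mono) (use closure_subset in blast)
  show "at_right (0::real) \<noteq> bot" by simp
  have "((\<lambda>t. a + t *\<^sub>R w) \<longlongrightarrow> a + 0 *\<^sub>R w) (at_right 0)" by (intro tendsto_intros)
  then show "((\<lambda>t. a + t *\<^sub>R w) \<longlongrightarrow> a) (at_right 0)" by simp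
qed

section \<open>The fan of a family of convex classes\<close>

text \<open>
  The map \<open>\<kappa>\<close> stands for the initial ideal. The premise of \<open>collapse\<close> holds if the points \<open>z + s d\<close> are in
  the closure of a class and \<open>v\<close> is in its relative interior.
\<close>

locale convex_classes =
  fixes \<sigma> :: "(real ^ 'n) set" and \<kappa> :: "real ^ 'n \<Rightarrow> 'c" and H :: "(int ^ 'n) set"
  assumes rational: "rational_polyhedral_cone \<sigma>"
    and pointed: "strongly_convex \<sigma>"
    and interior_ne: "interior \<sigma> \<noteq> {}"
    and finite_H: "finite H"
    and cells: "\<And>v w. \<forall>h\<in>H. sgn (wt v h) = sgn (wt w h) \<Longrightarrow> \<kappa> v = \<kappa> w"
    and classes_convex: "\<And>u u' t. u \<in> \<sigma> \<Longrightarrow> u' \<in> \<sigma> \<Longrightarrow> \<kappa> u = \<kappa> u' \<Longrightarrow> 0 < t \<Longrightarrow> t < 1 \<Longrightarrow>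
       \<kappa> ((1 - t) *\<^sub>R u + t *\<^sub>R u') = \<kappa> u"
    and perturb: "\<And>a b w. \<kappa> a = \<kappa> b \<Longrightarrow>
       \<forall>\<^sub>F \<epsilon> in at_right 0. \<kappa> (a + \<epsilon> *\<^sub>R w) = \<kappa> (b + \<epsilon> *\<^sub>R w)"
    and collapse: "\<And>z v d \<eta> k. z \<in> interior \<sigma> \<Longrightarrow> v \<in> \<sigma> \<Longrightarrow> 0 < \<eta> \<Longrightarrow>
       (\<And>s \<epsilon>. \<bar>s\<bar> \<le> \<eta> \<Longrightarrow> 0 < \<epsilon> \<Longrightarrow> \<kappa> (z + s *\<^sub>R d + \<epsilon> *\<^sub>R v) = k) \<Longrightarrow>
       \<forall>\<^sub>F s in at_right 0. \<kappa> (z + s *\<^sub>R d) = \<kappa> z"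
begin

definition cls :: "'c \<Rightarrow> (real ^ 'n) set" where "cls k = {v \<in> \<sigma>. \<kappa> v = k}"

lemma cone_\<sigma>: "convex_cone \<sigma>"
  by (rule rational_polyhedral_cone_convex_cone[OF rational])

lemma convex_\<sigma>: "convex \<sigma>"
  using cone_\<sigma> by (simp add: convex_cone_def)

lemma closed_\<sigma>: "closed \<sigma>"
  by (rule polyhedron_imp_closed[OF rational_polyhedral_cone_polyhedron[OF rational]])

lemma scale_\<kappa>: "0 < c \<Longrightarrow> \<kappa> (c *\<^sub>R v) = \<kappa> v"
  by (rule cells) (simp add: sgn_mult)

lemma scale_cls: "v \<in> cls k \<Longrightarrow> 0 < c \<Longrightarrow> c *\<^sub>R v \<in> cls k"
  using convex_cone_scaleR[OF cone_\<sigma>, of c v] by (simp add: cls_def scale_\<kappa>)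

lemma convex_cls: "convex (cls k)"
  unfolding convex_alt
proof (intro ballI allI impI)
  fix x y and t :: real assume x: "x \<in> cls k" and y: "y \<in> cls k" and t: "0 \<le> t \<and> t \<le> 1"
  have "(1 - t) *\<^sub>R x + t *\<^sub>R y \<in> \<sigma>"
    using convexD[OF convex_\<sigma>, of x y "1 - t" t] x y t by (simp add: cls_def)
  moreover have "\<kappa> ((1 - t) *\<^sub>R x + t *\<^sub>R y) = k"
  proof -
    consider "t = 0" | "t = 1" | "0 < t" "t < 1" using t by linarith
    then show ?thesis
      by cases (use x y classes_convex[of x y t] in \<open>auto simp: cls_def\<close>)
  qed
  ultimately show "(1 - t) *\<^sub>R x + t *\<^sub>R y \<in> cls k" by (simp add: cls_def)
qed

lemma closure_cls_subset: "closure (cls k) \<subseteq> \<sigma>"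
  by (rule closure_minimal[OF _ closed_\<sigma>]) (auto simp: cls_def)

lemma interior_add:
  assumes "x \<in> \<sigma>" "v \<in> interior \<sigma>" "0 < c"
  shows "x + c *\<^sub>R v \<in> interior \<sigma>"
proof -
  have sub: "(\<lambda>y. x + c *\<^sub>R y) ` interior \<sigma> \<subseteq> \<sigma>"
    using assms(1,3) interior_subset[of \<sigma>]
    by (auto intro!: convex_cone_add[OF cone_\<sigma>] convex_cone_scaleR[OF cone_\<sigma>])
  have "open ((+) x ` ((*\<^sub>R) c ` interior \<sigma>))"
    using assms(3) by (intro open_translation open_scaling) auto
  then have "open ((\<lambda>y. x + c *\<^sub>R y) ` interior \<sigma>)" by (simp add: image_image)
  with sub have "(\<lambda>y. x + c *\<^sub>R y) ` interior \<sigma> \<subseteq> interior \<sigma>" by (rule interior_maximal)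
  then show ?thesis using assms(2) by blast
qed

lemma \<sigma>_add: "x \<in> \<sigma> \<Longrightarrow> v \<in> \<sigma> \<Longrightarrow> 0 \<le> c \<Longrightarrow> x + c *\<^sub>R v \<in> \<sigma>"
  by (intro convex_cone_add[OF cone_\<sigma>] convex_cone_scaleR[OF cone_\<sigma>])

definition sign_vector :: "real ^ 'n \<Rightarrow> int ^ 'n \<Rightarrow> real" where
  "sign_vector v = (\<lambda>h\<in>H. sgn (wt v h))"

lemma \<kappa>_sign_vector: "sign_vector v = sign_vector w \<Longrightarrow> \<kappa> v = \<kappa> w"
  by (rule cells) (metis sign_vector_def restrict_apply')

lemma finite_sign_vectors: "finite (range sign_vector)"
proof (rule finite_subset)
  show "range sign_vector \<subseteq> (\<Pi>\<^sub>E h\<in>H. {-1, 0, 1})"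
    by (auto simp: sign_vector_def sgn_real_def split: if_splits)
  show "finite (\<Pi>\<^sub>E h\<in>H. {-1, 0, 1 :: real})" using finite_H by (intro finite_PiE) auto
qed

lemma finite_classes: "finite (\<kappa> ` A)"
proof (rule finite_subset)
  show "\<kappa> ` A \<subseteq> (\<lambda>s. \<kappa> (SOME v. sign_vector v = s)) ` range sign_vector"
  proof
    fix k assume "k \<in> \<kappa> ` A"
    then obtain v where v: "k = \<kappa> v" by auto
    have "sign_vector (SOME w. sign_vector w = sign_vector v) = sign_vector v" by (rule someI) simp
    then have "k = \<kappa> (SOME w. sign_vector w = sign_vector v)" using \<kappa>_sign_vector v by metis
    then show "k \<in> (\<lambda>s. \<kappa> (SOME v. sign_vector v = s)) ` range sign_vector" by blast
  qed
  show "finite ((\<lambda>s. \<kappa> (SOME v. sign_vector v = s)) ` range sign_vector)"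
    using finite_sign_vectors by simp
qed

text \<open>
  The closure is cut out by the weak versions of the sign conditions: moving a point that satisfies
  these a little towards \<open>v0\<close> makes the signs correct.
\<close>

lemma rational_closure_sign_cell:
  assumes v0: "v0 \<in> \<sigma>"
  shows "rational_polyhedral_cone (closure {v \<in> \<sigma>. sign_vector v = sign_vector v0})"
proof -
  define H' where "H' = {h \<in> H. 0 \<le> wt v0 h} \<union> uminus ` {h \<in> H. wt v0 h \<le> 0}"
  have wtm: "wt v (- h) = - wt v h" for v :: "real ^ 'n" and h
    using real_vec_minus[of 0 h] by (simp add: real_vec_zero)
  define X where "X = \<sigma> \<inter> {v. \<forall>a\<in>H'. 0 \<le> wt v a}"
  have X: "v \<in> X \<longleftrightarrow> v \<in> \<sigma> \<and> (\<forall>h\<in>H. (0 \<le> wt v0 h \<longrightarrow> 0 \<le> wt v h) \<and> (wt v0 h \<le> 0 \<longrightarrow> wt v h \<le> 0))" for v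
    by (auto simp: X_def H'_def ball_Un wtm)
  have rat: "rational_polyhedral_cone X"
    unfolding X_def using finite_H
    by (intro rational_polyhedral_cone_Int_halfspaces[OF rational]) (auto simp: H'_def)
  have "closure {v \<in> \<sigma>. sign_vector v = sign_vector v0} = X"
  proof
    show "closure {v \<in> \<sigma>. sign_vector v = sign_vector v0} \<subseteq> X"
    proof (rule closure_minimal)
      show "closed X" by (rule polyhedron_imp_closed[OF rational_polyhedral_cone_polyhedron[OF rat]])
      show "{v \<in> \<sigma>. sign_vector v = sign_vector v0} \<subseteq> X"
      proof
        fix v assume v: "v \<in> {v \<in> \<sigma>. sign_vector v = sign_vector v0}"
        have "sgn (wt v h) = sgn (wt v0 h)" if "h \<in> H" for h
          using v that by (metis (mono_tags, lifting) mem_Collect_eq restrict_apply' sign_vector_def)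
        then have "(0 \<le> wt v0 h \<longrightarrow> 0 \<le> wt v h) \<and> (wt v0 h \<le> 0 \<longrightarrow> wt v h \<le> 0)" if "h \<in> H" for h
          using that by (metis linorder_not_less sgn_greater sgn_less)
        then show "v \<in> X" using v unfolding X by simp
      qed
    qed
    show "X \<subseteq> closure {v \<in> \<sigma>. sign_vector v = sign_vector v0}"
    proof
      fix v assume v: "v \<in> X"
      have "\<forall>\<^sub>F t in at_right 0. v + t *\<^sub>R v0 \<in> {v \<in> \<sigma>. sign_vector v = sign_vector v0}"
      proof (rule eventually_mono)
        show "\<forall>\<^sub>F t::real in at_right 0. 0 < t" by (simp add: eventually_at_right_less)
        fix t :: real assume t: "0 < t"
        have "sgn (wt (v + t *\<^sub>R v0) h) = sgn (wt v0 h)" if h: "h \<in> H" for h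
        proof -
          consider "0 < wt v0 h" | "wt v0 h < 0" | "wt v0 h = 0" by linarith
          then show ?thesis
          proof cases
            case 1
            then have "0 < wt v h + t * wt v0 h" using v h t unfolding X by (intro add_nonneg_pos) auto
            then show ?thesis using 1 by (simp add: inner_add_left)
          next
            case 2
            then have "t * wt v0 h < 0" using t by (simp add: mult_pos_neg)
            moreover have "wt v h \<le> 0" using v h 2 unfolding X by auto
            ultimately have "wt v h + t * wt v0 h < 0" by linarith
            then show ?thesis using 2 by (simp add: inner_add_left)
          next
            case 3
            then have "wt v h = 0" using v h unfolding X by (auto intro: antisym)
            then show ?thesis using 3 by (simp add: inner_add_left)
          qed
        qed
        then have "sign_vector (v + t *\<^sub>R v0) = sign_vector v0"
          unfolding sign_vector_def by (intro restrict_ext) auto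
        then show "v + t *\<^sub>R v0 \<in> {v \<in> \<sigma>. sign_vector v = sign_vector v0}"
          using v v0 t unfolding X by (auto intro: \<sigma>_add)
      qed
      then show "v \<in> closure {v \<in> \<sigma>. sign_vector v = sign_vector v0}" by (rule mem_closure_if_eventually)
    qed
  qed
  then show ?thesis using rat by simp
qed

lemma rational_closure_cls:
  assumes u: "u \<in> \<sigma>"
  shows "rational_polyhedral_cone (closure (cls (\<kappa> u)))"
proof -
  define cell where "cell s = {v \<in> \<sigma>. sign_vector v = s}" for s
  define \<D> where "\<D> = (\<lambda>s. closure (cell s)) ` sign_vector ` cls (\<kappa> u)"
  have fin: "finite (sign_vector ` cls (\<kappa> u))" using finite_sign_vectors by (rule finite_subset[rotated]) auto
  have "cls (\<kappa> u) = (\<Union>s\<in>sign_vector ` cls (\<kappa> u). cell s)"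
  proof
    show "cls (\<kappa> u) \<subseteq> (\<Union>s\<in>sign_vector ` cls (\<kappa> u). cell s)" by (auto simp: cell_def cls_def)
    show "(\<Union>s\<in>sign_vector ` cls (\<kappa> u). cell s) \<subseteq> cls (\<kappa> u)"
    proof
      fix v assume "v \<in> (\<Union>s\<in>sign_vector ` cls (\<kappa> u). cell s)"
      then obtain w where "w \<in> cls (\<kappa> u)" "v \<in> \<sigma>" "sign_vector v = sign_vector w"
        by (auto simp: cell_def)
      then show "v \<in> cls (\<kappa> u)" using \<kappa>_sign_vector[of v w] by (simp add: cls_def)
    qed
  qed
  then have "closure (cls (\<kappa> u)) = closure (\<Union>s\<in>sign_vector ` cls (\<kappa> u). cell s)" by simp
  also have "\<dots> = \<Union>\<D>" unfolding \<D>_def using closure_finite_UN[OF fin, of cell] by simp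
  finally have eq: "closure (cls (\<kappa> u)) = \<Union>\<D>" .
  have "rational_polyhedral_cone (\<Union>\<D>)"
  proof (rule rational_polyhedral_cone_Union)
    show "finite \<D>" using fin by (simp add: \<D>_def)
    show "\<D> \<noteq> {}" using u by (auto simp: \<D>_def cls_def)
    show "convex (\<Union>\<D>)" unfolding eq[symmetric] by (intro convex_closure convex_cls)
    fix D assume "D \<in> \<D>"
    then obtain v0 where "v0 \<in> cls (\<kappa> u)" "D = closure (cell (sign_vector v0))" by (auto simp: \<D>_def)
    then show "rational_polyhedral_cone D"
      using rational_closure_sign_cell[of v0] by (simp add: cell_def cls_def)
  qed
  then show ?thesis by (simp add: eq)
qed

text \<open>
  Classes are stable under positive scaling, so \<open>z + \<epsilon>v\<close> may be replaced by a point of the open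
  segment from \<open>v\<close> to \<open>z\<close>.
\<close>

lemma translate_closure_cls:
  assumes z: "z \<in> closure (cls k)" and v: "v \<in> rel_interior (cls k)" and \<epsilon>: "0 < \<epsilon>"
  shows "z + \<epsilon> *\<^sub>R v \<in> cls k"
proof -
  have vc: "v \<in> cls k" using v rel_interior_subset by blast
  define y where "y = (1 / (1 + \<epsilon>)) *\<^sub>R z + (\<epsilon> / (1 + \<epsilon>)) *\<^sub>R v"
  have e: "1 - 1 / (1 + \<epsilon>) = \<epsilon> / (1 + \<epsilon>)" using \<epsilon> by (simp add: field_simps)
  have "y \<in> cls k"
  proof (cases "z = v")
    case True
    have "1 / (1 + \<epsilon>) + \<epsilon> / (1 + \<epsilon>) = 1" using \<epsilon> by (simp add: field_simps)
    then have "y = v" unfolding y_def True scaleR_add_left[symmetric] by simp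
    then show ?thesis using vc by simp
  next
    case False
    have "y = (1 - 1 / (1 + \<epsilon>)) *\<^sub>R v + (1 / (1 + \<epsilon>)) *\<^sub>R z" unfolding e by (simp add: y_def)
    then have "y \<in> open_segment v z"
      unfolding in_segment using False \<epsilon> by (intro conjI exI[of _ "1 / (1 + \<epsilon>)"]) auto
    then have "y \<in> rel_interior (cls k)"
      using rel_interior_closure_convex_segment[OF convex_cls v z] by blast
    then show ?thesis using rel_interior_subset by blast
  qed
  then have "(1 + \<epsilon>) *\<^sub>R y \<in> cls k" using \<epsilon> by (intro scale_cls) auto
  moreover have "(1 + \<epsilon>) *\<^sub>R y = z + \<epsilon> *\<^sub>R v" using \<epsilon> by (simp add: y_def scaleR_add_right)
  ultimately show ?thesis by simp
qed

text \<open>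
  Collapse makes \<open>\<kappa>\<close> locally constant along the segment.
\<close>

lemma constant_on_open_segment:
  assumes x: "x \<in> closure (cls k)" "x \<in> interior \<sigma>" and y: "y \<in> closure (cls k)" "y \<in> interior \<sigma>"
    and p: "p \<in> open_segment x y" and q: "q \<in> open_segment x y"
  shows "\<kappa> p = \<kappa> q"
proof -
  have "cls k \<noteq> {}" using x by auto
  then obtain v where v: "v \<in> rel_interior (cls k)"
    using rel_interior_eq_empty[OF convex_cls] by blast
  have v\<sigma>: "v \<in> \<sigma>" using v rel_interior_subset by (force simp: cls_def)
  define \<phi> where "\<phi> r = x + r *\<^sub>R (y - x)" for r :: real
  have \<phi>c: "\<phi> r \<in> closure (cls k)" if "0 \<le> r" "r \<le> 1" for r
    using convexD[OF convex_closure[OF convex_cls] x(1) y(1), of "1 - r" r] that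
    by (simp add: \<phi>_def algebra_simps)
  have \<phi>i: "\<phi> r \<in> interior \<sigma>" if "0 \<le> r" "r \<le> 1" for r
    using convexD[OF convex_interior[OF convex_\<sigma>] x(2) y(2), of "1 - r" r] that
    by (simp add: \<phi>_def algebra_simps)
  have near: "\<forall>\<^sub>F s in at_right 0. \<kappa> (\<phi> (r + s * a)) = \<kappa> (\<phi> r)"
    if r: "0 < r" "r < 1" and a: "\<bar>a\<bar> = 1" for r a
  proof -
    have "\<forall>\<^sub>F s in at_right 0. \<kappa> (\<phi> r + s *\<^sub>R (a *\<^sub>R (y - x))) = \<kappa> (\<phi> r)"
    proof (rule collapse[OF _ v\<sigma>])
      show "\<phi> r \<in> interior \<sigma>" using r by (intro \<phi>i) auto
      show "0 < min r (1 - r)" using r by simp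
      fix s \<epsilon> :: real assume s: "\<bar>s\<bar> \<le> min r (1 - r)" and \<epsilon>: "0 < \<epsilon>"
      have sa: "\<bar>s * a\<bar> \<le> min r (1 - r)" using s a by (simp add: abs_mult)
      have "\<phi> (r + s * a) \<in> closure (cls k)" using sa r by (intro \<phi>c) (auto simp: abs_le_iff)
      then have "\<phi> (r + s * a) + \<epsilon> *\<^sub>R v \<in> cls k" by (rule translate_closure_cls[OF _ v \<epsilon>])
      moreover have "\<phi> (r + s * a) = \<phi> r + s *\<^sub>R (a *\<^sub>R (y - x))"
        by (simp add: \<phi>_def algebra_simps)
      ultimately show "\<kappa> (\<phi> r + s *\<^sub>R (a *\<^sub>R (y - x)) + \<epsilon> *\<^sub>R v) = k" by (simp add: cls_def)
    qed
    moreover have "\<phi> (r + s * a) = \<phi> r + s *\<^sub>R (a *\<^sub>R (y - x))" for s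
      by (simp add: \<phi>_def algebra_simps)
    ultimately show ?thesis by simp
  qed
  have "(\<kappa> \<circ> \<phi>) constant_on {0<..<1::real}"
  proof (rule locally_constant_imp_constant)
    show "connected {0<..<1::real}" by simp
    fix r :: real assume r: "r \<in> {0<..<1}"
    have "\<forall>\<^sub>F s in at_right 0. \<kappa> (\<phi> (r + s * 1)) = \<kappa> (\<phi> r) \<and> \<kappa> (\<phi> (r + s * (-1))) = \<kappa> (\<phi> r)"
      using near[of r 1] near[of r "-1"] r by (simp add: eventually_conj)
    then obtain e where e: "0 < e"
      "\<And>s. 0 < s \<Longrightarrow> s < e \<Longrightarrow> \<kappa> (\<phi> (r + s)) = \<kappa> (\<phi> r) \<and> \<kappa> (\<phi> (r - s)) = \<kappa> (\<phi> r)"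
      unfolding eventually_at_right_field by auto
    have "(\<kappa> \<circ> \<phi>) r' = (\<kappa> \<circ> \<phi>) r" if "r' \<in> {0<..<1} \<inter> ball r e" for r'
    proof -
      consider "r' = r" | "r < r'" | "r' < r" by linarith
      then show ?thesis
      proof cases
        case 2
        then show ?thesis using e(2)[of "r' - r"] that by (simp add: dist_real_def)
      next
        case 3
        then show ?thesis using e(2)[of "r - r'"] that by (simp add: dist_real_def)
      qed simp
    qed
    moreover have "r \<in> {0<..<1} \<inter> ball r e" using r e(1) by simp
    moreover have "openin (top_of_set {0<..<1}) ({0<..<1} \<inter> ball r e)"
      by (intro openin_open_Int open_ball)
    ultimately show "\<exists>T. openin (top_of_set {0<..<1}) T \<and> r \<in> T \<and> (\<forall>x\<in>T. (\<kappa> \<circ> \<phi>) x = (\<kappa> \<circ> \<phi>) r)"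
      by blast
  qed
  then obtain c where c: "\<And>r. 0 < r \<Longrightarrow> r < 1 \<Longrightarrow> \<kappa> (\<phi> r) = c" by (auto simp: constant_on_def)
  have "\<kappa> p = c" if p: "p \<in> open_segment x y" for p
  proof -
    obtain r where r: "0 < r" "r < 1" "p = (1 - r) *\<^sub>R x + r *\<^sub>R y"
      using p by (auto simp: in_segment)
    have p: "p = \<phi> r" by (simp add: r(3) \<phi>_def algebra_simps)
    show ?thesis unfolding p by (rule c[OF r(1,2)])
  qed
  then show ?thesis using p q by simp
qed

text \<open>
  The value of \<open>\<kappa>\<close> on the class that is entered when \<open>z\<close> is left in direction \<open>v\<close>. It exists because
  the signs that determine \<open>\<kappa>\<close> are constant for small \<open>\<epsilon>\<close>.
\<close>

definition germ :: "real ^ 'n \<Rightarrow> real ^ 'n \<Rightarrow> 'c" where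
  "germ z v = (SOME k. \<forall>\<^sub>F \<epsilon> in at_right 0. \<kappa> (z + \<epsilon> *\<^sub>R v) = k)"

definition germ_sign :: "real ^ 'n \<Rightarrow> real ^ 'n \<Rightarrow> int ^ 'n \<Rightarrow> real" where
  "germ_sign z v h = (if wt z h \<noteq> 0 then sgn (wt z h) else sgn (wt v h))"

lemma eventually_germ_sign:
  "\<forall>\<^sub>F \<epsilon> in at_right 0. \<forall>h\<in>H. sgn (wt (z + \<epsilon> *\<^sub>R v) h) = germ_sign z v h"
proof (rule eventually_ball_finite[OF finite_H], rule ballI)
  fix h
  show "\<forall>\<^sub>F \<epsilon> in at_right 0. sgn (wt (z + \<epsilon> *\<^sub>R v) h) = germ_sign z v h"
    using eventually_sgn_at_right[of "wt z h" "wt v h"] by (simp add: inner_add_left germ_sign_def)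
qed

lemma germ: "\<forall>\<^sub>F \<epsilon> in at_right 0. \<kappa> (z + \<epsilon> *\<^sub>R v) = germ z v"
proof -
  obtain \<epsilon>0 where \<epsilon>0: "\<forall>h\<in>H. sgn (wt (z + \<epsilon>0 *\<^sub>R v) h) = germ_sign z v h"
    by (rule eventually_at_rightE[OF eventually_germ_sign])
  have "\<forall>\<^sub>F \<epsilon> in at_right 0. \<kappa> (z + \<epsilon> *\<^sub>R v) = \<kappa> (z + \<epsilon>0 *\<^sub>R v)"
    using eventually_germ_sign by (rule eventually_mono) (rule cells, simp add: \<epsilon>0)
  then show ?thesis unfolding germ_def by (rule someI)
qed

lemma germ_eqI:
  assumes "\<forall>\<^sub>F \<epsilon> in at_right 0. \<kappa> (z + \<epsilon> *\<^sub>R v) = k"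
  shows "germ z v = k"
proof -
  have "\<forall>\<^sub>F \<epsilon>::real in at_right 0. germ z v = k"
    using germ[of z v] assms by eventually_elim simp
  then show ?thesis by simp
qed

lemma germ_closure_cls:
  assumes "z \<in> closure (cls k)" "v \<in> rel_interior (cls k)"
  shows "germ z v = k"
proof (rule germ_eqI, rule eventually_mono)
  show "\<forall>\<^sub>F t::real in at_right 0. 0 < t" by (simp add: eventually_at_right_less)
  show "\<kappa> (z + \<epsilon> *\<^sub>R v) = k" if "0 < \<epsilon>" for \<epsilon>
    using translate_closure_cls[OF assms that] by (simp add: cls_def)
qed

lemma germ_eq_if_sign:
  assumes "\<forall>h\<in>H. sgn (wt p h) = germ_sign z v h"
  shows "\<kappa> p = germ z v"
proof -
  obtain \<epsilon>0 where "(\<forall>h\<in>H. sgn (wt (z + \<epsilon>0 *\<^sub>R v) h) = germ_sign z v h) \<and> \<kappa> (z + \<epsilon>0 *\<^sub>R v) = germ z v"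
    using eventually_conj[OF eventually_germ_sign germ] by (rule eventually_at_rightE)
  then show ?thesis using assms cells[of p "z + \<epsilon>0 *\<^sub>R v"] by simp
qed

text \<open>
  If \<open>v'\<close> is so close to \<open>v\<close> that the nonzero signs of \<open>v\<close> are kept, all points of the half-open
  segment from \<open>v\<close> to \<open>v'\<close> define the same germ, and the threshold for \<open>\<epsilon>\<close> is uniform in \<open>s\<close>.
\<close>

lemma germ_towards:
  assumes near: "\<And>h. h \<in> H \<Longrightarrow> wt v h \<noteq> 0 \<Longrightarrow> 0 < wt v h * wt v' h"
  obtains e where "0 < e" "\<And>\<epsilon> s. 0 < \<epsilon> \<Longrightarrow> \<epsilon> < e \<Longrightarrow> 0 < s \<Longrightarrow> s \<le> 1 \<Longrightarrow>
    \<kappa> (z + \<epsilon> *\<^sub>R (v + s *\<^sub>R (v' - v))) = germ z v'"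
proof -
  have "\<forall>\<^sub>F \<epsilon> in at_right 0. \<forall>h\<in>H. wt z h \<noteq> 0 \<longrightarrow> \<epsilon> * (\<bar>wt v h\<bar> + \<bar>wt v' h\<bar>) < \<bar>wt z h\<bar>"
  proof (rule eventually_ball_finite[OF finite_H], rule ballI)
    fix h
    show "\<forall>\<^sub>F \<epsilon> in at_right 0. wt z h \<noteq> 0 \<longrightarrow> \<epsilon> * (\<bar>wt v h\<bar> + \<bar>wt v' h\<bar>) < \<bar>wt z h\<bar>"
    proof (cases "wt z h = 0")
      case False
      then have "0 < \<bar>wt z h\<bar> \<or> 0 = \<bar>wt z h\<bar> \<and> \<bar>wt v h\<bar> + \<bar>wt v' h\<bar> < 0" by simp
      from eventually_less_at_right[OF this] show ?thesis by (rule eventually_mono) simp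
    qed simp
  qed
  then obtain e where e: "0 < e" "\<And>\<epsilon> h. 0 < \<epsilon> \<Longrightarrow> \<epsilon> < e \<Longrightarrow> h \<in> H \<Longrightarrow> wt z h \<noteq> 0 \<Longrightarrow>
      \<epsilon> * (\<bar>wt v h\<bar> + \<bar>wt v' h\<bar>) < \<bar>wt z h\<bar>"
    unfolding eventually_at_right_field by auto
  show ?thesis
  proof (rule that[OF e(1)])
    fix \<epsilon> s :: real assume \<epsilon>: "0 < \<epsilon>" "\<epsilon> < e" and s: "0 < s" "s \<le> 1"
    show "\<kappa> (z + \<epsilon> *\<^sub>R (v + s *\<^sub>R (v' - v))) = germ z v'"
    proof (rule germ_eq_if_sign, rule ballI)
      fix h assume h: "h \<in> H"
      define a where "a = wt v h"
      define b where "b = wt v' h"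
      define m where "m = (1 - s) * a + s * b"
      have wt: "wt (z + \<epsilon> *\<^sub>R (v + s *\<^sub>R (v' - v))) h = wt z h + \<epsilon> * m"
        by (simp add: inner_add_left inner_diff_left m_def a_def b_def algebra_simps)
      show "sgn (wt (z + \<epsilon> *\<^sub>R (v + s *\<^sub>R (v' - v))) h) = germ_sign z v' h"
      proof (cases "wt z h = 0")
        case False
        have "\<bar>m\<bar> \<le> \<bar>(1 - s) * a\<bar> + \<bar>s * b\<bar>" unfolding m_def by (rule abs_triangle_ineq)
        also have "\<dots> = (1 - s) * \<bar>a\<bar> + s * \<bar>b\<bar>" using s by (simp add: abs_mult)
        also have "\<dots> \<le> \<bar>a\<bar> + \<bar>b\<bar>" using s by (intro add_mono mult_left_le_one_le) auto
        finally have "\<epsilon> * \<bar>m\<bar> \<le> \<epsilon> * (\<bar>a\<bar> + \<bar>b\<bar>)" using \<epsilon> by (intro mult_left_mono) auto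
        also have "\<dots> < \<bar>wt z h\<bar>" using e(2)[OF \<epsilon> h False] by (simp add: a_def b_def)
        finally have "\<bar>\<epsilon> * m\<bar> < \<bar>wt z h\<bar>" using \<epsilon> by (simp add: abs_mult)
        then have "sgn (wt z h + \<epsilon> * m) = sgn (wt z h)" by (auto simp: sgn_real_def)
        then show ?thesis using False by (simp add: wt germ_sign_def)
      next
        case True
        have "sgn m = sgn b"
        proof (cases "a = 0")
          case True
          then show ?thesis using s by (simp add: m_def sgn_mult)
        next
          case False
          then have ab: "0 < a * b" using near[OF h] by (simp add: a_def b_def)
          show ?thesis
          proof (cases "0 < b")
            case True
            then have "0 < a" using ab by (simp add: zero_less_mult_iff)
            then have "0 < m" unfolding m_def using s True by (intro add_nonneg_pos) auto
            then show ?thesis using True by simp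
          next
            case False
            then have "a < 0" "b < 0" using ab by (auto simp: zero_less_mult_iff)
            moreover have "(1 - s) * a \<le> 0" "s * b < 0"
              using s \<open>a < 0\<close> \<open>b < 0\<close> by (auto intro: mult_nonneg_nonpos mult_pos_neg)
            then have "m < 0" unfolding m_def by linarith
            ultimately show ?thesis by simp
          qed
        qed
        then show ?thesis using True \<epsilon> by (simp add: wt germ_sign_def b_def sgn_mult)
      qed
    qed
  qed
qed

text \<open>
  The midpoints between \<open>z \<plusminus> \<delta>d\<close> and \<open>z + 2\<epsilon>v\<close> lie in the closure of the class and in the interior of
  \<open>\<sigma>\<close>, so \<open>\<kappa>\<close> is constant on the segment between them. The length of this segment does not
  depend on \<open>\<epsilon>\<close>, and it survives when \<open>\<epsilon>\<close> tends to \<open>0\<close>.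
\<close>

lemma segment_through_germ:
  assumes z: "z \<in> \<sigma>" and v: "v \<in> interior \<sigma>" and d: "d \<noteq> 0" and \<delta>: "0 < \<delta>"
    and plus: "z + \<delta> *\<^sub>R d \<in> closure (cls k)" and minus: "z - \<delta> *\<^sub>R d \<in> closure (cls k)"
    and \<epsilon>: "0 < \<epsilon>" and mem: "z + (2 * \<epsilon>) *\<^sub>R v \<in> closure (cls k)" and a: "\<bar>a\<bar> = \<delta> / 4"
  shows "\<kappa> (z + a *\<^sub>R d + \<epsilon> *\<^sub>R v) = \<kappa> (z + \<epsilon> *\<^sub>R v)" "z + a *\<^sub>R d + \<epsilon> *\<^sub>R v \<in> interior \<sigma>"
proof -
  have conv: "convex (closure (cls k))" by (intro convex_closure convex_cls)
  define x where "x = z - (\<delta> / 2) *\<^sub>R d + \<epsilon> *\<^sub>R v"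
  define y where "y = z + (\<delta> / 2) *\<^sub>R d + \<epsilon> *\<^sub>R v"
  have x: "x = (1 / 2) *\<^sub>R (z - \<delta> *\<^sub>R d) + (1 / 2) *\<^sub>R (z + (2 * \<epsilon>) *\<^sub>R v)"
    by (simp add: x_def vec_eq_iff field_simps)
  have y: "y = (1 / 2) *\<^sub>R (z + \<delta> *\<^sub>R d) + (1 / 2) *\<^sub>R (z + (2 * \<epsilon>) *\<^sub>R v)"
    by (simp add: y_def vec_eq_iff field_simps)
  have xc: "x \<in> closure (cls k)" unfolding x by (rule convexD[OF conv minus mem]) auto
  have yc: "y \<in> closure (cls k)" unfolding y by (rule convexD[OF conv plus mem]) auto
  have half: "z + b *\<^sub>R d \<in> \<sigma>" if "\<bar>b\<bar> \<le> \<delta>" for b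
  proof -
    have "z - \<delta> *\<^sub>R d \<in> \<sigma>" "z + \<delta> *\<^sub>R d \<in> \<sigma>" using plus minus closure_cls_subset by auto
    then have "(1 / 2 - b / (2 * \<delta>)) *\<^sub>R (z - \<delta> *\<^sub>R d) + (1 / 2 + b / (2 * \<delta>)) *\<^sub>R (z + \<delta> *\<^sub>R d) \<in> \<sigma>"
      using that \<delta> by (intro convexD[OF convex_\<sigma>]) (auto simp: abs_le_iff field_simps)
    also have "(1 / 2 - b / (2 * \<delta>)) *\<^sub>R (z - \<delta> *\<^sub>R d) + (1 / 2 + b / (2 * \<delta>)) *\<^sub>R (z + \<delta> *\<^sub>R d) = z + b *\<^sub>R d"
    proof -
      have "(1 / 2 - b / (2 * \<delta>)) *\<^sub>R (z - \<delta> *\<^sub>R d) + (1 / 2 + b / (2 * \<delta>)) *\<^sub>R (z + \<delta> *\<^sub>R d)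
          = ((1 / 2 - b / (2 * \<delta>)) + (1 / 2 + b / (2 * \<delta>))) *\<^sub>R z
            + ((1 / 2 + b / (2 * \<delta>)) * \<delta> - (1 / 2 - b / (2 * \<delta>)) * \<delta>) *\<^sub>R d"
        by (simp only: scaleR_add_left scaleR_diff_left scaleR_add_right scaleR_diff_right scaleR_scaleR) simp
      also have "\<dots> = z + b *\<^sub>R d" using \<delta> by (simp add: field_simps)
      finally show ?thesis .
    qed
    finally show ?thesis .
  qed
  have xi: "x \<in> interior \<sigma>"
    using interior_add[OF half[of "- (\<delta> / 2)"] v \<epsilon>] \<delta> by (simp add: x_def)
  have yi: "y \<in> interior \<sigma>"
    using interior_add[OF half[of "\<delta> / 2"] v \<epsilon>] \<delta> by (simp add: y_def)
  have "y - x = \<delta> *\<^sub>R d" by (simp add: x_def y_def flip: scaleR_add_left)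
  then have xy: "x \<noteq> y" using \<delta> d by auto
  have seg: "z + b *\<^sub>R d + \<epsilon> *\<^sub>R v \<in> open_segment x y" if "\<bar>b\<bar> < \<delta> / 2" for b
  proof -
    have r: "0 < 1 / 2 + b / \<delta>" "1 / 2 + b / \<delta> < 1" using that \<delta> by (auto simp: abs_less_iff field_simps)
    have "(1 - (1 / 2 + b / \<delta>)) *\<^sub>R x + (1 / 2 + b / \<delta>) *\<^sub>R y = x + (1 / 2 + b / \<delta>) *\<^sub>R (y - x)"
      by (simp add: vec_eq_iff algebra_simps)
    also have "\<dots> = x + (\<delta> / 2 + b) *\<^sub>R d"
      unfolding \<open>y - x = \<delta> *\<^sub>R d\<close> using \<delta> by (simp add: field_simps)
    also have "\<dots> = z + b *\<^sub>R d + \<epsilon> *\<^sub>R v" by (simp add: x_def scaleR_add_left)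
    finally show ?thesis unfolding in_segment using xy r by metis
  qed
  have s0: "z + 0 *\<^sub>R d + \<epsilon> *\<^sub>R v \<in> open_segment x y" using \<delta> by (intro seg) auto
  have sa: "z + a *\<^sub>R d + \<epsilon> *\<^sub>R v \<in> open_segment x y" using \<delta> a by (intro seg) auto
  show "\<kappa> (z + a *\<^sub>R d + \<epsilon> *\<^sub>R v) = \<kappa> (z + \<epsilon> *\<^sub>R v)"
    using constant_on_open_segment[OF xc xi yc yi sa s0] by simp
  show "z + a *\<^sub>R d + \<epsilon> *\<^sub>R v \<in> interior \<sigma>"
    using interior_add[OF half[of a] v \<epsilon>] \<delta> a by simp
qed

definition line_in_germ :: "real ^ 'n \<Rightarrow> real ^ 'n \<Rightarrow> real ^ 'n \<Rightarrow> bool" where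
  "line_in_germ z d v \<longleftrightarrow> (\<exists>\<delta>>0. z + \<delta> *\<^sub>R d \<in> closure (cls (germ z v)) \<and>
      z - \<delta> *\<^sub>R d \<in> closure (cls (germ z v)))"

text \<open>
  The points \<open>z + \<epsilon>v\<close> lie in the germ at \<open>v\<close> and in the closure of the germ at \<open>v'\<close>. If the germ at
  \<open>v\<close> contains the segment, then by \<open>segment_through_germ\<close> the points \<open>z + \<epsilon>v + a d\<close> are equivalent to
  \<open>z + \<epsilon>v\<close>, and perturbing all of them in direction \<open>v' - v\<close> leads into the germ at \<open>v'\<close>. If the germ
  at \<open>v'\<close> does, the same points are equivalent to \<open>z + \<epsilon>v\<close>, hence in the germ at \<open>v\<close>. Then let \<open>\<epsilon>\<close>
  tend to \<open>0\<close>.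
\<close>

lemma line_in_germ_locally_constant:
  assumes z: "z \<in> \<sigma>" and d: "d \<noteq> 0" and v: "v \<in> interior \<sigma>" and v': "v' \<in> interior \<sigma>"
    and near: "\<And>h. h \<in> H \<Longrightarrow> wt v h \<noteq> 0 \<Longrightarrow> 0 < wt v h * wt v' h"
  shows "line_in_germ z d v \<longleftrightarrow> line_in_germ z d v'"
proof -
  obtain e where e: "0 < e" "\<And>\<epsilon> s. 0 < \<epsilon> \<Longrightarrow> \<epsilon> < e \<Longrightarrow> 0 < s \<Longrightarrow> s \<le> 1 \<Longrightarrow>
      \<kappa> (z + \<epsilon> *\<^sub>R (v + s *\<^sub>R (v' - v))) = germ z v'"
    using germ_towards[OF near] by blast
  obtain e' where e': "0 < e'" "\<And>\<epsilon>. 0 < \<epsilon> \<Longrightarrow> \<epsilon> < e' \<Longrightarrow> \<kappa> (z + \<epsilon> *\<^sub>R v) = germ z v"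
    using germ[of z v] unfolding eventually_at_right_field by auto
  have v\<sigma>: "v \<in> \<sigma>" and v'\<sigma>: "v' \<in> \<sigma>" using v v' interior_subset by auto
  have vs: "v + s *\<^sub>R (v' - v) \<in> \<sigma>" if "0 \<le> s" "s \<le> 1" for s
    using convexD[OF convex_\<sigma> v\<sigma> v'\<sigma>, of "1 - s" s] that by (simp add: algebra_simps)
  define E where "E = min e e' / 2"
  have E: "0 < E" using e(1) e'(1) by (simp add: E_def)
  have E_ev: "\<forall>\<^sub>F \<epsilon> in at_right 0. \<epsilon> \<in> {0<..<E}" by (rule eventually_at_right_real) (rule E)
  show ?thesis
  proof
    assume "line_in_germ z d v"
    then obtain \<delta> where \<delta>: "0 < \<delta>" "z + \<delta> *\<^sub>R d \<in> closure (cls (germ z v))"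
      "z - \<delta> *\<^sub>R d \<in> closure (cls (germ z v))" by (auto simp: line_in_germ_def)
    have main: "z + a *\<^sub>R d \<in> closure (cls (germ z v'))" if a: "\<bar>a\<bar> = \<delta> / 4" for a
    proof -
      have "\<forall>\<^sub>F \<epsilon> in at_right 0. z + a *\<^sub>R d + \<epsilon> *\<^sub>R v \<in> closure (cls (germ z v'))"
        using E_ev
      proof (rule eventually_mono)
        fix \<epsilon> assume "\<epsilon> \<in> {0<..<E}"
        then have \<epsilon>: "0 < \<epsilon>" "2 * \<epsilon> < e'" "\<epsilon> < e" by (auto simp: E_def)
        have "z + (2 * \<epsilon>) *\<^sub>R v \<in> cls (germ z v)"
          using e'(2)[of "2 * \<epsilon>"] \<epsilon> \<sigma>_add[OF z v\<sigma>, of "2 * \<epsilon>"] by (simp add: cls_def)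
        then have "z + (2 * \<epsilon>) *\<^sub>R v \<in> closure (cls (germ z v))" using closure_subset by blast
        note seg = segment_through_germ[OF z v d \<delta> \<epsilon>(1) this a]
        have "((\<lambda>t. (z + a *\<^sub>R d + \<epsilon> *\<^sub>R v) + t *\<^sub>R (v' - v))
            \<longlongrightarrow> (z + a *\<^sub>R d + \<epsilon> *\<^sub>R v) + 0 *\<^sub>R (v' - v)) (at_right 0)"
          by (intro tendsto_intros)
        then have inside: "\<forall>\<^sub>F t in at_right 0. (z + a *\<^sub>R d + \<epsilon> *\<^sub>R v) + t *\<^sub>R (v' - v) \<in> interior \<sigma>"
          by (rule topological_tendstoD) (use seg(2) in auto)
        have small: "\<forall>\<^sub>F t in at_right 0. t \<in> {0<..<\<epsilon>}"
          by (rule eventually_at_right_real) (rule \<epsilon>)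
        have "\<forall>\<^sub>F t in at_right 0. (z + a *\<^sub>R d + \<epsilon> *\<^sub>R v) + t *\<^sub>R (v' - v) \<in> cls (germ z v')"
          using perturb[OF seg(1), of "v' - v"] inside small
        proof eventually_elim
          case (elim t)
          then have t: "0 < t" "t < \<epsilon>" by auto
          have "z + \<epsilon> *\<^sub>R v + t *\<^sub>R (v' - v) = z + \<epsilon> *\<^sub>R (v + (t / \<epsilon>) *\<^sub>R (v' - v))"
            using \<epsilon>(1) by (simp add: scaleR_add_right)
          also have "\<kappa> \<dots> = germ z v'" using e(2)[of \<epsilon> "t / \<epsilon>"] \<epsilon> t by simp
          finally show ?case using elim interior_subset by (auto simp: cls_def)
        qed
        then show "z + a *\<^sub>R d + \<epsilon> *\<^sub>R v \<in> closure (cls (germ z v'))" by (rule mem_closure_if_eventually)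
      qed
      then have "z + a *\<^sub>R d \<in> closure (closure (cls (germ z v')))" by (rule mem_closure_if_eventually)
      then show ?thesis by simp
    qed
    show "line_in_germ z d v'"
      unfolding line_in_germ_def
      using main[of "\<delta> / 4"] main[of "- (\<delta> / 4)"] \<delta>(1) by (intro exI[of _ "\<delta> / 4"]) auto
  next
    assume "line_in_germ z d v'"
    then obtain \<delta> where \<delta>: "0 < \<delta>" "z + \<delta> *\<^sub>R d \<in> closure (cls (germ z v'))"
      "z - \<delta> *\<^sub>R d \<in> closure (cls (germ z v'))" by (auto simp: line_in_germ_def)
    have cl: "z + \<epsilon> *\<^sub>R v \<in> closure (cls (germ z v'))" if \<epsilon>: "0 < \<epsilon>" "\<epsilon> < e" for \<epsilon>
    proof (rule mem_closure_if_eventually)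
      have small: "\<forall>\<^sub>F t in at_right (0::real). t \<in> {0<..<1}" by (rule eventually_at_right_real) simp
      show "\<forall>\<^sub>F t in at_right 0. z + \<epsilon> *\<^sub>R v + t *\<^sub>R (\<epsilon> *\<^sub>R (v' - v)) \<in> cls (germ z v')"
        using small
      proof (rule eventually_mono)
        fix t :: real assume t: "t \<in> {0<..<1}"
        have eq: "z + \<epsilon> *\<^sub>R v + t *\<^sub>R (\<epsilon> *\<^sub>R (v' - v)) = z + \<epsilon> *\<^sub>R (v + t *\<^sub>R (v' - v))"
          by (simp add: scaleR_add_right mult.commute)
        have "z + \<epsilon> *\<^sub>R (v + t *\<^sub>R (v' - v)) \<in> \<sigma>" using \<epsilon> t by (intro \<sigma>_add z vs) auto
        then show "z + \<epsilon> *\<^sub>R v + t *\<^sub>R (\<epsilon> *\<^sub>R (v' - v)) \<in> cls (germ z v')"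
          unfolding eq
          using e(2)[of \<epsilon> t] \<epsilon> t unfolding cls_def by simp
      qed
    qed
    have main: "z + a *\<^sub>R d \<in> closure (cls (germ z v))" if a: "\<bar>a\<bar> = \<delta> / 4" for a
    proof -
      have "\<forall>\<^sub>F \<epsilon> in at_right 0. z + a *\<^sub>R d + \<epsilon> *\<^sub>R v \<in> cls (germ z v)"
        using E_ev
      proof (rule eventually_mono)
        fix \<epsilon> assume "\<epsilon> \<in> {0<..<E}"
        then have \<epsilon>: "0 < \<epsilon>" "2 * \<epsilon> < e" "\<epsilon> < e'" by (auto simp: E_def)
        have "z + (2 * \<epsilon>) *\<^sub>R v \<in> closure (cls (germ z v'))" using \<epsilon> by (intro cl) auto
        note seg = segment_through_germ[OF z v d \<delta> \<epsilon>(1) this a]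
        then show "z + a *\<^sub>R d + \<epsilon> *\<^sub>R v \<in> cls (germ z v)"
          using e'(2)[OF \<epsilon>(1,3)] interior_subset by (auto simp: cls_def)
      qed
      then show ?thesis by (rule mem_closure_if_eventually)
    qed
    show "line_in_germ z d v"
      unfolding line_in_germ_def
      using main[of "\<delta> / 4"] main[of "- (\<delta> / 4)"] \<delta>(1) by (intro exI[of _ "\<delta> / 4"]) auto
  qed
qed

lemma line_in_germ_constant:
  assumes z: "z \<in> \<sigma>" and d: "d \<noteq> 0" and v: "v \<in> interior \<sigma>" and v': "v' \<in> interior \<sigma>"
    and line: "line_in_germ z d v"
  shows "line_in_germ z d v'"
proof (rule connected_induction_simple[of "interior \<sigma>" v v' "line_in_germ z d"])
  show "connected (interior \<sigma>)" by (intro convex_connected convex_interior convex_\<sigma>)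
  fix a assume a: "a \<in> interior \<sigma>"
  define U where "U = (\<Inter>h\<in>{h \<in> H. wt a h \<noteq> 0}. {x. 0 < (wt a h *\<^sub>R real_vec h) \<bullet> x})"
  have "open U" unfolding U_def
    using finite_H by (intro open_INT ballI open_halfspace_gt) auto
  moreover have "a \<in> U" by (auto simp: U_def inner_commute zero_less_mult_iff)
  moreover have iff: "line_in_germ z d a \<longleftrightarrow> line_in_germ z d x" if "x \<in> interior \<sigma>" "x \<in> U" for x
    using that by (intro line_in_germ_locally_constant[OF z d a]) (auto simp: U_def inner_commute)
  ultimately show "\<exists>T. openin (top_of_set (interior \<sigma>)) T \<and> a \<in> T \<and>
      (\<forall>x\<in>T. \<forall>y\<in>T. line_in_germ z d x \<longrightarrow> line_in_germ z d y)"
    using a by (intro exI[of _ "interior \<sigma> \<inter> U"] conjI openin_open_Int ballI impI) blast+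
qed (use v v' line in auto)

lemma rel_interior_meets_interior:
  assumes "cls k \<inter> interior \<sigma> \<noteq> {}"
  obtains v where "v \<in> rel_interior (cls k)" "v \<in> interior \<sigma>"
proof -
  obtain w where w: "w \<in> cls k" "w \<in> interior \<sigma>" using assms by auto
  then obtain v where v: "v \<in> rel_interior (cls k)"
    using rel_interior_eq_empty[OF convex_cls] by blast
  have v\<sigma>: "v \<in> closure \<sigma>"
    using v rel_interior_subset closure_subset by (force simp: cls_def)
  show ?thesis
  proof (cases "v = w")
    case True
    then show ?thesis using that v w by blast
  next
    case False
    then obtain p where p: "p \<in> open_segment v w" by (metis all_not_in_conv open_segment_eq_empty)
    have "p \<in> rel_interior (cls k)"
      using rel_interior_closure_convex_segment[OF convex_cls v] w(1) closure_subset p by blast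
    moreover have "p \<in> interior \<sigma>"
      using in_interior_closure_convex_segment[OF convex_\<sigma> w(2) v\<sigma>] p by (auto simp: open_segment_commute)
    ultimately show ?thesis by (rule that)
  qed
qed

text \<open>
  On a segment inside the first closure the points of the second closure form a closed set. It is open
  in the open segment as well, since the property \<open>line_in_germ\<close> passes from an interior vector of
  the first class to one of the second.
\<close>

theorem closure_cls_Int_face:
  assumes k1: "cls k1 \<inter> interior \<sigma> \<noteq> {}" and k2: "cls k2 \<inter> interior \<sigma> \<noteq> {}"
  shows "(closure (cls k1) \<inter> closure (cls k2)) face_of closure (cls k1)"
proof -
  let ?C1 = "closure (cls k1)" and ?C2 = "closure (cls k2)"
  have conv: "convex (closure (cls k))" for k by (intro convex_closure convex_cls)
  obtain v1 where v1: "v1 \<in> rel_interior (cls k1)" "v1 \<in> interior \<sigma>"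
    by (rule rel_interior_meets_interior[OF k1])
  obtain v2 where v2: "v2 \<in> rel_interior (cls k2)" "v2 \<in> interior \<sigma>"
    by (rule rel_interior_meets_interior[OF k2])
  have end_mem: "a \<in> ?C2"
    if a: "a \<in> ?C1" and b: "b \<in> ?C1" and x: "x \<in> ?C2" and seg: "x \<in> open_segment a b" for a b x
  proof -
    define \<phi> where "\<phi> r = a + r *\<^sub>R (b - a)" for r :: real
    have ab: "b - a \<noteq> 0" using seg by auto
    have \<phi>1: "\<phi> r \<in> ?C1" if "0 \<le> r" "r \<le> 1" for r
      using convexD[OF conv a b, of "1 - r" r] that by (simp add: \<phi>_def algebra_simps)
    have \<phi>_shift: "\<phi> (r + s) = \<phi> r + s *\<^sub>R (b - a)" for r s by (simp add: \<phi>_def algebra_simps)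
    obtain r0 where r0: "0 < r0" "r0 < 1" "x = \<phi> r0"
      using seg by (auto simp: in_segment \<phi>_def algebra_simps)
    have nbhd: "\<exists>e>0. \<forall>s. \<bar>s\<bar> < e \<longrightarrow> \<phi> (r + s) \<in> ?C2" if r: "0 < r" "r < 1" and z: "\<phi> r \<in> ?C2" for r
    proof -
      have z1: "\<phi> r \<in> ?C1" using r by (intro \<phi>1) auto
      have z\<sigma>: "\<phi> r \<in> \<sigma>" using z closure_cls_subset by blast
      define \<delta> where "\<delta> = min r (1 - r)"
      have \<delta>: "0 < \<delta>" "\<delta> \<le> r" "\<delta> \<le> 1 - r" using r by (auto simp: \<delta>_def)
      have "\<phi> (r + \<delta>) \<in> ?C1" "\<phi> (r + (- \<delta>)) \<in> ?C1" using \<delta> r by (auto intro!: \<phi>1)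
      then have "line_in_germ (\<phi> r) (b - a) v1"
        unfolding line_in_germ_def germ_closure_cls[OF z1 v1(1)] \<phi>_shift using \<delta>(1) by auto
      then have "line_in_germ (\<phi> r) (b - a) v2"
        by (rule line_in_germ_constant[OF z\<sigma> ab v1(2) v2(2)])
      then obtain e where e: "0 < e" "\<phi> (r + e) \<in> ?C2" "\<phi> (r + (- e)) \<in> ?C2"
        unfolding line_in_germ_def germ_closure_cls[OF z v2(1)] \<phi>_shift by auto
      have "\<phi> (r + s) \<in> ?C2" if s: "\<bar>s\<bar> < e" for s
      proof -
        define t where "t = 1 / 2 + s / (2 * e)"
        have t: "0 \<le> t" "t \<le> 1" using s e(1) by (auto simp: t_def abs_less_iff field_simps)
        have "(1 - t) *\<^sub>R \<phi> (r + (- e)) + t *\<^sub>R \<phi> (r + e) \<in> ?C2"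
          using convexD[OF conv e(3,2), of "1 - t" t] t by simp
        also have "(1 - t) *\<^sub>R \<phi> (r + (- e)) + t *\<^sub>R \<phi> (r + e) = \<phi> (r + (2 * t - 1) * e)"
          by (simp add: \<phi>_def vec_eq_iff algebra_simps)
        also have "(2 * t - 1) * e = s" using e(1) by (simp add: t_def field_simps)
        finally show ?thesis .
      qed
      then show ?thesis using e(1) by blast
    qed
    have cont: "closed {r. \<phi> r \<in> ?C2}"
    proof -
      have "continuous_on UNIV \<phi>" unfolding \<phi>_def by (intro continuous_intros)
      then have "closed (\<phi> -` ?C2)" by (intro closed_vimage closed_closure)
      then show ?thesis by (simp add: vimage_def)
    qed
    have all: "\<phi> r \<in> ?C2" if r: "0 < r" "r < 1" for r
    proof (rule connected_induction_simple[of "{0<..<1::real}" r0 r "\<lambda>r. \<phi> r \<in> ?C2"])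
      fix s :: real assume s: "s \<in> {0<..<1}"
      show "\<exists>T. openin (top_of_set {0<..<1}) T \<and> s \<in> T \<and>
          (\<forall>x\<in>T. \<forall>y\<in>T. \<phi> x \<in> ?C2 \<longrightarrow> \<phi> y \<in> ?C2)"
      proof (cases "\<phi> s \<in> ?C2")
        case True
        then obtain e where e: "0 < e" "\<And>t. \<bar>t\<bar> < e \<Longrightarrow> \<phi> (s + t) \<in> ?C2"
          using nbhd[of s] s by auto
        have "\<phi> y \<in> ?C2" if "y \<in> ball s e" for y
          using e(2)[of "y - s"] that by (simp add: dist_real_def abs_minus_commute)
        moreover have "s \<in> {0<..<1} \<inter> ball s e" using s e(1) by simp
        moreover have "openin (top_of_set {0<..<1}) ({0<..<1} \<inter> ball s e)"
          by (intro openin_open_Int open_ball)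
        ultimately show ?thesis
          by (intro exI[of _ "{0<..<1} \<inter> ball s e"]) simp
      next
        case False
        then have "s \<in> {0<..<1} \<inter> - {r. \<phi> r \<in> ?C2}" using s by simp
        moreover have "openin (top_of_set {0<..<1}) ({0<..<1} \<inter> - {r. \<phi> r \<in> ?C2})"
          using cont by (intro openin_open_Int) (simp add: open_closed)
        ultimately show ?thesis
          by (intro exI[of _ "{0<..<1} \<inter> - {r. \<phi> r \<in> ?C2}"]) simp
      qed
    qed (use r0 x r in auto)
    have "\<forall>\<^sub>F t in at_right 0. a + t *\<^sub>R (b - a) \<in> ?C2"
    proof (rule eventually_mono)
      show "\<forall>\<^sub>F t in at_right (0::real). t \<in> {0<..<1}" by (rule eventually_at_right_real) simp
      show "a + t *\<^sub>R (b - a) \<in> ?C2" if "t \<in> {0<..<1}" for t using all[of t] that by (simp add: \<phi>_def)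
    qed
    then have "a \<in> closure ?C2" by (rule mem_closure_if_eventually)
    then show ?thesis by simp
  qed
  show ?thesis
    unfolding face_of_def
  proof (intro conjI ballI impI)
    show "convex (?C1 \<inter> ?C2)" by (intro convex_Int conv)
    fix a b x assume a: "a \<in> ?C1" and b: "b \<in> ?C1" and x: "x \<in> ?C1 \<inter> ?C2" and seg: "x \<in> open_segment a b"
    show "a \<in> ?C1 \<inter> ?C2" using end_mem[OF a b _ seg] x a by auto
    show "b \<in> ?C1 \<inter> ?C2" using end_mem[OF b a, of x] seg x b by (auto simp: open_segment_commute)
  qed auto
qed

text \<open>
  Perturbing by a fixed interior vector \<open>v\<close> moves equivalent points to equivalent points.
\<close>

lemma cls_subset_interior_class:
  assumes u: "u \<in> \<sigma>"
  obtains k where "cls k \<inter> interior \<sigma> \<noteq> {}" "cls (\<kappa> u) \<subseteq> closure (cls k)"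
proof -
  obtain v where v: "v \<in> interior \<sigma>" using interior_ne by auto
  have v\<sigma>: "v \<in> \<sigma>" using v interior_subset by auto
  have pos: "\<forall>\<^sub>F t::real in at_right 0. 0 < t" by (simp add: eventually_at_right_less)
  show ?thesis
  proof (rule that)
    obtain \<epsilon> where "0 < \<epsilon>" "\<kappa> (u + \<epsilon> *\<^sub>R v) = germ u v" by (rule eventually_at_rightE[OF germ])
    moreover from this have "u + \<epsilon> *\<^sub>R v \<in> interior \<sigma>" using interior_add[OF u v] by simp
    ultimately show "cls (germ u v) \<inter> interior \<sigma> \<noteq> {}" using interior_subset by (auto simp: cls_def)
    show "cls (\<kappa> u) \<subseteq> closure (cls (germ u v))"
    proof
      fix u' assume u': "u' \<in> cls (\<kappa> u)"
      then have "\<kappa> u' = \<kappa> u" "u' \<in> \<sigma>" by (auto simp: cls_def)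
      have "\<forall>\<^sub>F \<epsilon> in at_right 0. u' + \<epsilon> *\<^sub>R v \<in> cls (germ u v)"
        using perturb[OF \<open>\<kappa> u' = \<kappa> u\<close>, of v] germ[of u v] pos
        by eventually_elim (auto simp: cls_def intro: \<sigma>_add \<open>u' \<in> \<sigma>\<close> v\<sigma>)
      then show "u' \<in> closure (cls (germ u v))" by (rule mem_closure_if_eventually)
    qed
  qed
qed

definition closures :: "(real ^ 'n) set set" where
  "closures = (\<lambda>u. closure (cls (\<kappa> u))) ` \<sigma>"

lemma finite_closures: "finite closures"
proof -
  have "closures = (\<lambda>k. closure (cls k)) ` \<kappa> ` \<sigma>" by (auto simp: closures_def)
  then show ?thesis using finite_classes by simp
qed

lemma maximal_closure:
  assumes C: "C \<in> closures" and max: "\<forall>D\<in>closures. \<not> C \<subset> D"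
  obtains k where "C = closure (cls k)" "cls k \<inter> interior \<sigma> \<noteq> {}"
proof -
  obtain u where u: "u \<in> \<sigma>" "C = closure (cls (\<kappa> u))" using C by (auto simp: closures_def)
  obtain k where k: "cls k \<inter> interior \<sigma> \<noteq> {}" "cls (\<kappa> u) \<subseteq> closure (cls k)"
    by (rule cls_subset_interior_class[OF u(1)])
  have "closure (cls k) \<in> closures" using k(1) by (auto simp: closures_def cls_def)
  moreover have "C \<subseteq> closure (cls k)" using k(2) u(2) by (simp add: closure_minimal)
  ultimately have "C = closure (cls k)" using max by blast
  then show ?thesis using that k(1) by blast
qed

lemma subset_maximal_closure:
  assumes "C \<in> closures"
  obtains D where "D \<in> closures" "\<forall>E\<in>closures. \<not> D \<subset> E" "C \<subseteq> D"
  using finite_has_maximal2[OF finite_closures assms] by (metis psubset_eq)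

lemma rational_closures: "C \<in> closures \<Longrightarrow> rational_polyhedral_cone C"
  using rational_closure_cls by (auto simp: closures_def)

text \<open>
  Maximal closures belong to classes that meet the interior, so they intersect in common faces; for
  faces \<open>F\<close> and \<open>G\<close> of two of them, \<open>F \<inter> G\<close> is an intersection of two faces of the common face. The
  closure of any class that meets the interior equals its intersection with a maximal closure that
  contains it, and so is a face of the latter.
\<close>

theorem fan_of_closures:
  "polyhedral_fan (fan_defined_by closures)"
  "subdivides (fan_defined_by closures) \<sigma>"
  "\<And>u. u \<in> \<sigma> \<Longrightarrow> cls (\<kappa> u) \<inter> interior \<sigma> \<noteq> {} \<Longrightarrow> closure (cls (\<kappa> u)) \<in> fan_defined_by closures"
proof -
  have conv: "convex C" if "C \<in> closures" for C
    using rational_polyhedral_cone_convex_cone[OF rational_closures[OF that]] by (simp add: convex_cone_def)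
  have sub: "C \<subseteq> \<sigma>" if "C \<in> closures" for C
    using that closure_cls_subset by (auto simp: closures_def)
  have fanD: "\<exists>C. C \<in> closures \<and> (\<forall>D\<in>closures. \<not> C \<subset> D) \<and> F face_of C \<and> F \<noteq> {}"
    if "F \<in> fan_defined_by closures" for F
    using that by (auto simp: fan_defined_by_def)
  have fan_sub: "F \<subseteq> \<sigma>" if F: "F \<in> fan_defined_by closures" for F
  proof -
    obtain C where "C \<in> closures" "F face_of C" using fanD[OF F] by blast
    then show ?thesis using sub[of C] face_of_imp_subset[of F C] by simp
  qed
  show "polyhedral_fan (fan_defined_by closures)"
    unfolding polyhedral_fan_def
  proof (intro conjI ballI allI impI)
    have "fan_defined_by closures \<subseteq> (\<Union>C\<in>closures. {F. F face_of C})"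
      by (auto simp: fan_defined_by_def)
    moreover have "finite (\<Union>C\<in>closures. {F. F face_of C})"
      using finite_closures rational_closures
      by (auto intro!: finite_polyhedron_faces rational_polyhedral_cone_polyhedron)
    ultimately show "finite (fan_defined_by closures)" by (rule finite_subset)
  next
    fix F assume F: "F \<in> fan_defined_by closures"
    show rat: "rational_polyhedral_cone F"
      using fanD[OF F] rational_polyhedral_cone_face[OF rational_closures] by blast
    have "0 \<in> F" using rat by (intro convex_cone_contains_0 rational_polyhedral_cone_convex_cone)
    moreover have "F \<subseteq> \<sigma>" using F by (rule fan_sub)
    ultimately show "strongly_convex F"
      using pointed by (force simp: strongly_convex_def)
    fix G assume "G face_of F \<and> G \<noteq> {}"
    with F show "G \<in> fan_defined_by closures"
      by (auto simp: fan_defined_by_def intro: face_of_trans)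
  next
    fix F G assume F: "F \<in> fan_defined_by closures" and G: "G \<in> fan_defined_by closures"
    obtain C where C: "C \<in> closures" "\<forall>D\<in>closures. \<not> C \<subset> D" "F face_of C" using fanD[OF F] by blast
    obtain D where D: "D \<in> closures" "\<forall>E\<in>closures. \<not> D \<subset> E" "G face_of D" using fanD[OF G] by blast
    obtain k where k: "C = closure (cls k)" "cls k \<inter> interior \<sigma> \<noteq> {}" by (rule maximal_closure[OF C(1,2)])
    obtain l where l: "D = closure (cls l)" "cls l \<inter> interior \<sigma> \<noteq> {}" by (rule maximal_closure[OF D(1,2)])
    have CD: "(C \<inter> D) face_of C" and DC: "(C \<inter> D) face_of D"
      using closure_cls_Int_face[OF k(2) l(2)] closure_cls_Int_face[OF l(2) k(2)]
      by (auto simp: k(1) l(1) Int_commute)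
    have FG: "F \<inter> G \<subseteq> C \<inter> D" using C(3) D(3) face_of_imp_subset by blast
    have "(F \<inter> (C \<inter> D)) face_of (C \<inter> D)"
      by (rule face_of_subset[OF face_of_Int[OF C(3) CD]]) auto
    moreover have "(G \<inter> (C \<inter> D)) face_of (C \<inter> D)"
      by (rule face_of_subset[OF face_of_Int[OF D(3) DC]]) auto
    ultimately have "((F \<inter> (C \<inter> D)) \<inter> (G \<inter> (C \<inter> D))) face_of (C \<inter> D)" by (rule face_of_Int)
    moreover have "(F \<inter> (C \<inter> D)) \<inter> (G \<inter> (C \<inter> D)) = F \<inter> G" using FG by blast
    ultimately have *: "(F \<inter> G) face_of (C \<inter> D)" by simp
    show "(F \<inter> G) face_of F"
      by (rule face_of_subset[OF face_of_trans[OF * CD]]) (use C(3) face_of_imp_subset in auto)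
    show "(F \<inter> G) face_of G"
      by (rule face_of_subset[OF face_of_trans[OF * DC]]) (use D(3) face_of_imp_subset in auto)
  qed
  show "subdivides (fan_defined_by closures) \<sigma>"
    unfolding subdivides_def
  proof
    show "\<Union>(fan_defined_by closures) \<subseteq> \<sigma>"
    proof
      fix x assume "x \<in> \<Union>(fan_defined_by closures)"
      then obtain F where F: "F \<in> fan_defined_by closures" "x \<in> F" by auto
      then show "x \<in> \<sigma>" using fan_sub[OF F(1)] by blast
    qed
    show "\<sigma> \<subseteq> \<Union>(fan_defined_by closures)"
    proof
      fix u assume u: "u \<in> \<sigma>"
      then have "closure (cls (\<kappa> u)) \<in> closures" by (auto simp: closures_def)
      then obtain D where D: "D \<in> closures" "\<forall>E\<in>closures. \<not> D \<subset> E" "closure (cls (\<kappa> u)) \<subseteq> D"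
        by (rule subset_maximal_closure)
      have "u \<in> closure (cls (\<kappa> u))" using u closure_subset by (force simp: cls_def)
      then have uD: "u \<in> D" using D(3) by blast
      moreover have "D face_of D" using conv[OF D(1)] by (rule face_of_refl)
      ultimately have "D \<in> fan_defined_by closures"
        using D(1,2) unfolding fan_defined_by_def by blast
      then show "u \<in> \<Union>(fan_defined_by closures)" using uD by blast
    qed
  qed
  fix u assume u: "u \<in> \<sigma>" and ne: "cls (\<kappa> u) \<inter> interior \<sigma> \<noteq> {}"
  have "closure (cls (\<kappa> u)) \<in> closures" using u by (auto simp: closures_def)
  then obtain D where D: "D \<in> closures" "\<forall>E\<in>closures. \<not> D \<subset> E" "closure (cls (\<kappa> u)) \<subseteq> D"
    by (rule subset_maximal_closure)
  obtain k where k: "D = closure (cls k)" "cls k \<inter> interior \<sigma> \<noteq> {}" by (rule maximal_closure[OF D(1,2)])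
  have "(D \<inter> closure (cls (\<kappa> u))) face_of D" unfolding k(1) by (rule closure_cls_Int_face[OF k(2) ne])
  moreover have "D \<inter> closure (cls (\<kappa> u)) = closure (cls (\<kappa> u))" using D(3) by blast
  moreover have "closure (cls (\<kappa> u)) \<noteq> {}" using ne by auto
  ultimately show "closure (cls (\<kappa> u)) \<in> fan_defined_by closures"
    using D(1,2) unfolding fan_defined_by_def mem_Collect_eq by metis
qed

end

section \<open>Initial ideals as initial spaces\<close>

context cone_monoid
begin

lemma mem_S_iff: "\<alpha> \<in> S \<longleftrightarrow> real_vec \<alpha> \<in> dual_cone cone"
proof
  assume "\<alpha> \<in> S"
  then show "real_vec \<alpha> \<in> dual_cone cone" using wt_nonneg by (auto simp: dual_cone_def)
next
  assume \<alpha>: "real_vec \<alpha> \<in> dual_cone cone"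
  have "0 \<le> idot b \<alpha>" if "b \<in> B" for b
  proof -
    have "real_vec b \<in> cone" unfolding cone_def using that by (intro hull_inc) auto
    then have "0 \<le> wt (real_vec b) \<alpha>" using \<alpha> by (auto simp: dual_cone_def)
    then show ?thesis by (simp add: wt_real_vec)
  qed
  then show "\<alpha> \<in> S" by (simp add: S_def)
qed

lemma carrier_toric_ring: "carrier (toric_ring cone) = supported_on S"
  by (auto simp: toric_ring_def supported_on_def mem_S_iff)

lemma minus_toric_ring:
  fixes x :: "(int ^ 'n) \<Rightarrow>\<^sub>0 'k::field"
  assumes "x \<in> carrier (toric_ring cone)"
  shows "\<ominus>\<^bsub>toric_ring cone\<^esub> x = - x"
proof -
  interpret cring "toric_ring cone :: ((int ^ 'n) \<Rightarrow>\<^sub>0 'k) ring" by (rule cring_toric_ring)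
  have "- x \<in> carrier (toric_ring cone)"
    using assms additive_groupD(3)[OF additive_group_supported_on, of x S] by (simp add: carrier_toric_ring)
  moreover have "x \<oplus>\<^bsub>toric_ring cone\<^esub> (- x) = \<zero>\<^bsub>toric_ring cone\<^esub>" by (simp add: toric_ring_def)
  ultimately show ?thesis using assms by (metis add.inv_comm minus_equality)
qed

lemma monoid_ideal_iff_ideal:
  fixes J :: "((int ^ 'n) \<Rightarrow>\<^sub>0 'k::field) set"
  shows "monoid_ideal J \<longleftrightarrow> ideal J (toric_ring cone)"
proof
  let ?R = "toric_ring cone :: ((int ^ 'n) \<Rightarrow>\<^sub>0 'k) ring"
  interpret cring ?R by (rule cring_toric_ring)
  {
    assume "ideal J ?R"
    then interpret J: ideal J ?R .
    show "monoid_ideal J"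
      unfolding monoid_ideal_def
    proof (intro conjI ballI allI)
      have JS: "J \<subseteq> carrier ?R" by (rule J.a_subset)
      then show "J \<subseteq> supported_on S" by (simp add: carrier_toric_ring)
      show "additive_group J"
        unfolding additive_group_def
      proof (intro conjI ballI)
        show "0 \<in> J" using J.zero_closed by (simp add: toric_ring_def)
        fix f g assume f: "f \<in> J" and g: "g \<in> J"
        have "\<ominus>\<^bsub>?R\<^esub> g \<in> J" using g by (rule J.a_inv_closed)
        then have "- g \<in> J" using g JS by (simp add: minus_toric_ring subsetD)
        with f have "f \<oplus>\<^bsub>?R\<^esub> (- g) \<in> J" by (rule J.a_closed)
        then show "f - g \<in> J" by (simp add: toric_ring_def)
      qed
      fix f \<gamma> and c :: 'k assume f: "f \<in> J" and \<gamma>: "\<gamma> \<in> S"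
      have "single \<gamma> c \<in> carrier ?R"
        using \<gamma> by (auto simp: carrier_toric_ring supported_on_def)
      with f have "single \<gamma> c \<otimes>\<^bsub>?R\<^esub> f \<in> J" by (rule J.I_l_closed)
      then show "single \<gamma> c * f \<in> J" by (simp add: toric_ring_def)
    qed
  }
  {
    assume J: "monoid_ideal J"
    note J' = monoid_idealD[OF J]
    have JS: "J \<subseteq> carrier ?R" using J'(2) by (simp add: carrier_toric_ring)
    have mult: "x * a \<in> J" if a: "a \<in> J" and x: "x \<in> carrier ?R" for a x
    proof -
      have "additive_group {x. x * a \<in> J}"
        using J'(1) by (auto simp: additive_group_def left_diff_distrib)
      moreover have "part (\<lambda>\<beta>. id \<beta> = \<alpha>) x \<in> {x. x * a \<in> J}" for \<alpha>
      proof -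
        have "part (\<lambda>\<beta>. id \<beta> = \<alpha>) x = single \<alpha> (lookup x \<alpha>)"
          by (intro poly_mapping_eqI) (auto simp: lookup_part lookup_single when_def)
        moreover have "single \<alpha> (lookup x \<alpha>) * a \<in> J"
        proof (cases "\<alpha> \<in> S")
          case True
          then show ?thesis by (rule J'(4)[OF a])
        next
          case False
          then have "lookup x \<alpha> = 0"
            using x by (simp add: carrier_toric_ring supported_on_iff)
          then show ?thesis using additive_groupD(1)[OF J'(1)] by simp
        qed
        ultimately show ?thesis by simp
      qed
      ultimately have "x \<in> {x. x * a \<in> J}" by (rule mem_if_parts_mem)
      then show ?thesis by simp
    qed
    show "ideal J ?R"
    proof (rule idealI)
      show "ring ?R" by (rule ring_axioms)
      show "subgroup J (add_monoid ?R)"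
      proof (rule add.subgroupI)
        show "J \<subseteq> carrier ?R" by (rule JS)
        show "J \<noteq> {}" using additive_groupD(1)[OF J'(1)] by auto
        show "\<ominus>\<^bsub>?R\<^esub> a \<in> J" if "a \<in> J" for a
          using that JS additive_groupD(3)[OF J'(1)] by (simp add: minus_toric_ring subsetD)
        show "a \<oplus>\<^bsub>?R\<^esub> b \<in> J" if "a \<in> J" "b \<in> J" for a b
          using that additive_groupD(4)[OF J'(1)] by (simp add: toric_ring_def)
      qed
      show "x \<otimes>\<^bsub>?R\<^esub> a \<in> J" if "a \<in> J" "x \<in> carrier ?R" for a x
        using mult[OF that] by (simp add: toric_ring_def)
      show "a \<otimes>\<^bsub>?R\<^esub> x \<in> J" if "a \<in> J" "x \<in> carrier ?R" for a x
        using mult[OF that] by (simp add: toric_ring_def mult.commute)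
    qed
  }
qed

text \<open>
  Multiples of initial forms by terms are again initial forms or zero, so their additive span is
  already an ideal.
\<close>

lemma initial_ideal_eq_initial_space:
  fixes J :: "((int ^ 'n) \<Rightarrow>\<^sub>0 'k::field) set"
  assumes J: "monoid_ideal J"
  shows "initial_ideal cone v J = initial_space (wt v) J"
proof
  let ?R = "toric_ring cone :: ((int ^ 'n) \<Rightarrow>\<^sub>0 'k) ring"
  interpret cring ?R by (rule cring_toric_ring)
  have mem: "initial_form v f \<in> initial_space (wt v) J" if "f \<in> J" for f
    using multiple_initial_form_mem[OF J that zero_in_S, of 1 v] by simp
  have I: "monoid_ideal (initial_space (wt v) J)" by (rule monoid_ideal_initial_space[OF J])
  show "initial_ideal cone v J \<subseteq> initial_space (wt v) J"
    unfolding initial_ideal_def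
    by (rule genideal_minimal) (use I mem in \<open>auto simp: monoid_ideal_iff_ideal\<close>)
  have sub: "initial_form v ` J \<subseteq> carrier ?R"
    using mem monoid_idealD(2)[OF I] by (auto simp: carrier_toric_ring)
  have gen: "monoid_ideal (initial_ideal cone v J)"
    unfolding initial_ideal_def monoid_ideal_iff_ideal by (rule genideal_ideal[OF sub])
  have self: "initial_form v f \<in> initial_ideal cone v J" if "f \<in> J" for f
    unfolding initial_ideal_def using genideal_self[OF sub] that by blast
  show "initial_space (wt v) J \<subseteq> initial_ideal cone v J"
  proof
    fix g assume g: "g \<in> initial_space (wt v) J"
    show "g \<in> initial_ideal cone v J"
    proof (rule mem_if_parts_mem[OF monoid_idealD(1)[OF gen]])
      fix a
      obtain f where f: "f \<in> J" "\<And>\<alpha>. wt v \<alpha> < a \<Longrightarrow> lookup f \<alpha> = 0"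
        "\<And>\<alpha>. wt v \<alpha> = a \<Longrightarrow> lookup f \<alpha> = lookup g \<alpha>"
        by (rule initial_spaceE[OF g, of a]) (rule that)
      show "part (\<lambda>\<alpha>. wt v \<alpha> = a) g \<in> initial_ideal cone v J"
      proof (cases "\<exists>m. m \<in> keys f \<and> wt v m = a")
        case True
        then obtain m where m: "m \<in> keys f" "wt v m = a" by blast
        have least: "wt v m \<le> wt v \<alpha>" if "\<alpha> \<in> keys f" for \<alpha>
          using f(2)[of \<alpha>] that m(2) by (force simp: in_keys_iff)
        have init: "initial_form v f = part (\<lambda>\<alpha>. wt v \<alpha> = wt v m) f"
          by (rule initial_form_leading[OF m(1) least])
        have "part (\<lambda>\<alpha>. wt v \<alpha> = a) g = initial_form v f"
          unfolding init m(2) by (intro poly_mapping_eqI) (simp add: lookup_part f(3))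
        then show ?thesis using self[OF f(1)] by simp
      next
        case False
        then have "part (\<lambda>\<alpha>. wt v \<alpha> = a) g = 0"
          by (intro poly_mapping_eqI) (auto simp: lookup_part f(3)[symmetric] in_keys_iff)
        then show ?thesis using additive_groupD(1)[OF monoid_idealD(1)[OF gen]] by simp
      qed
    qed
  qed
qed

end

theorem theorem1p1:
  fixes \<sigma> :: "(real ^ 'n) set"
    and J :: "((int ^ 'n) \<Rightarrow>\<^sub>0 'k::field) set"
  assumes "perfect_field TYPE('k)"
    and "rational_polyhedral_cone \<sigma>"
    and "strongly_convex \<sigma>"
    and "dim \<sigma> = CARD('n)"
    and "ideal J (toric_ring \<sigma>)"
  shows "finite (class_closures \<sigma> J)
    \<and> (\<forall>C\<in>class_closures \<sigma> J. rational_polyhedral_cone C)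
    \<and> polyhedral_fan (fan_defined_by (class_closures \<sigma> J))
    \<and> subdivides (fan_defined_by (class_closures \<sigma> J)) \<sigma>
    \<and> (\<forall>E\<in>\<sigma> // initial_equiv \<sigma> J. E \<inter> interior \<sigma> \<noteq> {} \<longrightarrow>
          closure E \<in> fan_defined_by (class_closures \<sigma> J))"
proof -
  obtain B :: "(int ^ 'n) set" where B: "finite B" and \<sigma>B: "\<sigma> = convex_cone hull (real_vec ` B)"
    using assms(2) by (auto simp: rational_polyhedral_cone_def)
  have convex: "convex \<sigma>" and zero: "0 \<in> \<sigma>"
    by (simp_all add: \<sigma>B convex_convex_cone_hull convex_cone_hull_contains_0)
  have full: "affine hull \<sigma> = UNIV"
    using assms(4) aff_dim_zero[of \<sigma>] zero by (simp add: hull_inc flip: aff_dim_eq_full)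
  have int_ne: "interior \<sigma> \<noteq> {}"
    using rel_interior_eq_empty[OF convex] rel_interior_interior[OF full] zero by auto
  interpret cone_monoid B
  proof
    show "finite B" by (rule B)
    fix \<alpha> :: "int ^ 'n" assume orth: "\<And>b. b \<in> B \<Longrightarrow> idot b \<alpha> = 0"
    have "convex_cone hull (real_vec ` B) \<subseteq> {x. real_vec \<alpha> \<bullet> x = 0}"
    proof (rule hull_minimal)
      show "real_vec ` B \<subseteq> {x. real_vec \<alpha> \<bullet> x = 0}"
        using orth wt_real_vec[of _ \<alpha>] by (auto simp: inner_commute)
      show "convex_cone {x. real_vec \<alpha> \<bullet> x = 0}" by (simp add: convex_cone_iff inner_add_right)
    qed
    then have sub: "\<sigma> \<subseteq> {x. real_vec \<alpha> \<bullet> x = 0}" by (simp add: \<sigma>B)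
    show "\<alpha> = 0"
    proof (rule ccontr)
      assume "\<alpha> \<noteq> 0"
      then have "real_vec \<alpha> \<noteq> 0" using inj_real_vec real_vec_zero by (metis injD)
      then have "interior {x. real_vec \<alpha> \<bullet> x = 0} = {}" by (rule interior_hyperplane)
      then show False using int_ne interior_mono[OF sub] by auto
    qed
  qed
  have \<sigma>: "cone = \<sigma>" by (simp add: cone_def \<sigma>B)
  have J: "monoid_ideal J" using assms(5) by (simp add: monoid_ideal_iff_ideal \<sigma>)
  define \<kappa> where "\<kappa> v = initial_space (wt v) J" for v
  have \<kappa>: "initial_ideal \<sigma> v J = \<kappa> v" for v
    using initial_ideal_eq_initial_space[OF J, of v] by (simp add: \<kappa>_def \<sigma>)
  obtain H :: "(int ^ 'n) set" where H: "finite H"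
    "\<And>v w. \<forall>h\<in>H. sgn (wt v h) = sgn (wt w h) \<Longrightarrow> initial_space (wt v) J = initial_space (wt w) J"
    by (rule finitely_many_sign_cells[OF J]) (rule that)
  interpret convex_classes \<sigma> \<kappa> H
  proof
    show "rational_polyhedral_cone \<sigma>" "strongly_convex \<sigma>" "interior \<sigma> \<noteq> {}" "finite H"
      by (fact assms(2) assms(3) int_ne H(1))+
    show "\<kappa> v = \<kappa> w" if "\<forall>h\<in>H. sgn (wt v h) = sgn (wt w h)" for v w
      using H(2)[OF that] by (simp add: \<kappa>_def)
    show "\<kappa> ((1 - t) *\<^sub>R u + t *\<^sub>R u') = \<kappa> u"
      if "u \<in> \<sigma>" "u' \<in> \<sigma>" "\<kappa> u = \<kappa> u'" "0 < t" "t < 1" for u u' t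
      using initial_space_convex[OF J, of u u' t] that by (simp add: \<kappa>_def \<sigma>)
    show "\<forall>\<^sub>F \<epsilon> in at_right 0. \<kappa> (a + \<epsilon> *\<^sub>R w) = \<kappa> (b + \<epsilon> *\<^sub>R w)" if "\<kappa> a = \<kappa> b" for a b w
      using initial_space_perturbed[OF J, of a w] initial_space_perturbed[OF J, of b w]
      by eventually_elim (use that in \<open>simp add: \<kappa>_def\<close>)
    show "\<forall>\<^sub>F s in at_right 0. \<kappa> (z + s *\<^sub>R d) = \<kappa> z"
      if "z \<in> interior \<sigma>" "v \<in> \<sigma>" "0 < \<eta>"
        "\<And>s \<epsilon>. \<bar>s\<bar> \<le> \<eta> \<Longrightarrow> 0 < \<epsilon> \<Longrightarrow> \<kappa> (z + s *\<^sub>R d + \<epsilon> *\<^sub>R v) = k" for z v d \<eta> k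
      using initial_space_collapse[OF J, of z v \<eta> d k] that by (simp add: \<kappa>_def \<sigma>)
  qed
  have equiv: "initial_equiv \<sigma> J `` {u} = cls (\<kappa> u)" if "u \<in> \<sigma>" for u
    using that by (auto simp: initial_equiv_def cls_def \<kappa>)
  have classes: "\<sigma> // initial_equiv \<sigma> J = (\<lambda>u. cls (\<kappa> u)) ` \<sigma>"
    using equiv by (auto simp: quotient_def)
  have closures: "class_closures \<sigma> J = closures"
    by (simp add: class_closures_def closures_def classes image_image)
  show ?thesis
    unfolding closures classes
    using finite_closures rational_closures fan_of_closures by auto
qed

end
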